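(* $$1+\frac{\pi}{3}+c_2\;\le\;\rho_2^2\;\le\;6.2195,$$ where $1+\frac{\pi}{3}+c_2\approx 5.5675$.
   Context: Let $\mathcal{C}$ be the unit circle in the Euclidean plane centered at the origin. For $n,k\in\mathbb{N}$, $k$ treasures are hidden at unknown points $\mathbf{T}=(T_1,\dots,T_k)\in\mathcal{C}^k$, and $n$ robots start at time $0$ at the origin. Each robot moves independently anywhere in the plane (not restricted to $\mathcal{C}$) with speed at most $1$. A treasure is discovered when the position of some robot coincides with it; upon discovery all robots instantly learn its location. A strategy specifies the motion of all $n$ robots, where at each time the motion may depend only on the information about treasures discovered so far; $\mathcal{S}_k^n$ is the set of all valid strategies for $n$ robots and $k$ treasures. For $S\in\mathcal{S}_k^n$ let $\rho_S(\mathbf{T})$ be the time required until every robot has individually visited (been at the location of) every treasure. Define $$\rho_k^n=\inf_{S\in\mathcal{S}_k^n}\ \sup_{\mathbf{T}\in\mathcal{C}^k}\rho_S(\mathbf{T}).$$ Separately, let $R=(1,0)$ and let $d(\cdot,\cdot)$ denote Euclidean distance. For $k\in\mathbb{N}$ define $$c_k=\sup_{(T_1,\dots,T_k)\in\mathcal{C}^k}\ \min_\sigma\Big(d(R,T_{\sigma(1)})+\sum_{i=2}^k d(T_{\sigma(i-1)},T_{\sigma(i)})\Big),$$ the minimum being over all permutations $\sigma$ of $\{1,\dots,k\}$. *)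

theory Defs
  imports "HOL-Analysis.Analysis" "HOL-Library.Multiset"
begin

text \<open>The Euclidean plane is the type \<^typ>\<open>complex\<close>, whose \<^const>\<open>dist\<close> is the Euclidean distance.\<close>

definition unit_circle :: "complex set" where
  "unit_circle = sphere 0 1"

definition placements :: "nat \<Rightarrow> (nat \<Rightarrow> complex) set" where
  "placements k = {1..k} \<rightarrow>\<^sub>E unit_circle"

text \<open>For \<open>n\<close> robots, \<open>X i t\<close> is the position of robot \<open>i \<in> {1..n}\<close> at time \<open>t \<ge> 0\<close>.
  Moving at speed at most 1 means being 1-Lipschitz in time.\<close>

definition admissible_motion :: "nat \<Rightarrow> (nat \<Rightarrow> real \<Rightarrow> complex) \<Rightarrow> bool" where
  "admissible_motion n X \<longleftrightarrow> (\<forall>i\<in>{1..n}. X i 0 = 0 \<and> 1-lipschitz_on {0..} (X i))"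

definition visited_by :: "(real \<Rightarrow> complex) \<Rightarrow> complex \<Rightarrow> real \<Rightarrow> bool" where
  "visited_by x p t \<longleftrightarrow> (\<exists>s\<in>{0..t}. x s = p)"

text \<open>The common knowledge at time \<open>t\<close>: the locations of all treasures found by some robot no
  later than \<open>t\<close>. Only locations are revealed, not the indices of the treasures; it is a multiset
  because treasures may share a location.\<close>

definition discovered ::
  "nat \<Rightarrow> nat \<Rightarrow> (nat \<Rightarrow> real \<Rightarrow> complex) \<Rightarrow> (nat \<Rightarrow> complex) \<Rightarrow> real \<Rightarrow> complex multiset" where
  "discovered n k X T t =
     image_mset T (mset_set {j\<in>{1..k}. \<exists>i\<in>{1..n}. visited_by (X i) (T j) t})"

text \<open>A strategy is given by its response: \<open>S T\<close> is the joint motion of the robots when the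
  treasures are at \<open>T\<close>. That the motion depends only on what has been discovered so far is
  non-anticipation: two placements with the same record of discoveries throughout \<open>[0,t]\<close> (locations
  and times) cannot be told apart at time \<open>t\<close>, so the robots are then at the same positions.\<close>

definition strategies ::
  "nat \<Rightarrow> nat \<Rightarrow> ((nat \<Rightarrow> complex) \<Rightarrow> nat \<Rightarrow> real \<Rightarrow> complex) set" where
  "strategies n k = {S.
     (\<forall>T\<in>placements k. admissible_motion n (S T)) \<and>
     (\<forall>T\<in>placements k. \<forall>T'\<in>placements k. \<forall>t\<ge>0.
        (\<forall>s\<in>{0..t}. discovered n k (S T) T s = discovered n k (S T') T' s) \<longrightarrow>
        (\<forall>i\<in>{1..n}. S T i t = S T' i t))}"

text \<open>Equal to \<open>\<infinity>\<close> if some robot never visits some treasure.\<close>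

definition completion_time ::
  "nat \<Rightarrow> nat \<Rightarrow> (nat \<Rightarrow> real \<Rightarrow> complex) \<Rightarrow> (nat \<Rightarrow> complex) \<Rightarrow> ereal" where
  "completion_time n k X T =
     Inf (ereal ` {t. 0 \<le> t \<and> (\<forall>i\<in>{1..n}. \<forall>j\<in>{1..k}. visited_by (X i) (T j) t)})"

definition rho :: "nat \<Rightarrow> nat \<Rightarrow> ereal" where
  "rho n k = (INF S\<in>strategies n k. SUP T\<in>placements k. completion_time n k (S T) T)"

text \<open>The length of a shortest path from \<open>(1,0)\<close> through \<open>k\<close> points of the circle, in the worst
  case; meaningful for \<open>k \<ge> 1\<close>.\<close>

definition path_const :: "nat \<Rightarrow> real" where
  "path_const k = (SUP T\<in>placements k.
     Min ((\<lambda>\<sigma>. dist (Complex 1 0) (T (\<sigma> 1)) + (\<Sum>i=2..k. dist (T (\<sigma> (i - 1))) (T (\<sigma> i))))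
          ` {\<sigma>. \<sigma> permutes {1..k}}))"

end

theory Submission
  imports Defs
begin

text \<open>
  Lower bound. Let the robots move until no treasure is ever found. Among the vertices of a regular
  1024-gon each robot reaches at most 127 before a time slightly below \<open>1 + pi / 4\<close>, so one of the 128
  inscribed octagons has at most one explored vertex at that time. From then on the seven other
  vertices form a finite game: every next visit to a fresh vertex is answered by placing both
  treasures at fresh vertices, by placing one treasure at the visited vertex, or by waiting. With
  rational lower bounds for the distances a short search shows that 3.79 more time units never
  suffice, which beats \<open>1 + pi / 3 + c\<^sub>2\<close>.

  Upper bound. Both robots go to \<open>1\<close> and sweep the circle in opposite directions until the first
  treasure is found at arc distance \<open>a\<close>. If \<open>a\<close> is small, the other robot crosses the chord to the
  treasure, returns along it and resumes its sweep; otherwise both just go on. When the second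
  treasure is found, every robot walks straight to what it still has to visit.
\<close>

section \<open>Indistinguishable placements\<close>

text \<open>A strategy responds only to actual placements, so there is no run without treasures to
  start from. Its substitute is the run with both treasures at the vertex that is found last: it
  learns nothing before every vertex in question has been visited. \<open>undiscovered_run\<close>
  and \<open>known_run\<close> supply such runs, and \<open>strategies_agree\<close> allows the
  adversary to exchange them for others as long as the difference is undetected. The game forgets
  where the robots are when the search ends: all its initial arrival bounds are 0. This relaxation
  makes it finite and purely integral. The numbers fit narrowly: search and game together give
  \<open>1.778 + 3.79 = 5.568\<close>, while the constant to be beaten is about
  \<open>5.56754\<close>. For the upper bound, \<open>6.2195\<close> is nearly attained in two
  scenarios: a fetch with \<open>a\<close> just below \<open>fetch_limit\<close> followed by a
  second discovery at the worst moment (\<open>evacuation_cost\<close>), and sweeping on from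
  \<open>a = fetch_limit\<close> (\<open>sweep_cost\<close>).\<close>

lemma lipschitz_agree_at_end:
  fixes x y :: "real \<Rightarrow> 'a::metric_space"
  assumes "1-lipschitz_on {0..} x" "1-lipschitz_on {0..} y" "0 < m" "\<And>s. 0 \<le> s \<Longrightarrow> s < m \<Longrightarrow> x s = y s"
  shows "x m = y m"
proof (rule ccontr)
  assume "x m \<noteq> y m"
  define e where "e = min m (dist (x m) (y m) / 3)"
  have e: "0 < e" "e \<le> m" "3 * e \<le> dist (x m) (y m)"
    using \<open>x m \<noteq> y m\<close> assms(3) by (auto simp: e_def min_def)
  have eq: "x (m - e) = y (m - e)" using assms(4)[of "m - e"] e by auto
  have "dist (x m) (y m) \<le> dist (x m) (x (m - e)) + dist (y (m - e)) (y m)"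
    using dist_triangle[of "x m" "y m" "x (m - e)"] unfolding eq by simp
  also have "\<dots> \<le> dist m (m - e) + dist (m - e) m"
    using lipschitz_onD[OF assms(1), of m "m - e"] lipschitz_onD[OF assms(2), of "m - e" m] e assms(3)
    by auto
  finally show False using e by (simp add: dist_real_def)
qed

text \<open>Non-anticipation alone is circular: equal positions at a time are forced only by equal
  records up to and including that time, which depend on those positions. The speed limit breaks the
  circle: after the infimum \<open>m\<close> of the times of disagreement no robot can reach a new
  treasure for a short while, so the equality propagates beyond \<open>m\<close>. In
  \<open>sep\<close>, being at \<open>T' j\<close> need be excluded for only one of the two runs,
  since such a visit is always moved to a time at which they agree.\<close>

lemma strategies_agree:
  assumes S: "S \<in> strategies n k" and T: "T \<in> placements k" "T' \<in> placements k"
    and sep: "\<And>j i s. j \<in> {1..k} \<Longrightarrow> T j \<noteq> T' j \<Longrightarrow> i \<in> {1..n} \<Longrightarrow> 0 \<le> s \<Longrightarrow> s < t \<Longrightarrow>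
      S T i s \<noteq> T j \<and> (S T i s \<noteq> T' j \<or> S T' i s \<noteq> T' j)"
    and i: "i \<in> {1..n}" and s: "0 \<le> s" "s \<le> t"
  shows "S T i s = S T' i s"
proof (rule ccontr)
  assume neq: "S T i s \<noteq> S T' i s"
  define D where "D = {s. 0 \<le> s \<and> s \<le> t \<and> (\<exists>i\<in>{1..n}. S T i s \<noteq> S T' i s)}"
  define m where "m = Inf D"
  have "s \<in> D" using neq i s unfolding D_def by blast
  then have D: "D \<noteq> {}" "bdd_below D" by (auto simp: D_def intro!: bdd_belowI[of _ 0])
  have adm: "admissible_motion n (S T)" "admissible_motion n (S T')"
    using S T by (auto simp: strategies_def)
  note lip = adm[unfolded admissible_motion_def, rule_format]
  have m0: "0 \<le> m" unfolding m_def using D by (intro cInf_greatest) (auto simp: D_def)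
  have before: "S T i r = S T' i r" if "i \<in> {1..n}" "0 \<le> r" "r < m" for i r
  proof (rule ccontr)
    assume "S T i r \<noteq> S T' i r"
    moreover have "r \<le> t"
    proof -
      obtain d where "d \<in> D" using D by auto
      then have "m \<le> d" "d \<le> t" unfolding m_def using D by (auto simp: cInf_lower D_def)
      then show ?thesis using that by simp
    qed
    ultimately have "r \<in> D" using that by (auto simp: D_def)
    then show False using that D by (auto simp: m_def dest: cInf_lower)
  qed
  have at: "S T i m = S T' i m" if "i \<in> {1..n}" for i
  proof (cases "m = 0")
    case True then show ?thesis using lip(1)[of i] lip(2)[of i] that by simp
  next
    case False
    show ?thesis
    proof (rule lipschitz_agree_at_end)
      show "1-lipschitz_on {0..} (S T i)" "1-lipschitz_on {0..} (S T' i)" using lip that by blast+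
      show "0 < m" using False m0 by simp
    qed (rule before[OF that])
  qed
  have upto: "S T i r = S T' i r" if "i \<in> {1..n}" "0 \<le> r" "r \<le> m" for i r
    using at[OF that(1)] before[OF that(1,2)] that(3) by (cases "r = m") auto
  have mt: "m < t"
  proof -
    obtain d where d: "d \<in> D" using D by auto
    then have "m \<le> d" "d \<le> t" unfolding m_def using D by (auto simp: cInf_lower D_def)
    moreover have "m \<notin> D" using at unfolding D_def by blast
    ultimately show ?thesis using d by (cases "m = d") auto
  qed
  \<comment> \<open>\<open>\<delta>\<close> will be the least positive distance at time
    \<open>m\<close> between a robot and a treasure of its own run, capped by \<open>t - m\<close>.
    At speed 1, no treasure that a robot is not already at can be reached in less time.\<close>
  define E where "E = {t - m} \<union> ((\<lambda>(i, j). dist (S T i m) (T j)) ` ({1..n} \<times> {1..k}) \<union>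
      (\<lambda>(i, j). dist (S T' i m) (T' j)) ` ({1..n} \<times> {1..k}) - {0})"
  define \<delta> where "\<delta> = Min E"
  have E: "finite E" "E \<noteq> {}" "\<And>e. e \<in> E \<Longrightarrow> 0 < e" using mt by (auto simp: E_def)
  have \<delta>_le: "\<And>e. e \<in> E \<Longrightarrow> \<delta> \<le> e" unfolding \<delta>_def using E(1) by simp
  have "t - m \<in> E" by (simp add: E_def)
  then have \<delta>: "0 < \<delta>" "m + \<delta> \<le> t"
    using E(3)[OF Min_in[OF E(1,2)]] \<delta>_le[of "t - m"] unfolding \<delta>_def by auto
  have stays: "S T i m = T j" if "i \<in> {1..n}" "j \<in> {1..k}" "m \<le> q" "q < m + \<delta>" "S T i q = T j" for i j q
  proof (rule ccontr)
    assume "S T i m \<noteq> T j"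
    then have "dist (S T i m) (T j) \<in> E"
      unfolding E_def using that(1,2) by (intro UnI2 DiffI UnI1 image_eqI[of _ _ "(i, j)"]) auto
    then have "\<delta> \<le> dist (S T i m) (T j)" by (rule \<delta>_le)
    moreover have "dist (S T i m) (S T i q) \<le> q - m"
      using lipschitz_onD[of 1 "{0..}" "S T i" m q] lip(1)[of i] that m0 by (auto simp: dist_real_def)
    ultimately show False using that by simp
  qed
  have stays': "S T' i m = T' j" if "i \<in> {1..n}" "j \<in> {1..k}" "m \<le> q" "q < m + \<delta>" "S T' i q = T' j" for i j q
  proof (rule ccontr)
    assume "S T' i m \<noteq> T' j"
    then have "dist (S T' i m) (T' j) \<in> E"
      unfolding E_def using that(1,2) by (intro UnI2 DiffI UnI2 image_eqI[of _ _ "(i, j)"]) auto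
    then have "\<delta> \<le> dist (S T' i m) (T' j)" by (rule \<delta>_le)
    moreover have "dist (S T' i m) (S T' i q) \<le> q - m"
      using lipschitz_onD[of 1 "{0..}" "S T' i" m q] lip(2)[of i] that m0 by (auto simp: dist_real_def)
    ultimately show False using that by simp
  qed
  have same: "S T i r = S T' i r" if r: "0 \<le> r" "r < m + \<delta>" and "i \<in> {1..n}" for i r
  proof -
    have rec: "discovered n k (S T) T q = discovered n k (S T') T' q" if q: "0 \<le> q" "q \<le> r" for q
    proof -
      have eqj: "T j = T' j" if j: "j \<in> {1..k}" and vis: "\<exists>i\<in>{1..n}. visited_by (S T i) (T j) q
          \<or> visited_by (S T' i) (T' j) q" for j
      proof (rule ccontr)
        assume ne: "T j \<noteq> T' j"
        obtain i w where i: "i \<in> {1..n}" and w: "0 \<le> w" "w \<le> q" and "S T i w = T j \<or> S T' i w = T' j"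
          using vis by (auto simp: visited_by_def)
        moreover have "S T i w \<noteq> T j" using sep[OF j ne i, of w] w q r \<delta> by auto
        ultimately have h: "S T' i w = T' j" by simp
        \<comment> \<open>A robot at a treasure during the interval from \<open>m\<close> to
          \<open>m + \<delta>\<close> was there already at time \<open>m\<close>, so the visit can
          be moved back to a time when both runs coincide.\<close>
        define w' where "w' = min w m"
        have "S T' i w' = T' j" using stays'[OF i j, of w] h w q r by (auto simp: w'_def min_def)
        moreover have "S T i w' = S T' i w'" using upto[OF i, of w'] w m0 by (auto simp: w'_def)
        moreover have "0 \<le> w'" "w' < t" using w m0 mt by (auto simp: w'_def)
        ultimately show False using sep[OF j ne i, of w'] by auto
      qed
      have "(\<exists>i\<in>{1..n}. visited_by (S T i) (T j) q) = (\<exists>i\<in>{1..n}. visited_by (S T' i) (T' j) q)"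
        if j: "j \<in> {1..k}" for j
      proof
        assume "\<exists>i\<in>{1..n}. visited_by (S T i) (T j) q"
        then obtain i w where i: "i \<in> {1..n}" and w: "0 \<le> w" "w \<le> q" and h: "S T i w = T j"
          by (auto simp: visited_by_def)
        have "visited_by (S T i) (T j) q" using w h by (auto simp: visited_by_def)
        then have e: "T j = T' j" using eqj[OF j] i by blast
        have "S T i (min w m) = T j" using stays[OF i j, of w] h w q r by (auto simp: min_def)
        then have "S T' i (min w m) = T' j" using upto[OF i, of "min w m"] w m0 e by auto
        then show "\<exists>i\<in>{1..n}. visited_by (S T' i) (T' j) q"
          using i w m0 unfolding visited_by_def by (intro bexI[of _ i] bexI[of _ "min w m"]) auto
      next
        assume "\<exists>i\<in>{1..n}. visited_by (S T' i) (T' j) q"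
        then obtain i w where i: "i \<in> {1..n}" and w: "0 \<le> w" "w \<le> q" and h: "S T' i w = T' j"
          by (auto simp: visited_by_def)
        have "visited_by (S T' i) (T' j) q" using w h by (auto simp: visited_by_def)
        then have e: "T j = T' j" using eqj[OF j] i by blast
        have "S T' i (min w m) = T' j" using stays'[OF i j, of w] h w q r by (auto simp: min_def)
        then have "S T i (min w m) = T j" using upto[OF i, of "min w m"] w m0 e by auto
        then show "\<exists>i\<in>{1..n}. visited_by (S T i) (T j) q"
          using i w m0 unfolding visited_by_def by (intro bexI[of _ i] bexI[of _ "min w m"]) auto
      qed
      then have sets: "{j\<in>{1..k}. \<exists>i\<in>{1..n}. visited_by (S T i) (T j) q} =
          {j\<in>{1..k}. \<exists>i\<in>{1..n}. visited_by (S T' i) (T' j) q}" by blast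
      show ?thesis unfolding discovered_def sets
      proof (rule image_mset_cong)
        fix j assume "j \<in># mset_set {j\<in>{1..k}. \<exists>i\<in>{1..n}. visited_by (S T' i) (T' j) q}"
        then have "j \<in> {1..k}" "\<exists>i\<in>{1..n}. visited_by (S T' i) (T' j) q" by auto
        then show "T j = T' j" using eqj[of j] by blast
      qed
    qed
    have nonant: "\<forall>T\<in>placements k. \<forall>T'\<in>placements k. \<forall>t\<ge>0.
        (\<forall>s\<in>{0..t}. discovered n k (S T) T s = discovered n k (S T') T' s) \<longrightarrow>
        (\<forall>i\<in>{1..n}. S T i t = S T' i t)"
      using S unfolding strategies_def by (rule CollectE) (erule conjunct2)
    have "\<forall>q\<in>{0..r}. discovered n k (S T) T q = discovered n k (S T') T' q"
    proof
      fix q assume "q \<in> {0..r}"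
      then have "0 \<le> q" "q \<le> r" unfolding atLeastAtMost_iff by blast+
      then show "discovered n k (S T) T q = discovered n k (S T') T' q" by (rule rec)
    qed
    then have "\<forall>i\<in>{1..n}. S T i r = S T' i r"
      by (rule nonant[THEN bspec, OF T(1), THEN bspec, OF T(2), THEN spec, THEN mp, OF r(1), THEN mp])
    then show ?thesis using that(3) by (rule bspec)
  qed
  have "m + \<delta> \<le> Inf D"
  proof (rule cInf_greatest[OF D(1)])
    fix d assume "d \<in> D"
    then obtain i where d: "0 \<le> d" "i \<in> {1..n}" "S T i d \<noteq> S T' i d" unfolding D_def by blast
    show "m + \<delta> \<le> d"
    proof (rule ccontr)
      assume "\<not> m + \<delta> \<le> d"
      then have "d < m + \<delta>" by simp
      from same[OF d(1) this d(2)] d(3) show False by blast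
    qed
  qed
  then have "m + \<delta> \<le> m" unfolding m_def .
  then show False using \<delta>(1) by linarith
qed

section \<open>First visits, and runs with a common past\<close>

text \<open>Meaningful only if some robot reaches \<open>p\<close>; otherwise the infimum is over the empty set.\<close>

definition hit :: "(nat \<Rightarrow> real \<Rightarrow> complex) \<Rightarrow> complex \<Rightarrow> real" where
  "hit X p = Inf {t. 0 \<le> t \<and> (\<exists>i\<in>{1..2}. X i t = p)}"

lemma hit_le: "0 \<le> t \<Longrightarrow> i \<in> {1..2} \<Longrightarrow> X i t = p \<Longrightarrow> hit X p \<le> t"
  unfolding hit_def by (rule cInf_lower) (auto intro!: bdd_belowI[of _ 0])

lemma hit_attained:
  assumes X: "admissible_motion 2 X" and "0 \<le> t" "i \<in> {1..2}" "X i t = p"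
  shows "0 \<le> hit X p" "\<exists>i\<in>{1..2}. X i (hit X p) = p"
proof -
  have "closed {t \<in> {0..}. X i t = p}" if "i \<in> {1..2}" for i
    using X that unfolding admissible_motion_def
    by (intro continuous_closed_preimage_constant) (auto dest: lipschitz_on_continuous_on)
  then have "closed (\<Union>i\<in>{1..2}. {t \<in> {0..}. X i t = p})" by (intro closed_UN) auto
  moreover have eq: "(\<Union>i\<in>{1..2}. {t \<in> {0..}. X i t = p}) = {t. 0 \<le> t \<and> (\<exists>i\<in>{1..2}. X i t = p)}"
    by auto
  ultimately have "hit X p \<in> {t. 0 \<le> t \<and> (\<exists>i\<in>{1..2}. X i t = p)}"
    unfolding hit_def
  proof (intro closed_contains_Inf)
    show "{t. 0 \<le> t \<and> (\<exists>i\<in>{1..2}. X i t = p)} \<noteq> {}" using assms(2-4) by blast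
  qed (auto intro: bdd_belowI[of _ 0])
  then show "0 \<le> hit X p" "\<exists>i\<in>{1..2}. X i (hit X p) = p" by auto
qed

text \<open>\<open>Y\<close> is typically the response to another placement, which departs from
  \<open>X\<close> once the difference has been discovered.\<close>

definition follows :: "(nat \<Rightarrow> real \<Rightarrow> complex) \<Rightarrow> (nat \<Rightarrow> real \<Rightarrow> complex) \<Rightarrow> real \<Rightarrow> bool" where
  "follows Y X m \<longleftrightarrow> admissible_motion 2 Y \<and> (\<forall>i\<in>{1..2}. \<forall>s\<in>{0..m}. Y i s = X i s)"

lemma follows_mono: "follows Y X m' \<Longrightarrow> m \<le> m' \<Longrightarrow> follows Y X m"
  by (auto simp: follows_def)

lemma follows_trans: "follows Y X' m \<Longrightarrow> follows X' X m \<Longrightarrow> follows Y X m"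
  by (auto simp: follows_def)

lemma follows_hit:
  assumes "follows Y X m" "m \<le> hit X p" "i \<in> {1..2}" "0 \<le> \<tau>" "Y i \<tau> = p"
  shows "m \<le> \<tau>"
proof (rule ccontr)
  assume "\<not> m \<le> \<tau>"
  then have "X i \<tau> = p" using assms by (auto simp: follows_def)
  then show False using hit_le[of \<tau> i X p] assms \<open>\<not> m \<le> \<tau>\<close> by auto
qed

lemma travel_time:
  assumes "admissible_motion n Y" "i \<in> {1..n}" "0 \<le> s" "s \<le> \<tau>" "Y i s = p" "Y i \<tau> = p'"
  shows "s + dist p p' \<le> \<tau>"
  using lipschitz_onD[of 1 "{0..}" "Y i" s \<tau>] assms by (auto simp: admissible_motion_def dist_real_def)

section \<open>The game on an octagon\<close>

text \<open>An entry \<open>(v, x, y)\<close> of a state says that vertex \<open>v\<close> is unvisited and that the two robots cannot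
  be there earlier than \<open>x\<close> and \<open>y\<close> thousandths of a time unit after the start of the game.\<close>

type_synonym arrivals = "(int \<times> int \<times> int) list"

text \<open>The chords \<open>2 * sin (k * pi / 8)\<close> of the unit circle in thousandths,
  rounded down so that they remain lower bounds.\<close>

definition oct_dist :: "int \<Rightarrow> int \<Rightarrow> int" where
  "oct_dist u v = (let k = \<bar>u - v\<bar> in
     if k = 1 \<or> k = 7 then 765 else if k = 2 \<or> k = 6 then 1414
     else if k = 3 \<or> k = 5 then 1847 else if k = 4 then 2000 else 0)"

definition budget :: int where "budget = 3790"

definition swap_robots :: "arrivals \<Rightarrow> arrivals" where
  "swap_robots = map (\<lambda>(v, x, y). (v, y, x))"

text \<open>The visiting robot continues from \<open>u\<close>, at time \<open>s\<close> at the
  earliest. The other robot gets the bound \<open>s\<close> because the visit to \<open>u\<close>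
  precedes the first visits to all remaining vertices.\<close>

definition after_visit :: "int \<Rightarrow> int \<Rightarrow> arrivals \<Rightarrow> arrivals" where
  "after_visit u s G = map (\<lambda>(v, x, y). (v, s + oct_dist u v, max y s))
     (filter (\<lambda>(v, x, y). v \<noteq> u) G)"

text \<open>The treasures are placed at \<open>B\<close> and \<open>C\<close>. Each robot needs at
  least the smaller of its two arrival bounds plus the distance between the treasures, and the later
  robot decides.\<close>

definition pair_exceeds :: "arrivals \<Rightarrow> bool" where
  "pair_exceeds G = list_ex (\<lambda>(B, x, y). list_ex (\<lambda>(C, x', y').
     budget \<le> max (min x x') (min y y') + oct_dist B C) G) G"

text \<open>The option is \<^const>\<open>None\<close> if the robot has already been at the known treasure \<open>A\<close>, and otherwise
  carries its earliest arrival there.\<close>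

definition with_known :: "int \<Rightarrow> int option \<Rightarrow> int \<Rightarrow> int \<Rightarrow> int" where
  "with_known A p u x = (case p of None \<Rightarrow> x | Some a \<Rightarrow> min x a + oct_dist u A)"

text \<open>The next event is caused by the robot with status \<open>p\<close>: a trip to the known
  treasure \<open>A\<close>, or a visit to a fresh vertex \<open>u\<close>. In the second case the
  adversary puts the second treasure at \<open>u\<close> if this makes the other robot late, and
  waits otherwise. Lateness of the visiting robot itself is tested in
  \<open>second_lost\<close>.\<close>

definition second_moves_lose ::
  "(int option \<Rightarrow> int option \<Rightarrow> arrivals \<Rightarrow> bool) \<Rightarrow> int \<Rightarrow> int option \<Rightarrow> int option \<Rightarrow> arrivals \<Rightarrow> bool" where
  "second_moves_lose L A p q G \<longleftrightarrow>
     (case p of None \<Rightarrow> True | Some s \<Rightarrow>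
        if budget \<le> s then True else L None q (after_visit A s G)) \<and>
     list_all (\<lambda>(u, s, y).
       if budget \<le> s \<or> budget \<le> with_known A (map_option (max s) q) u (max y s)
       then True
       else L (map_option (\<lambda>_. s + oct_dist u A) p) (map_option (max s) q) (after_visit u s G)) G"

text \<open>The number bounds the search depth. The adversary either wins at once by putting the
  second treasure at some fresh vertex, or has to answer every next event of either robot; events of
  the second robot are treated by exchanging the roles. An empty list is no win, because no place is
  left for the second treasure.\<close>

primrec second_lost :: "nat \<Rightarrow> int \<Rightarrow> int option \<Rightarrow> int option \<Rightarrow> arrivals \<Rightarrow> bool" where
  "second_lost 0 A p q G = False"
| "second_lost (Suc n) A p q G =
    (if G = [] then False
     else if list_ex (\<lambda>(u, x, y). budget \<le> with_known A p u x \<or> budget \<le> with_known A q u y) G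
     then True
     else if second_moves_lose (second_lost n A) A p q G
     then second_moves_lose (second_lost n A) A q p (swap_robots G) else False)"

text \<open>The three answers to a visit are tried in the order both treasures elsewhere, waiting, a
  treasure at \<open>u\<close>. In the last case the visitor is done with \<open>u\<close>, hence
  \<open>None\<close>. Depth 16 is ample there: every later event uses up one of at most six fresh
  vertices or is the only trip to \<open>u\<close>.\<close>

definition first_moves_lose :: "(arrivals \<Rightarrow> bool) \<Rightarrow> arrivals \<Rightarrow> bool" where
  "first_moves_lose L G \<longleftrightarrow> list_all (\<lambda>(u, s, y).
     if budget \<le> s then True
     else let H = after_visit u s G in
       if pair_exceeds H then True
       else if L H then True
       else second_lost 16 u None (Some (max s y)) H) G"

primrec first_lost :: "nat \<Rightarrow> arrivals \<Rightarrow> bool" where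
  "first_lost 0 G = False"
| "first_lost (Suc n) G =
    (if G = [] then False
     else if first_moves_lose (first_lost n) G
     then first_moves_lose (first_lost n) (swap_robots G) else False)"

text \<open>Vertex 0 is missing because it may have been explored. The zero bounds assume nothing
  about the positions of the robots at the start. Depth 8 exceeds the number of possible visits to
  the seven vertices.\<close>

lemma octagon_lost: "first_lost 8 (map (\<lambda>v. (v, 0, 0)) [1, 2, 3, 4, 5, 6, 7])"
  by code_simp

lemma in_after_visit:
  "(w, x, y) \<in> set (after_visit u s G) \<longleftrightarrow>
     w \<noteq> u \<and> (\<exists>x0 y0. (w, x0, y0) \<in> set G \<and> x = s + oct_dist u w \<and> y = max y0 s)"
  by (force simp: after_visit_def)

lemma in_swap_robots [simp]: "(w, x, y) \<in> set (swap_robots G) \<longleftrightarrow> (w, y, x) \<in> set G"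
  by (force simp: swap_robots_def)

lemma second_lost_nonempty: "second_lost n A p q G \<Longrightarrow> G \<noteq> []"
  by (cases n) (auto split: if_splits)

lemma pair_exceeds_iff:
  "pair_exceeds G \<longleftrightarrow> (\<exists>B a b C a' b'. (B, a, b) \<in> set G \<and> (C, a', b') \<in> set G \<and>
     budget \<le> max (min a a') (min b b') + oct_dist B C)"
  unfolding pair_exceeds_def list_ex_iff Bex_def split_paired_Ex prod.case by blast

section \<open>Soundness of the game search for actual runs\<close>

locale octagon_game =
  fixes t :: real and vert :: "int \<Rightarrow> complex"
  assumes vert_dist: "\<And>u v. u \<in> {0..7} \<Longrightarrow> v \<in> {0..7} \<Longrightarrow>
      real_of_int (oct_dist u v) / 1000 \<le> dist (vert u) (vert v)"
begin

definition after :: "int \<Rightarrow> real" where "after x = t + real_of_int x / 1000"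

abbreviation "deadline \<equiv> after budget"

lemma after_mono [simp]: "after x \<le> after y \<longleftrightarrow> x \<le> y" "after x < after y \<longleftrightarrow> x < y"
  by (auto simp: after_def)

definition arrivals_bound where
  "arrivals_bound i j Y G \<longleftrightarrow> (\<forall>(u, x, y)\<in>set G. \<forall>\<tau>\<ge>0.
     (Y i \<tau> = vert u \<longrightarrow> after x \<le> \<tau>) \<and> (Y j \<tau> = vert u \<longrightarrow> after y \<le> \<tau>))"

lemma arrivals_boundD:
  assumes "arrivals_bound i j Y G" "(u, x, y) \<in> set G" "0 \<le> \<tau>"
  shows "Y i \<tau> = vert u \<Longrightarrow> after x \<le> \<tau>" "Y j \<tau> = vert u \<Longrightarrow> after y \<le> \<tau>"
  using assms unfolding arrivals_bound_def by blast+

definition known_bound where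
  "known_bound i Y A p \<longleftrightarrow> (\<forall>a. p = Some a \<longrightarrow> (\<forall>\<tau>\<ge>0. Y i \<tau> = vert A \<longrightarrow> after a \<le> \<tau>))"

text \<open>\<open>Y\<close> still agrees with \<open>X\<close> at the time \<open>s\<close> of the
  visit, so its robot \<open>i\<close> is at \<open>u\<close> as well, and in \<open>Y\<close> too
  no remaining vertex is reached before \<open>m\<close>. Hence robot \<open>i\<close> has to travel
  there from \<open>u\<close> after \<open>s\<close>, and robot \<open>j\<close> cannot arrive
  before \<open>s\<close>.\<close>

lemma after_visit_bound:
  assumes ij: "i \<in> {1..2}" "j \<in> {1..2}" and keys: "fst ` set G \<subseteq> {0..7}" "u \<in> {0..7}"
    and B: "arrivals_bound i j Y G" and Y: "follows Y X m"
    and s: "s \<le> m" "0 \<le> s" "X i s = vert u" "after x \<le> s"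
    and hit: "\<And>w. w \<in> fst ` set G \<Longrightarrow> m \<le> hit X (vert w)"
  shows "arrivals_bound i j Y (after_visit u x G)"
  unfolding arrivals_bound_def
proof (safe)
  fix w x' y' \<tau> assume w: "(w, x', y') \<in> set (after_visit u x G)" and \<tau>: "(0::real) \<le> \<tau>"
  obtain x0 y0 where G: "(w, x0, y0) \<in> set G" and x': "x' = x + oct_dist u w" and y': "y' = max y0 x"
    using w by (auto simp: in_after_visit)
  have wG: "w \<in> fst ` set G" using G by force
  have Yu: "Y i s = vert u" using Y s ij by (auto simp: follows_def)
  have adm: "admissible_motion 2 Y" using Y by (simp add: follows_def)
  { assume h: "Y i \<tau> = vert w"
    have "m \<le> \<tau>" using follows_hit[OF Y hit[OF wG] ij(1) \<tau> h] .
    then have "s + dist (vert u) (vert w) \<le> \<tau>"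
      using travel_time[OF adm ij(1) s(2) _ Yu h] s(1) by simp
    moreover have "real_of_int (oct_dist u w) / 1000 \<le> dist (vert u) (vert w)"
      using keys wG by (intro vert_dist) auto
    ultimately show "after x' \<le> \<tau>" using s(4) by (simp add: after_def x' add_divide_distrib) }
  { assume h: "Y j \<tau> = vert w"
    have "m \<le> \<tau>" using follows_hit[OF Y hit[OF wG] ij(2) \<tau> h] .
    moreover have "after y0 \<le> \<tau>" using arrivals_boundD(2)[OF B G \<tau> h] .
    ultimately show "after y' \<le> \<tau>" using s by (auto simp: y' max_def) }
qed

text \<open>Whichever of \<open>u\<close> and \<open>A\<close> is visited first, this happens no
  earlier than the smaller bound, and the other one is still a chord away. Used contrapositively: a
  bound that reaches \<open>budget\<close> is a win for the adversary.\<close>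

lemma with_known_less:
  assumes i: "i \<in> {1..2}" and Y: "admissible_motion 2 Y" and keys: "u \<in> {0..7}" "A \<in> {0..7}"
    and u: "0 \<le> \<tau>" "\<tau> < deadline" "Y i \<tau> = vert u" "after x \<le> \<tau>"
    and A: "0 \<le> \<tau>'" "\<tau>' < deadline" "Y i \<tau>' = vert A" "\<And>a. p = Some a \<Longrightarrow> after a \<le> \<tau>'"
  shows "with_known A p u x < budget"
proof (cases p)
  case None
  have "after x < deadline" using u by linarith
  then show ?thesis using None by (simp add: with_known_def)
next
  case (Some a)
  have d: "real_of_int (oct_dist u A) / 1000 \<le> dist (vert u) (vert A)"
    using keys by (intro vert_dist) auto
  have "after (min x a + oct_dist u A) < deadline"
  proof (cases "\<tau> \<le> \<tau>'")
    case True
    have "\<tau> + dist (vert u) (vert A) \<le> \<tau>'" using travel_time[OF Y i u(1) True u(3) A(3)] .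
    moreover have "after (min x a) \<le> \<tau>" using u(4) order_trans[of "after (min x a)" "after x" \<tau>] by simp
    ultimately show ?thesis using d A(2) by (simp add: after_def add_divide_distrib)
  next
    case False
    have "\<tau>' + dist (vert A) (vert u) \<le> \<tau>" using travel_time[OF Y i A(1) _ A(3) u(3)] False by simp
    moreover have "after (min x a) \<le> \<tau>'" using A(4)[OF Some] order_trans[of "after (min x a)" "after a" \<tau>'] by simp
    ultimately show ?thesis using d u(2) by (simp add: after_def add_divide_distrib dist_commute)
  qed
  then show ?thesis using Some by (simp add: with_known_def)
qed

text \<open>The bounds are required of every run that follows \<open>X\<close> up to \<open>m\<close>, since the adversary may still
  switch to a run that departs from \<open>X\<close> when a treasure is found after \<open>m\<close>.\<close>

definition second_state where
  "second_state i j X m A p q G \<longleftrightarrow> {i, j} = {1, 2} \<and> fst ` set G \<subseteq> {0..7} \<and> (p = None \<or> q = None) \<and> 0 \<le> m \<and>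
     (\<forall>u\<in>fst ` set G. m \<le> hit X (vert u)) \<and>
     (\<forall>Y. follows Y X m \<longrightarrow> arrivals_bound i j Y G \<and> known_bound i Y A p \<and> known_bound j Y A q)"

lemma second_state_swap:
  "second_state i j X m A p q G \<Longrightarrow> second_state j i X m A q p (swap_robots G)"
  unfolding second_state_def arrivals_bound_def swap_robots_def
  by (auto simp: insert_commute image_image case_prod_unfold)

text \<open>\<open>X\<close> is the run with a known treasure at \<open>A\<close> and no further discovery. Until \<open>X\<close> first hits
  a vertex \<open>u\<close>, it cannot be told apart from the run \<open>Y\<close> whose second treasure is at \<open>u\<close>.\<close>

definition second_world where
  "second_world X A U \<longleftrightarrow> admissible_motion 2 X \<and> A \<in> {0..7} \<and> (\<forall>u\<in>U.
     0 \<le> hit X (vert u) \<and> hit X (vert u) < deadline \<and> (\<exists>k\<in>{1..2}. X k (hit X (vert u)) = vert u) \<and>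
     (\<exists>Y. follows Y X (hit X (vert u)) \<and> (\<forall>k\<in>{1..2}. \<forall>v\<in>{u, A}. \<exists>\<tau>\<ge>0. \<tau> < deadline \<and> Y k \<tau> = vert v)))"

text \<open>\<open>u\<close> is the first fresh vertex visited in \<open>X\<close>. The alternatives
  of \<open>event\<close> match the two kinds of moves: a trip to \<open>A\<close> no later than
  this visit, or the visit itself while all outstanding trips to \<open>A\<close> are still ahead.
  Either way the updated bounds form a valid state that \<open>L\<close> declares lost.\<close>

lemma second_moves_lose_sound:
  assumes L: "\<And>p q G m. L p q G \<Longrightarrow> second_state i j X m A p q G \<Longrightarrow> fst ` set G \<subseteq> U \<Longrightarrow> False"
    and lose: "second_moves_lose L A p q G" and W: "second_world X A U"
    and st: "second_state i j X m A p q G" and U: "fst ` set G \<subseteq> U"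
    and u: "(u, x, y) \<in> set G" and least: "\<And>w. w \<in> fst ` set G \<Longrightarrow> hit X (vert u) \<le> hit X (vert w)"
    and event: "(p \<noteq> None \<and> (\<exists>r\<in>{0..hit X (vert u)}. X i r = vert A)) \<or>
      (X i (hit X (vert u)) = vert u \<and> (\<forall>r\<in>{0..hit X (vert u)}.
          (p \<noteq> None \<longrightarrow> X i r \<noteq> vert A) \<and> (q \<noteq> None \<longrightarrow> X j r \<noteq> vert A)))"
  shows False
proof -
  let ?M = "hit X (vert u)"
  have ij: "i \<in> {1..2}" "j \<in> {1..2}" and keys: "fst ` set G \<subseteq> {0..7}" and pq: "p = None \<or> q = None" and m0: "0 \<le> m"
    using st unfolding second_state_def by (auto simp: doubleton_eq_iff)
  have uG: "u \<in> fst ` set G" using u by force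
  have X: "admissible_motion 2 X" and A: "A \<in> {0..7}" using W by (auto simp: second_world_def)
  have m: "m \<le> ?M" using st uG by (auto simp: second_state_def)
  have M: "0 \<le> ?M" "?M < deadline" using W U uG unfolding second_world_def by blast+
  have bd: "arrivals_bound i j Y G" "known_bound i Y A p" "known_bound j Y A q" if "follows Y X m" for Y
    using st that by (auto simp: second_state_def)
  have XX: "follows X X r" for r using X by (simp add: follows_def)
  from event show False
  proof (elim disjE conjE bexE)
    fix r assume p: "p \<noteq> None" and r: "r \<in> {0..?M}" "X i r = vert A"
    obtain a where a: "p = Some a" using p by auto
    have q: "q = None" using pq a by auto
    have ar: "after a \<le> r" using bd(2)[OF XX] r a by (auto simp: known_bound_def)
    have "after a < deadline" using ar r(1) M(2) unfolding atLeastAtMost_iff by linarith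
    then have "L None q (after_visit A a G)" using lose a by (auto simp: second_moves_lose_def)
    \<comment> \<open>The hypotheses allow \<open>r\<close> to lie before \<open>m\<close>; the
      maximum keeps the new state from being earlier than the old one.\<close>
    moreover have "second_state i j X (max m r) A None q (after_visit A a G)"
      unfolding second_state_def
    proof (intro conjI allI impI)
      show "{i, j} = {1, 2}" using st by (simp add: second_state_def)
      show "fst ` set (after_visit A a G) \<subseteq> {0..7}" using keys by (force simp: in_after_visit)
      have le: "max m r \<le> hit X (vert w)" if "w \<in> fst ` set G" for w
        using least[OF that] m r by auto
      then show "\<forall>u\<in>fst ` set (after_visit A a G). max m r \<le> hit X (vert u)"
        by (force simp: in_after_visit)
      fix Y assume Y: "follows Y X (max m r)"
      show "arrivals_bound i j Y (after_visit A a G)"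
        using ar r le keys A by (intro after_visit_bound[OF ij _ _ bd(1)[OF follows_mono[OF Y]] Y, where s = r]) auto
      show "known_bound i Y A None" "known_bound j Y A q" by (auto simp: known_bound_def q)
    qed (use m0 in auto)
    moreover have "fst ` set (after_visit A a G) \<subseteq> U" using U by (force simp: in_after_visit)
    ultimately show False by (rule L)
  next
    assume Xi: "X i ?M = vert u" and noA: "\<forall>r\<in>{0..?M}. (p \<noteq> None \<longrightarrow> X i r \<noteq> vert A) \<and> (q \<noteq> None \<longrightarrow> X j r \<noteq> vert A)"
    have xM: "after x \<le> ?M" using arrivals_boundD(1)[OF bd(1)[OF XX] u M(1) Xi] .
    have late: "?M \<le> \<tau>" if "follows Y X ?M" "k = i \<and> p \<noteq> None \<or> k = j \<and> q \<noteq> None" "0 \<le> \<tau>" "Y k \<tau> = vert A" for Y k \<tau>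
    proof (rule ccontr)
      assume "\<not> ?M \<le> \<tau>"
      then have "X k \<tau> = vert A" "\<tau> \<in> {0..?M}" using that ij by (auto simp: follows_def)
      then show False using noA that(2) by auto
    qed
    have kb: "known_bound j Y A (map_option (max x) q)" if Y: "follows Y X ?M" for Y
      unfolding known_bound_def
    proof (intro allI impI)
      fix b \<tau> assume "map_option (max x) q = Some b" and \<tau>: "(0::real) \<le> \<tau>" "Y j \<tau> = vert A"
      then obtain b0 where b: "q = Some b0" "b = max x b0" by auto
      have "?M \<le> \<tau>" using late[OF Y _ \<tau>] b by auto
      moreover have "after b0 \<le> \<tau>" using bd(3)[OF follows_mono[OF Y m]] \<tau> b by (auto simp: known_bound_def)
      ultimately show "after b \<le> \<tau>" using xM by (auto simp: b max_def)
    qed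
    have kb': "known_bound i Y A (map_option (\<lambda>_. x + oct_dist u A) p)" if Y: "follows Y X ?M" for Y
      unfolding known_bound_def
    proof (intro allI impI)
      fix b \<tau> assume "map_option (\<lambda>_. x + oct_dist u A) p = Some b" and \<tau>: "(0::real) \<le> \<tau>" "Y i \<tau> = vert A"
      then have b: "p \<noteq> None" "b = x + oct_dist u A" by auto
      have "?M \<le> \<tau>" using late[OF Y _ \<tau>] b by auto
      moreover have "Y i ?M = vert u" using Y Xi M ij by (auto simp: follows_def)
      ultimately have "?M + dist (vert u) (vert A) \<le> \<tau>"
        using travel_time[of 2 Y i ?M \<tau>] Y ij M \<tau> by (auto simp: follows_def)
      moreover have "real_of_int (oct_dist u A) / 1000 \<le> dist (vert u) (vert A)"
        using keys uG A by (intro vert_dist) auto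
      ultimately show "after b \<le> \<tau>" using xM by (simp add: after_def b add_divide_distrib)
    qed
    have "x < budget" using xM M by (metis after_mono(2) order_le_less_trans)
    \<comment> \<open>With the second treasure at \<open>u\<close>, the run \<open>Y\<close> agrees
      with \<open>X\<close> up to the visit and yet brings robot \<open>j\<close> to both
      \<open>u\<close> and \<open>A\<close> before the deadline. So the test for an immediate win
      fails, and \<open>L\<close> must have been applied.\<close>
    moreover have "with_known A (map_option (max x) q) u (max y x) < budget"
    proof -
      obtain Y where Y: "follows Y X ?M"
        and vis: "\<forall>k\<in>{1..2}. \<forall>v\<in>{u, A}. \<exists>\<tau>\<ge>0. \<tau> < deadline \<and> Y k \<tau> = vert v"
        using W U uG unfolding second_world_def by blast
      obtain \<tau> where \<tau>: "0 \<le> \<tau>" "\<tau> < deadline" "Y j \<tau> = vert u" using vis ij by blast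
      obtain \<tau>' where \<tau>': "0 \<le> \<tau>'" "\<tau>' < deadline" "Y j \<tau>' = vert A" using vis ij by blast
      have "after y \<le> \<tau>" using arrivals_boundD(2)[OF bd(1)[OF follows_mono[OF Y m]] u \<tau>(1,3)] .
      moreover have "?M \<le> \<tau>" using follows_hit[OF Y order_refl ij(2) \<tau>(1,3)] .
      ultimately have "after (max y x) \<le> \<tau>" using xM by (auto simp: max_def)
      moreover have "after a \<le> \<tau>'" if "map_option (max x) q = Some a" for a
        using kb[OF Y] that \<tau>' by (auto simp: known_bound_def)
      moreover have "admissible_motion 2 Y" using Y by (simp add: follows_def)
      ultimately show ?thesis using \<tau> \<tau>' ij keys uG A
        by (intro with_known_less[of j Y u A \<tau> "max y x" \<tau>']) auto
    qed
    ultimately have "L (map_option (\<lambda>_. x + oct_dist u A) p) (map_option (max x) q) (after_visit u x G)"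
      using lose u unfolding second_moves_lose_def list_all_iff by (auto split: if_splits)
    moreover have "second_state i j X ?M A (map_option (\<lambda>_. x + oct_dist u A) p) (map_option (max x) q) (after_visit u x G)"
      unfolding second_state_def
    proof (intro conjI allI impI)
      show "{i, j} = {1, 2}" using st by (simp add: second_state_def)
      show "fst ` set (after_visit u x G) \<subseteq> {0..7}" using keys by (force simp: in_after_visit)
      show "\<forall>w\<in>fst ` set (after_visit u x G). ?M \<le> hit X (vert w)"
        using least by (force simp: in_after_visit)
      fix Y assume Y: "follows Y X ?M"
      show "arrivals_bound i j Y (after_visit u x G)"
        using M Xi xM least keys uG
        by (intro after_visit_bound[OF ij _ _ bd(1)[OF follows_mono[OF Y m]] Y, where s = ?M]) auto
      show "known_bound i Y A (map_option (\<lambda>_. x + oct_dist u A) p)" "known_bound j Y A (map_option (max x) q)"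
        using kb kb' Y by auto
    qed (use M pq in auto)
    moreover have "fst ` set (after_visit u x G) \<subseteq> U" using U by (force simp: in_after_visit)
    ultimately show False by (rule L)
  qed
qed

lemma least_hit:
  assumes "G \<noteq> []"
  obtains u x y where "(u, x, y) \<in> set G" "\<And>w. w \<in> fst ` set G \<Longrightarrow> hit X (vert u) \<le> hit X (vert w)"
proof -
  have "finite (fst ` set G)" "fst ` set G \<noteq> {}" using assms by auto
  then obtain u where u: "u \<in> fst ` set G" "\<And>w. w \<in> fst ` set G \<Longrightarrow> hit X (vert u) \<le> hit X (vert w)"
    using finite_imp_Sup_less ex_min_if_finite arg_min_if_finite[of "fst ` set G" "\<lambda>u. hit X (vert u)"]
    by (metis linorder_not_less)
  then show ?thesis using that by force
qed

text \<open>The run \<open>X\<close> stays fixed while the search descends. At each level the next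
  event is read off from \<open>X\<close>: up to the first hit of a remaining vertex, either a robot
  completes its outstanding trip to \<open>A\<close>, or that hit is the event. The search has
  declared all of these lost.\<close>

lemma second_lost_sound:
  assumes "second_lost n A p q G" "second_state i j X m A p q G" "second_world X A U" "fst ` set G \<subseteq> U"
  shows False
  using assms(1,2,4)
proof (induction n arbitrary: i j p q G m)
  case 0
  then show False unfolding second_lost.simps by (elim FalseE)
next
  case (Suc n)
  note st = Suc.prems(2) and U = Suc.prems(3)
  have ij: "{i, j} = {1, 2}" "i \<in> {1..2}" "j \<in> {1..2}" and keys: "fst ` set G \<subseteq> {0..7}"
    using st unfolding second_state_def by (auto simp: doubleton_eq_iff)
  have G: "G \<noteq> []" using Suc.prems(1) by (auto split: if_splits)
  have A: "A \<in> {0..7}" using assms(3) by (simp add: second_world_def)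
  \<comment> \<open>The run with its second treasure at \<open>u\<close> obeys the current bounds
    and finishes in time, which rules out an immediate win.\<close>
  have static: "with_known A p u x < budget \<and> with_known A q u y < budget" if u: "(u, x, y) \<in> set G" for u x y
  proof -
    have uG: "u \<in> fst ` set G" using u by force
    obtain Y where Y: "follows Y X (hit X (vert u))"
        and vis: "\<forall>k\<in>{1..2}. \<forall>v\<in>{u, A}. \<exists>\<tau>\<ge>0. \<tau> < deadline \<and> Y k \<tau> = vert v"
        using assms(3) U uG unfolding second_world_def by blast
    have "m \<le> hit X (vert u)" using st uG by (auto simp: second_state_def)
    then have "follows Y X m" using Y follows_mono by blast
    then have bd: "arrivals_bound i j Y G" "known_bound i Y A p" "known_bound j Y A q" "admissible_motion 2 Y"
      using st by (auto simp: second_state_def follows_def)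
    obtain \<tau> where \<tau>: "0 \<le> \<tau>" "\<tau> < deadline" "Y j \<tau> = vert u" using vis ij by blast
    obtain \<tau>' where \<tau>': "0 \<le> \<tau>'" "\<tau>' < deadline" "Y j \<tau>' = vert A" using vis ij by blast
    obtain \<theta> where \<theta>: "0 \<le> \<theta>" "\<theta> < deadline" "Y i \<theta> = vert u" using vis ij by blast
    obtain \<theta>' where \<theta>': "0 \<le> \<theta>'" "\<theta>' < deadline" "Y i \<theta>' = vert A" using vis ij by blast
    have "with_known A p u x < budget"
      using bd \<theta> \<theta>' ij keys uG A arrivals_boundD(1)[OF bd(1) u \<theta>(1,3)]
      by (intro with_known_less[of i Y u A \<theta> x \<theta>' p]) (auto simp: known_bound_def)
    moreover have "with_known A q u y < budget"
      using bd \<tau> \<tau>' ij keys uG A arrivals_boundD(2)[OF bd(1) u \<tau>(1,3)]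
      by (intro with_known_less[of j Y u A \<tau> y \<tau>' q]) (auto simp: known_bound_def)
    ultimately show ?thesis by simp
  qed
  have "\<not> list_ex (\<lambda>(u, x, y). budget \<le> with_known A p u x \<or> budget \<le> with_known A q u y) G"
    using static unfolding list_ex_iff by fastforce
  then have lose: "second_moves_lose (second_lost n A) A p q G" "second_moves_lose (second_lost n A) A q p (swap_robots G)"
    using Suc.prems(1) by (auto split: if_splits)
  obtain u x y where u: "(u, x, y) \<in> set G" and least: "\<And>w. w \<in> fst ` set G \<Longrightarrow> hit X (vert u) \<le> hit X (vert w)"
    using least_hit[OF G, of X] by blast
  have uG: "u \<in> fst ` set G" using u by force
  have sw: "fst ` set (swap_robots G) = fst ` set G" by (force simp: swap_robots_def)
  let ?M = "hit X (vert u)"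
  have "\<exists>k\<in>{1..2}. X k ?M = vert u" using assms(3) U uG by (auto simp: second_world_def)
  moreover have "k = i \<or> k = j" if "k \<in> {1..2}" for k
    using ij(1) that by (auto simp: doubleton_eq_iff)
  ultimately have ev: "X i ?M = vert u \<or> X j ?M = vert u" by metis
  have u': "(u, y, x) \<in> set (swap_robots G)" using u by simp
  have least': "hit X (vert u) \<le> hit X (vert w)" if "w \<in> fst ` set (swap_robots G)" for w
    using least that unfolding sw .
  have U': "fst ` set (swap_robots G) \<subseteq> U" using U unfolding sw .
  have robot_i: False if "(p \<noteq> None \<and> (\<exists>r\<in>{0..?M}. X i r = vert A)) \<or>
      (X i ?M = vert u \<and> (\<forall>r\<in>{0..?M}. (p \<noteq> None \<longrightarrow> X i r \<noteq> vert A) \<and> (q \<noteq> None \<longrightarrow> X j r \<noteq> vert A)))"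
    by (rule second_moves_lose_sound[OF _ lose(1) assms(3) st U u _ that]) (fact Suc.IH, fact least)
  have robot_j: False if "(q \<noteq> None \<and> (\<exists>r\<in>{0..?M}. X j r = vert A)) \<or>
      (X j ?M = vert u \<and> (\<forall>r\<in>{0..?M}. (q \<noteq> None \<longrightarrow> X j r \<noteq> vert A) \<and> (p \<noteq> None \<longrightarrow> X i r \<noteq> vert A)))"
    by (rule second_moves_lose_sound[OF _ lose(2) assms(3) second_state_swap[OF st] U' u' _ that])
      (fact Suc.IH, fact least')
  have no_i: "p = None \<or> X i r \<noteq> vert A" if "r \<in> {0..?M}" for r
  proof (rule ccontr)
    assume "\<not> ?thesis"
    with that have "p \<noteq> None \<and> (\<exists>r\<in>{0..?M}. X i r = vert A)" by (intro conjI bexI[of _ r]) simp_all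
    then show False by (rule robot_i[OF disjI1])
  qed
  have no_j: "q = None \<or> X j r \<noteq> vert A" if "r \<in> {0..?M}" for r
  proof (rule ccontr)
    assume "\<not> ?thesis"
    with that have "q \<noteq> None \<and> (\<exists>r\<in>{0..?M}. X j r = vert A)" by (intro conjI bexI[of _ r]) simp_all
    then show False by (rule robot_j[OF disjI1])
  qed
  from ev show False
  proof
    assume "X i ?M = vert u"
    moreover have "\<forall>r\<in>{0..?M}. (p \<noteq> None \<longrightarrow> X i r \<noteq> vert A) \<and> (q \<noteq> None \<longrightarrow> X j r \<noteq> vert A)"
    proof
      fix r assume "r \<in> {0..?M}"
      from no_i[OF this] no_j[OF this] show "(p \<noteq> None \<longrightarrow> X i r \<noteq> vert A) \<and> (q \<noteq> None \<longrightarrow> X j r \<noteq> vert A)" by blast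
    qed
    ultimately show False by (intro robot_i[OF disjI2[OF conjI]])
  next
    assume "X j ?M = vert u"
    moreover have "\<forall>r\<in>{0..?M}. (q \<noteq> None \<longrightarrow> X j r \<noteq> vert A) \<and> (p \<noteq> None \<longrightarrow> X i r \<noteq> vert A)"
    proof
      fix r assume "r \<in> {0..?M}"
      from no_i[OF this] no_j[OF this] show "(q \<noteq> None \<longrightarrow> X j r \<noteq> vert A) \<and> (p \<noteq> None \<longrightarrow> X i r \<noteq> vert A)" by blast
    qed
    ultimately show False by (intro robot_j[OF disjI2[OF conjI]])
  qed
qed

text \<open>The options of the adversary while nothing is known: both treasures at vertices that are
  still unvisited, or one treasure at \<open>A\<close> and a run \<open>X'\<close> in which the
  second stays unfound as long as required. \<open>U'\<close> is nonempty because such a run needs a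
  vertex for its second treasure.\<close>

definition first_world where
  "first_world X U \<longleftrightarrow> admissible_motion 2 X \<and> U \<subseteq> {0..7} \<and>
     (\<forall>u\<in>U. 0 \<le> hit X (vert u) \<and> hit X (vert u) < deadline \<and> (\<exists>k\<in>{1..2}. X k (hit X (vert u)) = vert u)) \<and>
     (\<forall>B\<in>U. \<forall>C\<in>U. \<forall>s. s \<le> hit X (vert B) \<and> s \<le> hit X (vert C) \<longrightarrow>
        (\<exists>Y. follows Y X s \<and> (\<forall>k\<in>{1..2}. \<forall>v\<in>{B, C}. \<exists>\<tau>\<ge>0. \<tau> < deadline \<and> Y k \<tau> = vert v))) \<and>
     (\<forall>A\<in>U. \<forall>U'\<subseteq>U. U' \<noteq> {} \<longrightarrow> (\<forall>u\<in>U'. hit X (vert A) \<le> hit X (vert u)) \<longrightarrow>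
        (\<exists>X'. follows X' X (hit X (vert A)) \<and> second_world X' A U'))"

lemma second_world_hit:
  assumes "second_world X A U" "u \<in> U"
  shows "0 \<le> hit X (vert u) \<and> (\<exists>k\<in>{1..2}. X k (hit X (vert u)) = vert u)"
proof -
  have "\<forall>u\<in>U. 0 \<le> hit X (vert u) \<and> hit X (vert u) < deadline \<and> (\<exists>k\<in>{1..2}. X k (hit X (vert u)) = vert u) \<and>
     (\<exists>Y. follows Y X (hit X (vert u)) \<and> (\<forall>k\<in>{1..2}. \<forall>v\<in>{u, A}. \<exists>\<tau>\<ge>0. \<tau> < deadline \<and> Y k \<tau> = vert v))"
    using assms(1) unfolding second_world_def by (elim conjE)
  from this[THEN bspec, OF assms(2)] show ?thesis by (elim conjE) (intro conjI)
qed

lemma first_worldD: "first_world X U \<Longrightarrow> admissible_motion 2 X \<and> U \<subseteq> {0..7}"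
  unfolding first_world_def by (elim conjE) (intro conjI)

lemma first_world_hit:
  assumes "first_world X U" "u \<in> U"
  shows "0 \<le> hit X (vert u) \<and> hit X (vert u) < deadline \<and> (\<exists>k\<in>{1..2}. X k (hit X (vert u)) = vert u)"
proof -
  have "\<forall>u\<in>U. 0 \<le> hit X (vert u) \<and> hit X (vert u) < deadline \<and> (\<exists>k\<in>{1..2}. X k (hit X (vert u)) = vert u)"
    using assms(1) unfolding first_world_def by (elim conjE)
  from this[THEN bspec, OF assms(2)] show ?thesis .
qed

lemma first_world_pair:
  assumes "first_world X U" "B \<in> U" "C \<in> U" "s \<le> hit X (vert B) \<and> s \<le> hit X (vert C)"
  shows "\<exists>Y. follows Y X s \<and> (\<forall>k\<in>{1..2}. \<forall>v\<in>{B, C}. \<exists>\<tau>\<ge>0. \<tau> < deadline \<and> Y k \<tau> = vert v)"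
proof -
  have "\<forall>B\<in>U. \<forall>C\<in>U. \<forall>s. s \<le> hit X (vert B) \<and> s \<le> hit X (vert C) \<longrightarrow>
        (\<exists>Y. follows Y X s \<and> (\<forall>k\<in>{1..2}. \<forall>v\<in>{B, C}. \<exists>\<tau>\<ge>0. \<tau> < deadline \<and> Y k \<tau> = vert v))"
    using assms(1) unfolding first_world_def by (elim conjE)
  from this[THEN bspec, OF assms(2), THEN bspec, OF assms(3), THEN spec, THEN mp, OF assms(4)]
  show ?thesis .
qed

lemma first_world_second:
  assumes "first_world X U" "A \<in> U" "U' \<subseteq> U" "U' \<noteq> {}" "\<forall>u\<in>U'. hit X (vert A) \<le> hit X (vert u)"
  shows "\<exists>X'. follows X' X (hit X (vert A)) \<and> second_world X' A U'"
proof -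
  have "\<forall>A\<in>U. \<forall>U'\<subseteq>U. U' \<noteq> {} \<longrightarrow> (\<forall>u\<in>U'. hit X (vert A) \<le> hit X (vert u)) \<longrightarrow>
        (\<exists>X'. follows X' X (hit X (vert A)) \<and> second_world X' A U')"
    using assms(1) unfolding first_world_def by (elim conjE)
  from this[THEN bspec, OF assms(2), THEN spec, THEN mp, OF assms(3), THEN mp, OF assms(4), THEN mp, OF assms(5)]
  show ?thesis .
qed

definition first_state where
  "first_state i j X m U G \<longleftrightarrow> {i, j} = {1, 2} \<and> fst ` set G \<subseteq> U \<and> 0 \<le> m \<and>
     (\<forall>u\<in>fst ` set G. m \<le> hit X (vert u)) \<and> (\<forall>Y. follows Y X m \<longrightarrow> arrivals_bound i j Y G)"

lemma first_stateD:
  assumes "first_state i j X m U G"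
  shows "{i, j} = {1, 2}" "fst ` set G \<subseteq> U" "\<forall>u\<in>fst ` set G. m \<le> hit X (vert u)"
    "\<forall>Y. follows Y X m \<longrightarrow> arrivals_bound i j Y G"
  using assms unfolding first_state_def by - (elim conjE; assumption)+

lemma first_state_swap: "first_state i j X m U G \<Longrightarrow> first_state j i X m U (swap_robots G)"
  unfolding first_state_def arrivals_bound_def swap_robots_def
  by (auto simp: insert_commute image_image case_prod_unfold)

lemma pair_visit_late:
  assumes Y: "admissible_motion 2 Y" and k: "k \<in> {1..2}" and BC: "B \<in> {0..7}" "C \<in> {0..7}"
    and B: "0 \<le> \<tau>" "\<tau> < deadline" "Y k \<tau> = vert B" "after x \<le> \<tau>"
    and C: "0 \<le> \<tau>'" "\<tau>' < deadline" "Y k \<tau>' = vert C" "after x' \<le> \<tau>'"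
  shows "min x x' + oct_dist B C < budget"
  using with_known_less[of k Y B C \<tau> x \<tau>' "Some x'"] assms by (simp add: with_known_def)

text \<open>Each successful test leads to a contradiction: \<open>pair_exceeds\<close> through the
  run for that pair, which finishes in time; \<open>L\<close> through the state after the visit;
  \<open>second_lost\<close> through the run \<open>X'\<close> with a treasure at \<open>u\<close>.
  Hence \<open>first_moves_lose\<close> cannot hold.\<close>

lemma first_moves_lose_sound:
  assumes L: "\<And>G m. L G \<Longrightarrow> first_state i j X m U G \<Longrightarrow> False"
    and lose: "first_moves_lose L G" and W: "first_world X U" and st: "first_state i j X m U G"
    and u: "(u, x, y) \<in> set G" and least: "\<And>w. w \<in> fst ` set G \<Longrightarrow> hit X (vert u) \<le> hit X (vert w)"
    and Xi: "X i (hit X (vert u)) = vert u"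
  shows False
proof -
  let ?M = "hit X (vert u)" and ?H = "after_visit u x G"
  have ij: "i \<in> {1..2}" "j \<in> {1..2}" and U: "fst ` set G \<subseteq> U" "U \<subseteq> {0..7}"
    using first_stateD[OF st] first_worldD[OF W] by (auto simp: doubleton_eq_iff)
  have keys: "fst ` set G \<subseteq> {0..7}" using U by blast
  have uG: "u \<in> fst ` set G" using u by force
  have X: "admissible_motion 2 X" using first_worldD[OF W] by blast
  have m: "m \<le> ?M" using first_stateD[OF st] uG by blast
  have "0 \<le> ?M \<and> ?M < deadline"
    using first_world_hit[OF W subsetD[OF U(1) uG]] by blast
  then have M: "0 \<le> ?M" "?M < deadline" by blast+
  have bd: "arrivals_bound i j Y G" if "follows Y X m" for Y using first_stateD[OF st] that by blast
  have XX: "follows X X r" for r using X by (simp add: follows_def)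
  have xM: "after x \<le> ?M" using arrivals_boundD(1)[OF bd[OF XX] u M(1) Xi] .
  have "after x < deadline" using xM M by linarith
  then have "x < budget" by simp
  have H: "arrivals_bound i j Y ?H" if Y: "follows Y X ?M" for Y
    using M Xi xM least keys uG
    by (intro after_visit_bound[OF ij _ _ bd[OF follows_mono[OF Y m]] Y, where s = ?M]) auto
  have HG: "fst ` set ?H \<subseteq> fst ` set G" by (force simp: in_after_visit)
  have "\<not> pair_exceeds ?H"
  proof
    assume "pair_exceeds ?H"
    then obtain B a b C a' b' where B: "(B, a, b) \<in> set ?H" and C: "(C, a', b') \<in> set ?H"
      and exceeds: "budget \<le> max (min a a') (min b b') + oct_dist B C"
      unfolding pair_exceeds_iff by blast
    have BC: "B \<in> fst ` set G" "C \<in> fst ` set G"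
      using HG image_eqI[OF _ B, of B fst] image_eqI[OF _ C, of C fst] by auto
    obtain Y where Y: "follows Y X ?M"
      and vis: "\<forall>k\<in>{1..2}. \<forall>v\<in>{B, C}. \<exists>\<tau>\<ge>0. \<tau> < deadline \<and> Y k \<tau> = vert v"
    proof -
      have BU: "B \<in> U" "C \<in> U" using BC U(1) by blast+
      have MM: "?M \<le> hit X (vert B) \<and> ?M \<le> hit X (vert C)" using least BC by blast
      show ?thesis using first_world_pair[OF W BU MM] that by blast
    qed
    have Ya: "admissible_motion 2 Y" using Y by (simp add: follows_def)
    have BC': "B \<in> {0..7}" "C \<in> {0..7}" using BC keys by auto
    obtain \<tau> where \<tau>: "0 \<le> \<tau>" "\<tau> < deadline" "Y i \<tau> = vert B" using vis ij by blast
    obtain \<tau>' where \<tau>': "0 \<le> \<tau>'" "\<tau>' < deadline" "Y i \<tau>' = vert C" using vis ij by blast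
    obtain \<theta> where \<theta>: "0 \<le> \<theta>" "\<theta> < deadline" "Y j \<theta> = vert B" using vis ij by blast
    obtain \<theta>' where \<theta>': "0 \<le> \<theta>'" "\<theta>' < deadline" "Y j \<theta>' = vert C" using vis ij by blast
    have "min a a' + oct_dist B C < budget"
      using pair_visit_late[OF Ya ij(1) BC' \<tau> arrivals_boundD(1)[OF H[OF Y] B \<tau>(1,3)]
          \<tau>' arrivals_boundD(1)[OF H[OF Y] C \<tau>'(1,3)]] .
    moreover have "min b b' + oct_dist B C < budget"
      using pair_visit_late[OF Ya ij(2) BC' \<theta> arrivals_boundD(2)[OF H[OF Y] B \<theta>(1,3)]
          \<theta>' arrivals_boundD(2)[OF H[OF Y] C \<theta>'(1,3)]] .
    ultimately show False using exceeds unfolding max_def by (cases "min a a' \<le> min b b'") (simp_all only: if_True if_False)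
  qed
  moreover have "\<not> L ?H"
  proof
    assume "L ?H"
    moreover have "first_state i j X ?M U ?H"
      unfolding first_state_def
    proof (intro conjI allI impI ballI)
      show "{i, j} = {1, 2}" using first_stateD(1)[OF st] .
      show "fst ` set ?H \<subseteq> U" using HG U(1) by (rule subset_trans)
      show "?M \<le> hit X (vert w)" if "w \<in> fst ` set ?H" for w using least[OF subsetD[OF HG that]] .
    qed (fact M(1), fact H)
    ultimately show False by (rule L)
  qed
  moreover have "\<not> second_lost 16 u None (Some (max x y)) ?H"
  proof
    assume lost: "second_lost 16 u None (Some (max x y)) ?H"
    then have "?H \<noteq> []" by (rule second_lost_nonempty)
    then have "fst ` set ?H \<noteq> {}" by simp
    moreover have "fst ` set ?H \<subseteq> U" "u \<in> U" "\<forall>w\<in>fst ` set ?H. ?M \<le> hit X (vert w)"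
      using HG U(1) uG least by blast+
    ultimately obtain X' where X': "follows X' X ?M" "second_world X' u (fst ` set ?H)"
      using first_world_second[OF W, of u "fst ` set ?H"] by blast
    have "second_state i j X' ?M u None (Some (max x y)) ?H"
      unfolding second_state_def
    proof (intro conjI allI impI ballI)
      show "{i, j} = {1, 2}" using first_stateD(1)[OF st] .
      show "fst ` set ?H \<subseteq> {0..7}" using keys HG by blast
      show "None = None \<or> Some (max x y) = None" "0 \<le> ?M" using M by auto
      \<comment> \<open>\<open>X'\<close> may depart from \<open>X\<close> after the visit to
        \<open>u\<close>, so its first visits to other vertices can differ; they merely cannot come
        earlier than that visit.\<close>
      show "?M \<le> hit X' (vert w)" if w: "w \<in> fst ` set ?H" for w
      proof -
        obtain k where "k \<in> {1..2}" "X' k (hit X' (vert w)) = vert w" "0 \<le> hit X' (vert w)"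
          using second_world_hit[OF X'(2) w] by blast
        moreover have "?M \<le> hit X (vert w)" using w HG least by blast
        ultimately show ?thesis using follows_hit[OF X'(1)] by blast
      qed
      fix Y assume "follows Y X' ?M"
      then have Y: "follows Y X ?M" using X' follows_trans by blast
      show "arrivals_bound i j Y ?H" using H[OF Y] .
      show "known_bound i Y u None" by (simp add: known_bound_def)
      show "known_bound j Y u (Some (max x y))" unfolding known_bound_def
      proof (intro allI impI)
        fix a \<tau> assume a: "Some (max x y) = Some a" and \<tau>: "(0::real) \<le> \<tau>" "Y j \<tau> = vert u"
        have "?M \<le> \<tau>" using follows_hit[OF Y order_refl ij(2) \<tau>] .
        moreover have "after y \<le> \<tau>" using arrivals_boundD(2)[OF bd[OF follows_mono[OF Y m]] u \<tau>] .
        ultimately show "after a \<le> \<tau>" using xM a by (auto simp: max_def split: if_splits)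
      qed
    qed
    then show False using second_lost_sound[OF lost _ X'(2)] by blast
  qed
  ultimately show False
    using lose u \<open>x < budget\<close> unfolding first_moves_lose_def list_all_iff by (auto simp: Let_def split: if_splits)
qed

lemma first_lost_sound:
  assumes "first_lost n G" "first_state i j X m U G" "first_world X U"
  shows False
  using assms(1,2)
proof (induction n arbitrary: i j G m)
  case 0
  then show False unfolding first_lost.simps by (elim FalseE)
next
  case (Suc n)
  note st = Suc.prems(2)
  have G: "G \<noteq> []" and lose: "first_moves_lose (first_lost n) G" "first_moves_lose (first_lost n) (swap_robots G)"
    using Suc.prems(1) by (auto split: if_splits)
  obtain u x y where u: "(u, x, y) \<in> set G" and least: "\<And>w. w \<in> fst ` set G \<Longrightarrow> hit X (vert u) \<le> hit X (vert w)"
    using least_hit[OF G, of X] by blast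
  have sw: "fst ` set (swap_robots G) = fst ` set G" by (force simp: swap_robots_def)
  have ij: "{i, j} = {1, 2}" and uU: "u \<in> U" using first_stateD[OF st] u by force+
  have "\<exists>k\<in>{1..2}. X k (hit X (vert u)) = vert u" using first_world_hit[OF assms(3) uU] by blast
  moreover have "k = i \<or> k = j" if "k \<in> {1..2}" for k
    using ij that by (auto simp: doubleton_eq_iff)
  ultimately consider "X i (hit X (vert u)) = vert u" | "X j (hit X (vert u)) = vert u" by metis
  then show False
  proof cases
    case 1
    show False
      by (rule first_moves_lose_sound[OF _ lose(1) assms(3) st u _ 1]) (fact Suc.IH, fact least)
  next
    case 2
    have u': "(u, y, x) \<in> set (swap_robots G)" using u by simp
    have least': "hit X (vert u) \<le> hit X (vert w)" if "w \<in> fst ` set (swap_robots G)" for w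
      using least that unfolding sw .
    show False
      by (rule first_moves_lose_sound[OF _ lose(2) assms(3) first_state_swap[OF st] u' _ 2])
        (fact Suc.IH, fact least')
  qed
qed

end

section \<open>The lower bound\<close>

definition treasures :: "complex \<Rightarrow> complex \<Rightarrow> nat \<Rightarrow> complex" where
  "treasures B C j = (if j = 1 then B else if j = 2 then C else undefined)"

lemma treasures_simps [simp]: "treasures B C 1 = B" "treasures B C (Suc 0) = B" "treasures B C 2 = C"
  by (auto simp: treasures_def)

lemma treasures_placement: "B \<in> unit_circle \<Longrightarrow> C \<in> unit_circle \<Longrightarrow> treasures B C \<in> placements 2"
  by (auto simp: placements_def treasures_def PiE_iff extensional_def)

lemma argmax:
  fixes f :: "'a \<Rightarrow> real"
  assumes "finite V" "V \<noteq> {}"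
  obtains z where "z \<in> V" "\<And>p. p \<in> V \<Longrightarrow> f p \<le> f z"
proof -
  have "Max (f ` V) \<in> f ` V" using assms by simp
  then obtain z where "z \<in> V" "f z = Max (f ` V)" by auto
  then show ?thesis using assms by (intro that[of z]) auto
qed

section \<open>Runs in which no further treasure is found\<close>

locale fast_strategy =
  fixes S :: "(nat \<Rightarrow> complex) \<Rightarrow> nat \<Rightarrow> real \<Rightarrow> complex" and K :: real
  assumes S: "S \<in> strategies 2 2"
    and fast: "\<And>T i j. T \<in> placements 2 \<Longrightarrow> i \<in> {1..2} \<Longrightarrow> j \<in> {1..2} \<Longrightarrow> \<exists>\<tau>\<ge>0. \<tau> < K \<and> S T i \<tau> = T j"
begin

lemma admissible: "T \<in> placements 2 \<Longrightarrow> admissible_motion 2 (S T)"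
  using S by (simp add: strategies_def)

lemma hit_properties:
  assumes "T \<in> placements 2" "j \<in> {1..2}"
  shows "0 \<le> hit (S T) (T j)" "hit (S T) (T j) < K" "\<exists>k\<in>{1..2}. S T k (hit (S T) (T j)) = T j"
proof -
  obtain \<tau> where \<tau>: "0 \<le> \<tau>" "\<tau> < K" "S T 1 \<tau> = T j" using fast[OF assms(1) _ assms(2), of 1] by auto
  show "0 \<le> hit (S T) (T j)" "\<exists>k\<in>{1..2}. S T k (hit (S T) (T j)) = T j"
    using hit_attained[OF admissible[OF assms(1)] \<tau>(1) _ \<tau>(3)] by auto
  show "hit (S T) (T j) < K" using hit_le[of \<tau> 1 "S T" "T j"] \<tau> by auto
qed

text \<open>Before the hit neither run has found a treasure in which the placements differ: in
  \<open>T\<close> all of these lie at \<open>T j\<close>, and those of \<open>T'\<close> are found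
  later by assumption. As \<open>T'\<close> need not have a treasure at \<open>T j\<close>, the
  second claim carries a discovery time over to a run in which it is just a passing visit.\<close>

lemma runs_agree_until_hit:
  assumes T: "T \<in> placements 2" "T' \<in> placements 2" and j: "j \<in> {1..2}"
    and sep: "\<And>l. l \<in> {1..2} \<Longrightarrow> T l \<noteq> T' l \<Longrightarrow> T l = T j \<and> hit (S T) (T j) \<le> hit (S T') (T' l)"
  shows "follows (S T) (S T') (hit (S T) (T j))" "hit (S T') (T j) = hit (S T) (T j)"
proof -
  let ?h = "hit (S T) (T j)"
  have eq: "S T i s = S T' i s" if i: "i \<in> {1..2}" and s: "0 \<le> s" "s \<le> ?h" for i s
  proof (rule strategies_agree[OF S T _ i s])
    fix l i :: nat and s :: real assume l: "l \<in> {1..2}" "T l \<noteq> T' l" and i: "i \<in> {1..2}" and s: "0 \<le> s" "s < ?h"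
    show "S T i s \<noteq> T l \<and> (S T i s \<noteq> T' l \<or> S T' i s \<noteq> T' l)"
    proof (intro conjI disjI2 notI)
      assume "S T i s = T l"
      then show False using hit_le[OF s(1) i, of "S T" "T j"] sep[OF l] s by simp
    next
      assume "S T' i s = T' l"
      then show False using hit_le[OF s(1) i, of "S T'" "T' l"] sep[OF l] s by simp
    qed
  qed
  then show "follows (S T) (S T') ?h" using admissible[OF T(1)] by (simp add: follows_def)
  obtain k where k: "k \<in> {1..2}" "S T k ?h = T j" using hit_properties(3)[OF T(1) j] by blast
  then have k': "S T' k ?h = T j" using eq[OF k(1)] hit_properties(1)[OF T(1) j] by simp
  have le: "hit (S T') (T j) \<le> ?h" using hit_le[of ?h k "S T'" "T j"] hit_properties(1)[OF T(1) j] k(1) k' by blast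
  obtain l where l: "l \<in> {1..2}" "S T' l (hit (S T') (T j)) = T j" and l0: "0 \<le> hit (S T') (T j)"
    using hit_attained[of "S T'" ?h k "T j"] admissible[OF T(2)] hit_properties(1)[OF T(1) j] k(1) k' by blast
  have "S T l (hit (S T') (T j)) = T j" using eq[OF l(1) l0 le] l(2) by simp
  then have "?h \<le> hit (S T') (T j)" using hit_le[of "hit (S T') (T j)" l "S T" "T j"] l0 l(1) by blast
  then show "hit (S T') (T j) = ?h" using le by simp
qed

text \<open>\<open>z\<close> maximises the time at which \<open>p\<close> is found when both
  treasures lie at \<open>p\<close>. Up to that time the run for \<open>z\<close> has found nothing,
  so it visits every other \<open>p\<close> exactly when the run for \<open>p\<close> does. It
  therefore stands in for a run without treasures.\<close>

lemma undiscovered_run: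
  assumes V: "finite V" "V \<noteq> {}" "V \<subseteq> unit_circle"
  obtains X where "admissible_motion 2 X"
    "\<And>p. p \<in> V \<Longrightarrow> 0 \<le> hit X p \<and> hit X p < K \<and> (\<exists>k\<in>{1..2}. X k (hit X p) = p)"
    "\<And>B C s. B \<in> V \<Longrightarrow> C \<in> V \<Longrightarrow> s \<le> hit X B \<Longrightarrow> s \<le> hit X C \<Longrightarrow> follows (S (treasures B C)) X s"
proof -
  obtain z where z: "z \<in> V" and max: "\<And>p. p \<in> V \<Longrightarrow> hit (S (treasures p p)) p \<le> hit (S (treasures z z)) z"
    using argmax[OF V(1,2), of "\<lambda>p. hit (S (treasures p p)) p"] by blast
  let ?X = "S (treasures z z)"
  have pl: "treasures p q \<in> placements 2" if "p \<in> V" "q \<in> V" for p q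
    using that V(3) by (intro treasures_placement) auto
  have two: "treasures p p l = p" if "l \<in> {1..2}" for p and l :: nat
    using that by (auto simp: treasures_def)
  have hX: "hit ?X p = hit (S (treasures p p)) p" if p: "p \<in> V" for p
    using runs_agree_until_hit(2)[OF pl[OF p p] pl[OF z z], of 1] max[OF p] two by simp
  have hit: "0 \<le> hit ?X p \<and> hit ?X p < K \<and> (\<exists>k\<in>{1..2}. ?X k (hit ?X p) = p)" if p: "p \<in> V" for p
  proof -
    obtain k where k: "k \<in> {1..2}" "S (treasures p p) k (hit ?X p) = p"
      using hit_properties(3)[OF pl[OF p p], of 1] hX[OF p] by auto
    have b: "0 \<le> hit ?X p" "hit ?X p < K" using hit_properties(1,2)[OF pl[OF p p], of 1] hX[OF p] by auto
    have "follows (S (treasures p p)) ?X (hit ?X p)"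
      using runs_agree_until_hit(1)[OF pl[OF p p] pl[OF z z], of 1] max[OF p] two hX[OF p] by simp
    then have "?X k (hit ?X p) = p" using k b unfolding follows_def by auto
    then show ?thesis using b k by blast
  qed
  have fol: "follows (S (treasures B C)) ?X s"
    if BC: "B \<in> V" "C \<in> V" and s: "s \<le> hit ?X B" "s \<le> hit ?X C" for B C s
    unfolding follows_def
  proof (intro conjI ballI)
    show "admissible_motion 2 (S (treasures B C))" using admissible[OF pl[OF BC]] .
    fix i r assume i: "i \<in> {1..2::nat}" and r: "r \<in> {0..s}"
    have "?X i r = S (treasures B C) i r"
    proof (rule strategies_agree[OF S pl[OF z z] pl[OF BC] _ i])
      show "0 \<le> r" "r \<le> s" using r by auto
      fix l i :: nat and r :: real assume l: "l \<in> {1..2}" and i: "i \<in> {1..2}" and r: "0 \<le> r" "r < s"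
      have ne: "?X i r \<noteq> p" if "s \<le> hit ?X p" for p
      proof
        assume "?X i r = p"
        then show False using hit_le[OF r(1) i, of ?X p] that r by simp
      qed
      have "s \<le> hit ?X z" using s(1) hX[OF BC(1)] max[OF BC(1)] by simp
      then show "?X i r \<noteq> treasures z z l \<and> (?X i r \<noteq> treasures B C l \<or> S (treasures B C) i r \<noteq> treasures B C l)"
        using ne[of z] ne[OF s(1)] ne[OF s(2)] l by (auto simp: treasures_def)
    qed
    then show "S (treasures B C) i r = ?X i r" by simp
  qed
  show ?thesis using that[OF admissible[OF pl[OF z z]] hit fol] .
qed

text \<open>The device of \<open>undiscovered_run\<close> applied to the second treasure only: with
  the first one fixed at \<open>A\<close>, the second lies at the point where it is found
  last.\<close>

lemma known_run:
  assumes V: "finite U" "U \<noteq> {}" "U \<subseteq> unit_circle" "A \<in> unit_circle"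
  obtains z where "z \<in> U" "admissible_motion 2 (S (treasures A z))"
    "\<And>p. p \<in> U \<Longrightarrow> 0 \<le> hit (S (treasures A z)) p \<and> hit (S (treasures A z)) p < K \<and>
       (\<exists>k\<in>{1..2}. S (treasures A z) k (hit (S (treasures A z)) p) = p) \<and>
       follows (S (treasures A p)) (S (treasures A z)) (hit (S (treasures A z)) p)"
proof -
  obtain z where z: "z \<in> U" and max: "\<And>p. p \<in> U \<Longrightarrow> hit (S (treasures A p)) p \<le> hit (S (treasures A z)) z"
    using argmax[OF V(1,2), of "\<lambda>p. hit (S (treasures A p)) p"] by blast
  let ?X = "S (treasures A z)"
  have pl: "treasures A p \<in> placements 2" if "p \<in> U" for p
    using that V(3,4) by (intro treasures_placement) auto
  have hit: "0 \<le> hit ?X p \<and> hit ?X p < K \<and> (\<exists>k\<in>{1..2}. ?X k (hit ?X p) = p) \<and>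
      follows (S (treasures A p)) ?X (hit ?X p)" if p: "p \<in> U" for p
  proof -
    have sep: "treasures A p l = treasures A p 2 \<and> hit (S (treasures A p)) (treasures A p 2) \<le> hit ?X (treasures A z l)"
      if "l \<in> {1..2}" "treasures A p l \<noteq> treasures A z l" for l
      using that max[OF p] by (auto simp: treasures_def split: if_splits)
    have hX: "hit ?X p = hit (S (treasures A p)) p"
      using runs_agree_until_hit(2)[OF pl[OF p] pl[OF z], of 2] sep by simp
    obtain k where k: "k \<in> {1..2}" "S (treasures A p) k (hit ?X p) = p"
      using hit_properties(3)[OF pl[OF p], of 2] hX by auto
    have b: "0 \<le> hit ?X p" "hit ?X p < K" using hit_properties(1,2)[OF pl[OF p], of 2] hX by auto
    have fol: "follows (S (treasures A p)) ?X (hit ?X p)"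
      using runs_agree_until_hit(1)[OF pl[OF p] pl[OF z], of 2] sep hX by simp
    then have "?X k (hit ?X p) = p" using k b unfolding follows_def by auto
    then show ?thesis using b k fol by blast
  qed
  show ?thesis using that[OF z admissible[OF pl[OF z]] hit] .
qed

end

lemma (in octagon_game) first_world_of_strategy:
  assumes "fast_strategy S deadline" and V: "finite V" "V \<subseteq> unit_circle" and U: "U \<subseteq> {0..7}" "vert ` U \<subseteq> V"
    and adm: "admissible_motion 2 X"
    and hit: "\<And>p. p \<in> V \<Longrightarrow> 0 \<le> hit X p \<and> hit X p < deadline \<and> (\<exists>k\<in>{1..2}. X k (hit X p) = p)"
    and fol: "\<And>B C s. B \<in> V \<Longrightarrow> C \<in> V \<Longrightarrow> s \<le> hit X B \<Longrightarrow> s \<le> hit X C \<Longrightarrow> follows (S (treasures B C)) X s"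
  shows "first_world X U"
proof -
  interpret fast_strategy S deadline by fact
  have vis: "\<forall>k\<in>{1..2}. \<forall>v\<in>{B, C}. \<exists>\<tau>\<ge>0. \<tau> < deadline \<and> S (treasures (vert B) (vert C)) k \<tau> = vert v"
    if "B \<in> U" "C \<in> U" for B C
  proof (intro ballI)
    fix k :: nat and v assume k: "k \<in> {1..2}" and v: "v \<in> {B, C}"
    have pl: "treasures (vert B) (vert C) \<in> placements 2"
      using that U V by (intro treasures_placement) auto
    show "\<exists>\<tau>\<ge>0. \<tau> < deadline \<and> S (treasures (vert B) (vert C)) k \<tau> = vert v"
      using fast[OF pl k, of 1] fast[OF pl k, of 2] v by auto
  qed
  show ?thesis unfolding first_world_def
  proof (intro conjI ballI allI impI)
    fix u assume "u \<in> U"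
    then have "vert u \<in> V" using U by auto
    from hit[OF this] show "0 \<le> hit X (vert u)" "hit X (vert u) < deadline" "\<exists>k\<in>{1..2}. X k (hit X (vert u)) = vert u"
      by blast+
  next
    fix B C s assume BC: "B \<in> U" "C \<in> U" and s: "s \<le> hit X (vert B) \<and> s \<le> hit X (vert C)"
    have "follows (S (treasures (vert B) (vert C))) X s" using BC U s by (intro fol) auto
    then show "\<exists>Y. follows Y X s \<and> (\<forall>k\<in>{1..2}. \<forall>v\<in>{B, C}. \<exists>\<tau>\<ge>0. \<tau> < deadline \<and> Y k \<tau> = vert v)"
      using vis[OF BC] by blast
  next
    fix A U' assume A: "A \<in> U" and U': "U' \<subseteq> U" "U' \<noteq> {}" and le: "\<forall>u\<in>U'. hit X (vert A) \<le> hit X (vert u)"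
    have "finite (vert ` U')" "vert ` U' \<noteq> {}" "vert ` U' \<subseteq> unit_circle" "vert A \<in> unit_circle"
      using U' U V A finite_subset[of U' "{0..7}"] by auto
    then obtain z where z: "z \<in> vert ` U'" "admissible_motion 2 (S (treasures (vert A) z))"
      and h: "\<And>p. p \<in> vert ` U' \<Longrightarrow> 0 \<le> hit (S (treasures (vert A) z)) p \<and> hit (S (treasures (vert A) z)) p < deadline \<and>
       (\<exists>k\<in>{1..2}. S (treasures (vert A) z) k (hit (S (treasures (vert A) z)) p) = p) \<and>
       follows (S (treasures (vert A) p)) (S (treasures (vert A) z)) (hit (S (treasures (vert A) z)) p)"
      using known_run by blast
    have "follows (S (treasures (vert A) z)) X (hit X (vert A))"
      using z(1) U U' A le by (intro fol) auto
    moreover have "second_world (S (treasures (vert A) z)) A U'"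
      unfolding second_world_def
    proof (intro conjI ballI)
      show "admissible_motion 2 (S (treasures (vert A) z))" by fact
      show "A \<in> {0..7}" using A U by blast
      fix u assume u: "u \<in> U'"
      have hu: "0 \<le> hit (S (treasures (vert A) z)) (vert u) \<and> hit (S (treasures (vert A) z)) (vert u) < deadline \<and>
       (\<exists>k\<in>{1..2}. S (treasures (vert A) z) k (hit (S (treasures (vert A) z)) (vert u)) = vert u) \<and>
       follows (S (treasures (vert A) (vert u))) (S (treasures (vert A) z)) (hit (S (treasures (vert A) z)) (vert u))"
        using h[of "vert u"] u by blast
      then show "0 \<le> hit (S (treasures (vert A) z)) (vert u)" "hit (S (treasures (vert A) z)) (vert u) < deadline"
        "\<exists>k\<in>{1..2}. S (treasures (vert A) z) k (hit (S (treasures (vert A) z)) (vert u)) = vert u" by blast+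
      have "u \<in> U" using u U' by blast
      from vis[OF A this] have "\<forall>k\<in>{1..2}. \<forall>v\<in>{u, A}. \<exists>\<tau>\<ge>0. \<tau> < deadline \<and> S (treasures (vert A) (vert u)) k \<tau> = vert v"
        by blast
      then show "\<exists>Y. follows Y (S (treasures (vert A) z)) (hit (S (treasures (vert A) z)) (vert u)) \<and>
          (\<forall>k\<in>{1..2}. \<forall>v\<in>{u, A}. \<exists>\<tau>\<ge>0. \<tau> < deadline \<and> Y k \<tau> = vert v)"
        using hu by blast
    qed
    ultimately show "\<exists>X'. follows X' X (hit X (vert A)) \<and> second_world X' A U'" by blast
  qed (use adm U in auto)
qed

section \<open>Chords of the unit circle and the regular octagon\<close>

lemma dist_cis: "dist (cis a) (cis b) = 2 * \<bar>sin ((a - b) / 2)\<bar>"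
proof -
  have "(dist (cis a) (cis b))\<^sup>2 = (cos a - cos b)\<^sup>2 + (sin a - sin b)\<^sup>2"
    by (simp add: dist_norm cmod_power2)
  also have "\<dots> = 2 - 2 * cos (a - b)"
    using sin_cos_squared_add[of a] sin_cos_squared_add[of b]
    by (simp add: cos_diff power2_eq_square algebra_simps)
  also have "\<dots> = (2 * \<bar>sin ((a - b) / 2)\<bar>)\<^sup>2"
  proof -
    have "2 * ((a - b) / 2) = a - b" by simp
    then have "cos (a - b) = 1 - 2 * (sin ((a - b) / 2))\<^sup>2" using cos_double_sin[of "(a - b) / 2"] by metis
    then show ?thesis by (simp add: power_mult_distrib)
  qed
  finally show ?thesis by (rule power2_eq_imp_eq) auto
qed

lemma four_sin_pi_8_squared: "4 * (sin (pi / 8))\<^sup>2 = 2 - sqrt 2" "4 * (cos (pi / 8))\<^sup>2 = 2 + sqrt 2"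
  using cos_double_sin[of "pi / 8"] cos_double_cos[of "pi / 8"] cos_45 by auto

lemma octagon_sides:
  "765 / 1000 \<le> 2 * sin (pi / 8)" "1414 / 1000 \<le> 2 * sin (pi * 2 / 8)" "1847 / 1000 \<le> 2 * sin (pi * 3 / 8)"
proof -
  have s2: "1.4142 \<le> sqrt 2" by (rule real_le_rsqrt) (simp add: power2_eq_square)
  have s2': "sqrt 2 \<le> 1.41422" by (rule real_le_lsqrt) (auto simp: power2_eq_square)
  have pos: "0 \<le> sin (pi / 8)" "0 \<le> cos (pi / 8)" by (auto intro!: sin_ge_zero cos_ge_zero)
  have 1: "(765 / 1000)\<^sup>2 \<le> (2 * sin (pi / 8))\<^sup>2"
    using four_sin_pi_8_squared(1) s2' by (simp add: power_mult_distrib power2_eq_square)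
  show "765 / 1000 \<le> 2 * sin (pi / 8)" by (rule power2_le_imp_le[OF 1]) (use pos in simp)
  show "1414 / 1000 \<le> 2 * sin (pi * 2 / 8)" using s2 sin_45 by simp
  have "sin (pi * 3 / 8) = cos (pi / 8)" using sin_cos_eq[of "pi * 3 / 8"] by (simp add: field_simps)
  have 3: "(1847 / 1000)\<^sup>2 \<le> (2 * cos (pi / 8))\<^sup>2"
    using four_sin_pi_8_squared(2) s2 by (simp add: power_mult_distrib power2_eq_square)
  have "1847 / 1000 \<le> 2 * cos (pi / 8)" by (rule power2_le_imp_le[OF 3]) (use pos in simp)
  then show "1847 / 1000 \<le> 2 * sin (pi * 3 / 8)" using \<open>sin (pi * 3 / 8) = cos (pi / 8)\<close> by simp
qed

lemma octagon_game_cis: "octagon_game (\<lambda>u. cis (c + pi * real_of_int u / 4))"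
proof
  fix u v :: int assume "u \<in> {0..7}" "v \<in> {0..7}"
  define d where "d = \<bar>u - v\<bar>"
  have d: "0 \<le> d" "d \<le> 7" using \<open>u \<in> {0..7}\<close> \<open>v \<in> {0..7}\<close> by (auto simp: d_def)
  have "dist (cis (c + pi * real_of_int u / 4)) (cis (c + pi * real_of_int v / 4)) =
      2 * \<bar>sin (pi * real_of_int (u - v) / 8)\<bar>"
  proof -
    have "(c + pi * real_of_int u / 4 - (c + pi * real_of_int v / 4)) / 2 = pi * real_of_int (u - v) / 8"
      by (simp add: field_simps)
    then show ?thesis unfolding dist_cis by presburger
  qed
  also have "\<bar>sin (pi * real_of_int (u - v) / 8)\<bar> = \<bar>sin (pi * real_of_int d / 8)\<bar>"
  proof (cases "u \<le> v")
    case True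
    then have "pi * real_of_int (u - v) / 8 = - (pi * real_of_int d / 8)"
      by (simp add: d_def right_diff_distrib diff_divide_distrib)
    then show ?thesis by simp
  qed (simp add: d_def)
  finally have eq: "dist (cis (c + pi * real_of_int u / 4)) (cis (c + pi * real_of_int v / 4)) =
      2 * \<bar>sin (pi * real_of_int d / 8)\<bar>" .
  have mirror: "sin (pi * (8 - x) / 8) = sin (pi * x / 8)" for x
    using sin_pi_minus[of "pi * x / 8"] by (simp add: right_diff_distrib diff_divide_distrib)
  have side: "765 / 1000 \<le> 2 * sin (pi * 1 / 8)" "1414 / 1000 \<le> 2 * sin (pi * 2 / 8)"
    "1847 / 1000 \<le> 2 * sin (pi * 3 / 8)" "2000 / 1000 \<le> 2 * sin (pi * 4 / 8)"
    "1847 / 1000 \<le> 2 * sin (pi * 5 / 8)" "1414 / 1000 \<le> 2 * sin (pi * 6 / 8)"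
    "765 / 1000 \<le> 2 * sin (pi * 7 / 8)"
    using octagon_sides mirror[of 3] mirror[of 2] mirror[of 1] by simp_all
  have oct: "oct_dist u v = (if d = 1 \<or> d = 7 then 765 else if d = 2 \<or> d = 6 then 1414
     else if d = 3 \<or> d = 5 then 1847 else if d = 4 then 2000 else 0)"
    unfolding oct_dist_def Let_def d_def ..
  have "d = 0 \<or> d = 1 \<or> d = 2 \<or> d = 3 \<or> d = 4 \<or> d = 5 \<or> d = 6 \<or> d = 7" using d by linarith
  then have "real_of_int (oct_dist u v) / 1000 \<le> 2 * sin (pi * real_of_int d / 8)"
    by (elim disjE) (use side in \<open>simp_all add: oct\<close>)
  then have "real_of_int (oct_dist u v) / 1000 \<le> 2 * \<bar>sin (pi * real_of_int d / 8)\<bar>" by linarith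
  then show "real_of_int (oct_dist u v) / 1000 \<le>
      dist (cis (c + pi * real_of_int u / 4)) (cis (c + pi * real_of_int v / 4))"
    unfolding eq .
qed

section \<open>Counting the explored vertices of the polygon\<close>

lemma separated_times_card:
  fixes h :: "'a \<Rightarrow> real"
  assumes "finite W" and \<delta>: "0 < \<delta>" and range: "\<And>k. k \<in> W \<Longrightarrow> 0 \<le> h k \<and> h k < real m * \<delta>"
    and sep: "\<And>k k'. k \<in> W \<Longrightarrow> k' \<in> W \<Longrightarrow> k \<noteq> k' \<Longrightarrow> \<delta> \<le> \<bar>h k - h k'\<bar>"
  shows "card W \<le> m"
proof -
  \<comment> \<open>Times that are \<open>\<delta>\<close> apart fall into different cells of width
    \<open>\<delta>\<close>, and only \<open>m\<close> cells meet the range.\<close>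
  define f where "f k = nat \<lfloor>h k / \<delta>\<rfloor>" for k
  have fl: "real (f k) \<le> h k / \<delta>" "h k / \<delta> < real (f k) + 1" if "k \<in> W" for k
    using range[OF that] \<delta> unfolding f_def by (auto simp: of_nat_nat)
  have "inj_on f W"
  proof (rule inj_onI, rule ccontr)
    fix k k' assume k: "k \<in> W" "k' \<in> W" "f k = f k'" "k \<noteq> k'"
    have "\<bar>h k / \<delta> - h k' / \<delta>\<bar> < 1" using fl[OF k(1)] fl[OF k(2)] k(3) by auto
    then have "\<bar>h k - h k'\<bar> < \<delta>" using \<delta> by (simp add: diff_divide_distrib[symmetric] abs_div_pos[symmetric] divide_less_eq)
    then show False using sep[OF k(1,2,4)] by simp
  qed
  moreover have "f ` W \<subseteq> {..<m}"
  proof safe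
    fix k assume k: "k \<in> W"
    have "h k / \<delta> < real m" using range[OF k] \<delta> by (simp add: divide_less_eq)
    then show "f k < m" using fl(1)[OF k] by linarith
  qed
  ultimately show ?thesis using card_inj_on_le[of f W "{..<m}"] by simp
qed

lemma residue_class_sparse:
  fixes W :: "nat set"
  assumes "finite W" "card W < 2 * M"
  shows "\<exists>r<M. card {k \<in> W. k mod M = r} \<le> 1"
proof (rule ccontr)
  assume "\<not> ?thesis"
  then have "2 \<le> card {k \<in> W. k mod M = r}" if "r < M" for r using that by (auto simp: not_le)
  then have "(\<Sum>r<M. 2) \<le> (\<Sum>r<M. card {k \<in> W. k mod M = r})" by (intro sum_mono) auto
  also have "\<dots> = card (\<Union>r\<in>{..<M}. {k \<in> W. k mod M = r})"
    by (rule card_UN_disjoint[symmetric]) (use assms in auto)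
  also have "\<dots> \<le> card W" using assms by (intro card_mono) auto
  finally show False using assms by simp
qed

text \<open>Reflection at \<open>pi / 2\<close> moves the argument into the half where
  \<open>sin\<close> increases.\<close>

lemma sin_ge_first_step:
  assumes "1 \<le> d" "d + 1 \<le> N"
  shows "sin (pi / real N) \<le> sin (pi * real d / real N)"
proof -
  have N: "2 \<le> N" using assms by simp
  have *: "sin (pi / real N) \<le> sin (pi * real e / real N)" if "1 \<le> e" "2 * e \<le> N" for e
  proof (rule sin_monotone_2pi_le)
    show "- (pi / 2) \<le> pi / real N" by (rule order_trans[of _ 0]) auto
    show "pi / real N \<le> pi * real e / real N" using that N by (simp add: divide_right_mono)
    have "real (2 * e) \<le> real N" using that(2) by (rule of_nat_mono)
    then show "pi * real e / real N \<le> pi / 2" using N by (simp add: field_simps)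
  qed
  show ?thesis
  proof (cases "2 * d \<le> N")
    case True then show ?thesis using * assms by blast
  next
    case False
    then have "sin (pi / real N) \<le> sin (pi * real (N - d) / real N)" using assms by (intro *) auto
    also have "pi * real (N - d) / real N = pi - pi * real d / real N"
      using assms by (simp add: of_nat_diff field_simps)
    finally show ?thesis by simp
  qed
qed

lemma polygon_dist:
  assumes "k < N" "k' < N" "k \<noteq> k'"
  shows "2 * sin (pi / real N) \<le> dist (cis (2 * pi * real k / real N)) (cis (2 * pi * real k' / real N))"
proof -
  have *: "2 * sin (pi / real N) \<le> dist (cis (2 * pi * real a / real N)) (cis (2 * pi * real b / real N))"
    if "b < a" "a < N" for a b
  proof -
    have "(2 * pi * real a / real N - 2 * pi * real b / real N) / 2 = pi * real (a - b) / real N"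
      using that by (simp add: of_nat_diff field_simps)
    then have "dist (cis (2 * pi * real a / real N)) (cis (2 * pi * real b / real N)) = 2 * \<bar>sin (pi * real (a - b) / real N)\<bar>"
      by (simp add: dist_cis)
    moreover have "sin (pi / real N) \<le> sin (pi * real (a - b) / real N)"
      using that by (intro sin_ge_first_step) auto
    ultimately show ?thesis by simp
  qed
  show ?thesis
  proof (cases "k' < k")
    case True then show ?thesis using * assms by blast
  next
    case False then show ?thesis using *[of k k'] assms by (simp add: dist_commute)
  qed
qed

text \<open>\<open>2 * sin (pi / 1024)\<close> is the side of the 1024-gon. A robot needs time 1 to
  reach the circle and at least one side for each further vertex, so it has visited at most 127
  vertices before this time. With \<open>2 * 127 < 2 * 128\<close>, not all of the 128 octagons can
  have two explored vertices.\<close>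

definition search_time :: real where "search_time = 1 + 127 * (2 * sin (pi / 1024))"

lemma no_fast_strategy: "\<not> fast_strategy S (search_time + 3.79)"
proof
  assume fs: "fast_strategy S (search_time + 3.79)"
  define P where "P k = cis (2 * pi * real k / real 1024)" for k :: nat
  have P_circle: "P ` A \<subseteq> unit_circle" for A by (auto simp: P_def unit_circle_def)
  obtain X where X: "admissible_motion 2 X"
    "\<And>p. p \<in> P ` {..<1024} \<Longrightarrow> 0 \<le> hit X p \<and> hit X p < search_time + 3.79 \<and> (\<exists>k\<in>{1..2}. X k (hit X p) = p)"
    "\<And>B C s. B \<in> P ` {..<1024} \<Longrightarrow> C \<in> P ` {..<1024} \<Longrightarrow> s \<le> hit X B \<Longrightarrow> s \<le> hit X C \<Longrightarrow> follows (S (treasures B C)) X s"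
  proof (rule fast_strategy.undiscovered_run[OF fs])
    have "0 \<in> {..<1024 :: nat}" by simp
    then show "P ` {..<1024} \<noteq> {}" by blast
    show "finite (P ` {..<1024})" "P ` {..<1024} \<subseteq> unit_circle" using P_circle by simp_all
  qed (rule that)
  define \<delta> where "\<delta> = 2 * sin (pi / 1024)"
  have \<delta>: "0 < \<delta>" unfolding \<delta>_def by (intro mult_pos_pos sin_gt_zero) auto
  have far: "\<delta> \<le> dist (P k) (P k')" if "k < 1024" "k' < 1024" "k \<noteq> k'" for k k'
    using polygon_dist[of k 1024 k'] that by (simp add: P_def \<delta>_def)
  define W where "W = {k. k < 1024 \<and> hit X (P k) < search_time}"
  define Wi where "Wi i = {k \<in> W. X i (hit X (P k)) = P k}" for i
  have hit: "0 \<le> hit X (P k)" "hit X (P k) < search_time + 3.79" "\<exists>i\<in>{1..2}. X i (hit X (P k)) = P k" if "k < 1024" for k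
    using X(2)[of "P k"] that by auto
  have card_Wi: "card (Wi i) \<le> 127" if i: "i \<in> {1..2}" for i
  proof (rule separated_times_card[OF _ \<delta>, where h = "\<lambda>k. hit X (P k) - 1"])
    show "finite (Wi i)" by (rule finite_subset[of _ "{..<1024}"]) (auto simp: Wi_def W_def)
    fix k assume k: "k \<in> Wi i"
    then have k': "k < 1024" "hit X (P k) < search_time" "X i (hit X (P k)) = P k" by (auto simp: Wi_def W_def)
    have "X i 0 = 0" using X(1) i by (auto simp: admissible_motion_def)
    then have "0 + dist 0 (P k) \<le> hit X (P k)" using travel_time[OF X(1) i order_refl hit(1)[OF k'(1)]] k' by blast
    then show "0 \<le> hit X (P k) - 1 \<and> hit X (P k) - 1 < real 127 * \<delta>"
      using k'(2) by (simp add: P_def search_time_def \<delta>_def)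
  next
    fix k l assume kl: "k \<in> Wi i" "l \<in> Wi i" "k \<noteq> l"
    then have k: "k < 1024" "X i (hit X (P k)) = P k" and l: "l < 1024" "X i (hit X (P l)) = P l" by (auto simp: Wi_def W_def)
    have "dist (P k) (P l) \<le> \<bar>hit X (P k) - hit X (P l)\<bar>"
    proof (cases "hit X (P k) \<le> hit X (P l)")
      case True
      from travel_time[OF X(1) i hit(1)[OF k(1)] True k(2) l(2)] show ?thesis by simp
    next
      case False
      then have "hit X (P l) \<le> hit X (P k)" by simp
      from travel_time[OF X(1) i hit(1)[OF l(1)] this l(2) k(2)] show ?thesis by (simp add: dist_commute)
    qed
    then show "\<delta> \<le> \<bar>hit X (P k) - 1 - (hit X (P l) - 1)\<bar>" using far[OF k(1) l(1) kl(3)] by simp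
  qed
  have fin: "finite W" by (rule finite_subset[of _ "{..<1024}"]) (auto simp: W_def)
  have "W \<subseteq> Wi 1 \<union> Wi 2"
  proof
    fix k assume k: "k \<in> W"
    then obtain i where "i \<in> {1..2::nat}" "X i (hit X (P k)) = P k" using hit(3)[of k] by (auto simp: W_def)
    moreover have "i = 1 \<or> i = 2" using \<open>i \<in> {1..2}\<close> by auto
    ultimately show "k \<in> Wi 1 \<union> Wi 2" using k by (auto simp: Wi_def)
  qed
  then have "card W \<le> card (Wi 1 \<union> Wi 2)" using fin by (intro card_mono) (auto simp: Wi_def)
  also have "\<dots> \<le> card (Wi 1) + card (Wi 2)" by (rule card_Un_le)
  also have "\<dots> < 2 * 128" using card_Wi[of 1] card_Wi[of 2] by simp
  finally obtain r where r: "r < 128" "card {k \<in> W. k mod 128 = r} \<le> 1"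
    using residue_class_sparse[OF fin] by blast
  \<comment> \<open>The explored vertex of the chosen octagon, if there is one; otherwise any number
    will do, since it only rotates the numbering.\<close>
  obtain j where j: "\<And>l. l < 8 \<Longrightarrow> l \<noteq> j \<Longrightarrow> r + 128 * l \<notin> W"
  proof (cases "\<exists>j<8. r + 128 * j \<in> W")
    case True
    then obtain j where j: "j < 8" "r + 128 * j \<in> W" by blast
    show ?thesis
    proof (rule that[of j], rule notI)
      fix l assume l: "l < 8" "l \<noteq> j" "r + 128 * l \<in> W"
      have "card {r + 128 * j, r + 128 * l} \<le> card {k \<in> W. k mod 128 = r}"
        using j l r fin by (intro card_mono) auto
      then show False using r(2) l by simp
    qed
  qed (use that in blast)
  \<comment> \<open>The octagon is numbered starting from \<open>j\<close>, so that the possibly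
    explored vertex is number 0, the one absent from the game.\<close>
  define vert where "vert u = cis ((2 * pi * real r / 1024 + pi * real j / 4) + pi * real_of_int u / 4)" for u
  interpret octagon_game search_time vert
    unfolding vert_def by (rule octagon_game_cis)
  have deadline: "after budget = search_time + 3.79" by (simp add: after_def budget_def)
  have vertP: "\<exists>l<8. l \<noteq> j \<and> vert u = P (r + 128 * l)" if u: "u \<in> {1..7}" for u
  proof -
    define l where "l = nat ((int j + u) mod 8)"
    have l: "int l = (int j + u) mod 8" by (simp add: l_def)
    have "int l \<noteq> int j mod 8"
    proof
      assume "int l = int j mod 8"
      then have "(int j + u) mod 8 = int j mod 8" using l by simp
      then have "8 dvd u" by (simp add: mod_eq_dvd_iff)
      then show False using u by (auto dest: zdvd_imp_le)
    qed
    moreover have l8: "l < 8" using l by (metis of_nat_less_iff of_nat_numeral pos_mod_bound zero_less_numeral)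
    ultimately have "l \<noteq> j" by auto
    define q where "q = (int j + u) div 8"
    have "int j + u = 8 * q + int l" unfolding l q_def by simp
    then have "real j + real_of_int u = 8 * real_of_int q + real l" by (metis of_int_add of_int_mult of_int_numeral of_int_of_nat_eq)
    then have "real_of_int u = 8 * real_of_int q + real l - real j" by simp
    then have "(2 * pi * real r / 1024 + pi * real j / 4) + pi * real_of_int u / 4 =
        2 * pi * real (r + 128 * l) / real 1024 + 2 * pi * real_of_int q"
      by (simp add: ring_distribs add_divide_distrib diff_divide_distrib)
    then have "vert u = P (r + 128 * l)"
      unfolding vert_def P_def
      by (simp only: cis_mult[symmetric] cis_multiple_2pi[OF Ints_of_int] mult_1_right)
    then show ?thesis using l8 \<open>l \<noteq> j\<close> by blast
  qed
  have inV: "vert ` {1..7} \<subseteq> P ` {..<1024}"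
  proof
    fix p assume "p \<in> vert ` {1..7}"
    then obtain u where u: "u \<in> {1..7}" "p = vert u" by blast
    obtain l where l: "l < 8" "vert u = P (r + 128 * l)" using vertP[OF u(1)] by blast
    have "r + 128 * l < 1024" using l r by simp
    then show "p \<in> P ` {..<1024}" using l(2) u(2) by blast
  qed
  have late: "search_time \<le> hit X (vert u)" if u: "u \<in> {1..7}" for u
  proof -
    obtain l where l: "l < 8" "l \<noteq> j" "vert u = P (r + 128 * l)" using vertP[OF u] by blast
    have "r + 128 * l < 1024" using l r by simp
    then show ?thesis using j[OF l(1,2)] l(3) by (auto simp: W_def)
  qed
  have fw: "first_world X {1..7}"
  proof (rule first_world_of_strategy[where V = "P ` {..<1024}" and S = S])
    show "fast_strategy S deadline" using fs unfolding deadline .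
    show "finite (P ` {..<1024})" "P ` {..<1024} \<subseteq> unit_circle" using P_circle by simp_all
    show "{1..7} \<subseteq> {0..7::int}" by auto
    show "vert ` {1..7} \<subseteq> P ` {..<1024}" by (fact inV)
    show "admissible_motion 2 X" by (fact X(1))
  qed (unfold deadline, (fact X(2) X(3))+)
  have fs: "first_state 1 2 X search_time {1..7} (map (\<lambda>v. (v, 0, 0)) [1, 2, 3, 4, 5, 6, 7])"
    unfolding first_state_def
  proof (intro conjI allI impI ballI)
    let ?G = "map (\<lambda>v. (v, 0, 0)) [1, 2, 3, 4, 5, 6, 7 :: int] :: arrivals"
    show "fst ` set ?G \<subseteq> {1..7}" by auto
    then show "search_time \<le> hit X (vert u)" if "u \<in> fst ` set ?G" for u using late that by blast
    show "0 \<le> search_time" using \<delta> by (simp add: search_time_def \<delta>_def)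
    fix Y assume Y: "follows Y X search_time"
    show "arrivals_bound 1 2 Y ?G" unfolding arrivals_bound_def
    proof (safe)
      fix u x y \<tau> assume "(u, x, y) \<in> set ?G" and \<tau>: "(0::real) \<le> \<tau>"
      then have u: "u \<in> {1..7}" and xy: "x = 0" "y = 0" by auto
      show "after x \<le> \<tau>" if "Y 1 \<tau> = vert u"
        using follows_hit[OF Y late[OF u] _ \<tau> that] by (simp add: xy after_def)
      show "after y \<le> \<tau>" if "Y 2 \<tau> = vert u"
        using follows_hit[OF Y late[OF u] _ \<tau> that] by (simp add: xy after_def)
    qed
  qed simp
  show False by (rule first_lost_sound[OF octagon_lost fs fw])
qed

lemma search_time_lower: "1.778 \<le> search_time"
proof -
  define x where "x = pi / 1024"
  have x: "0.00306 \<le> x" "x \<le> 0.00307" "3.141592 / 1024 \<le> x" using pi_approx by (auto simp: x_def)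
  have "\<bar>sin x - (\<Sum>m<3. sin_coeff m * x ^ m)\<bar> \<le> inverse (fact 3) * \<bar>x\<bar> ^ 3" by (rule Maclaurin_sin_bound)
  then have "\<bar>sin x - x\<bar> \<le> x ^ 3 / 6" using x by (simp add: sin_coeff_def numeral_eq_Suc)
  moreover have "x ^ 3 \<le> 0.00307 ^ 3" using x by (intro power_mono) auto
  moreover have "(0.00307::real) ^ 3 \<le> 0.00000006" by (simp add: power3_eq_cube)
  ultimately have "x - 0.00000001 \<le> sin x" by linarith
  then show ?thesis using x unfolding search_time_def x_def[symmetric] by simp
qed

lemma rho_lower: "ereal 5.568 \<le> rho 2 2"
  unfolding rho_def
proof (rule INF_greatest)
  fix S assume S: "S \<in> strategies 2 2"
  have "\<not> fast_strategy S 5.568"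
  proof
    assume "fast_strategy S 5.568"
    then interpret fast_strategy S "5.568" .
    have "fast_strategy S (search_time + 3.79)"
    proof
      fix T i j assume "T \<in> placements 2" "i \<in> {1..2::nat}" "j \<in> {1..2::nat}"
      from fast[OF this] show "\<exists>\<tau>\<ge>0. \<tau> < search_time + 3.79 \<and> S T i \<tau> = T j"
        using search_time_lower by fastforce
    qed fact
    then show False using no_fast_strategy by blast
  qed
  then obtain T i j where T: "T \<in> placements 2" and ij: "i \<in> {1..2}" "j \<in> {1..2}"
    and slow: "\<And>\<tau>. 0 \<le> \<tau> \<Longrightarrow> \<tau> < 5.568 \<Longrightarrow> S T i \<tau> \<noteq> T j"
    using S unfolding fast_strategy_def by blast
  have "ereal 5.568 \<le> completion_time 2 2 (S T) T"
    unfolding completion_time_def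
  proof (rule INF_greatest)
    fix t assume "t \<in> {t. 0 \<le> t \<and> (\<forall>i\<in>{1..2}. \<forall>j\<in>{1..2}. visited_by (S T i) (T j) t)}"
    then have "visited_by (S T i) (T j) t" using ij by blast
    then obtain s where "0 \<le> s" "s \<le> t" "S T i s = T j" by (auto simp: visited_by_def)
    then show "ereal 5.568 \<le> ereal t" using slow[of s] by (cases "s < 5.568") auto
  qed
  also have "\<dots> \<le> (SUP T\<in>placements 2. completion_time 2 2 (S T) T)" using T by (rule SUP_upper)
  finally show "ereal 5.568 \<le> (SUP T\<in>placements 2. completion_time 2 2 (S T) T)" .
qed

section \<open>The constant for two treasures\<close>

definition tour :: "(nat \<Rightarrow> complex) \<Rightarrow> real" where
  "tour T = Min ((\<lambda>\<sigma>. dist (Complex 1 0) (T (\<sigma> 1)) + (\<Sum>i=2..2. dist (T (\<sigma> (i - 1))) (T (\<sigma> i))))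
          ` {\<sigma>. \<sigma> permutes {1..2 :: nat}})"

lemma permutes_two:
  "\<sigma> permutes {1..2 :: nat} \<Longrightarrow> (\<sigma> 1 = 1 \<and> \<sigma> 2 = 2) \<or> (\<sigma> 1 = 2 \<and> \<sigma> 2 = 1)"
proof -
  assume p: "\<sigma> permutes {1..2 :: nat}"
  have "\<sigma> 1 \<in> {1..2}" "\<sigma> 2 \<in> {1..2}" using permutes_in_image[OF p] by auto
  moreover have "\<sigma> 1 \<noteq> \<sigma> 2" using permutes_inj[OF p] by (simp add: inj_eq)
  ultimately show ?thesis by auto
qed

lemma tour_eq: "tour T = min (dist 1 (T 1)) (dist 1 (T 2)) + dist (T 1) (T 2)"
proof -
  let ?f = "\<lambda>\<sigma>. dist (Complex 1 0) (T (\<sigma> 1)) + (\<Sum>i=2..2. dist (T (\<sigma> (i - 1))) (T (\<sigma> i)))"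
  let ?A = "{\<sigma>. \<sigma> permutes {1..2 :: nat}}"
  have one: "Complex 1 0 = 1" by (simp add: complex_eq_iff)
  have img: "?f ` ?A = {dist 1 (T 1) + dist (T 1) (T 2), dist 1 (T 2) + dist (T 1) (T 2)}"
  proof (intro equalityI subsetI)
    fix x assume "x \<in> ?f ` ?A"
    then show "x \<in> {dist 1 (T 1) + dist (T 1) (T 2), dist 1 (T 2) + dist (T 1) (T 2)}"
    proof
      fix \<sigma> assume x: "x = ?f \<sigma>" and "\<sigma> \<in> ?A"
      then have "(\<sigma> 1 = 1 \<and> \<sigma> 2 = 2) \<or> (\<sigma> 1 = 2 \<and> \<sigma> 2 = 1)" using permutes_two by blast
      then show ?thesis unfolding x one by (elim disjE conjE) (simp_all add: dist_commute)
    qed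
  next
    fix x assume x: "x \<in> {dist 1 (T 1) + dist (T 1) (T 2), dist 1 (T 2) + dist (T 1) (T 2)}"
    have "id \<in> ?A" "Transposition.transpose 1 2 \<in> ?A" by (auto simp: permutes_id intro!: permutes_swap_id)
    then have "?f id \<in> ?f ` ?A" "?f (Transposition.transpose 1 2) \<in> ?f ` ?A" by blast+
    then show "x \<in> ?f ` ?A" using x by (auto simp: one dist_commute)
  qed
  show ?thesis unfolding tour_def img by (auto simp: min_def)
qed

text \<open>With \<open>c = cos a\<close> the left-hand side is the square of
  \<open>2 * sin a * (1 + 2 * cos a)\<close>. Its maximum is at the positive root of
  \<open>4 * c\<^sup>2 + c - 2\<close>, about \<open>0.5930703\<close>.\<close>

lemma tour_polynomial_bound:
  fixes c :: real
  assumes "0 \<le> c" "c \<le> 1"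
  shows "4 * (1 - c\<^sup>2) * (1 + 2 * c)\<^sup>2 \<le> 3.52035\<^sup>2"
proof -
  \<comment> \<open>The difference of the two sides has almost a double root at the maximiser.
    Dividing it out leaves the quadratic factor; the rounding errors are absorbed by the slack in
    \<open>3.52035\<close>.\<close>
  define d where "d = 16 * (c - 0.5930703)\<^sup>2 * (c\<^sup>2 + 2.1861406 * c + 1.4913379)"
  have "0 \<le> d" unfolding d_def using assms by (intro mult_nonneg_nonneg add_nonneg_nonneg) auto
  moreover have "d = 16 * c ^ 4 + 16 * c ^ 3 - 74999984222627 / 6250000000000 * c\<^sup>2
      - 499999996816899461073 / 31250000000000000000 * c + 524551830057908942211 / 62500000000000000000"
    unfolding d_def by (simp add: power2_eq_square power3_eq_cube power4_eq_xxxx algebra_simps)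
  moreover have "4 * (1 - c\<^sup>2) * (1 + 2 * c)\<^sup>2 = 4 + 16 * c + 12 * c\<^sup>2 - 16 * c ^ 3 - 16 * c ^ 4"
    by (simp add: power2_eq_square power3_eq_cube power4_eq_xxxx algebra_simps)
  moreover have "0 \<le> c\<^sup>2" "c\<^sup>2 \<le> 1" using assms by (auto simp: power_le_one)
  moreover have "(3.52035::real)\<^sup>2 = 123928641225 / 10000000000" by (simp add: power2_eq_square)
  ultimately show ?thesis using assms by linarith
qed

text \<open>Up to \<open>pi / 4\<close> the crude bound \<open>sqrt 2 + 2\<close> suffices. Beyond
  it \<open>a + b\<close> lies where \<open>sin\<close> decreases, so the worst case is
  \<open>b = a\<close>, which is the pair symmetric about the real axis.\<close>

lemma tour_angle_bound:
  assumes "0 \<le> a" "a \<le> b" "b \<le> pi / 2"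
  shows "2 * sin a + 2 * sin (a + b) \<le> 3.52035"
proof (cases "a \<le> pi / 4")
  case True
  have "sin a \<le> sin (pi / 4)" using assms True by (intro sin_monotone_2pi_le) auto
  moreover have "sqrt 2 \<le> 142 / 100" by (rule real_le_lsqrt) (auto simp: power2_eq_square)
  moreover have "sin (a + b) \<le> 1" by simp
  moreover have "sin (pi / 4) = sqrt 2 / 2" by (rule sin_45)
  ultimately have "2 * sin a + 2 * sin (a + b) \<le> 352035 / 100000" by linarith
  then show ?thesis by simp
next
  case False
  have "sin (pi - (a + b)) \<le> sin (pi - 2 * a)" using assms False by (intro sin_monotone_2pi_le) auto
  then have "sin (a + b) \<le> 2 * sin a * cos a" by (simp add: sin_double)
  then have "2 * sin a + 2 * sin (a + b) \<le> 2 * sin a * (1 + 2 * cos a)" by (simp add: algebra_simps)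
  also have "\<dots> \<le> 3.52035"
  proof (rule power2_le_imp_le)
    have c: "0 \<le> cos a" "cos a \<le> 1" using assms by (auto intro!: cos_ge_zero)
    have "(2 * sin a * (1 + 2 * cos a))\<^sup>2 = 4 * (1 - (cos a)\<^sup>2) * (1 + 2 * cos a)\<^sup>2"
      by (simp add: power_mult_distrib sin_squared_eq)
    then show "(2 * sin a * (1 + 2 * cos a))\<^sup>2 \<le> 3.52035\<^sup>2" using tour_polynomial_bound[OF c] by simp
  qed simp
  finally show ?thesis .
qed

lemma unit_circle_cis_Arg: "p \<in> unit_circle \<Longrightarrow> cis (Arg p) = p"
  using cis_Arg[of p] by (cases "p = 0") (auto simp: unit_circle_def sgn_eq)

text \<open>For given half angles \<open>a\<close> and \<open>b\<close> the points are farthest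
  apart on opposite sides of the real axis, whence \<open>sin (a + b)\<close>. The nearer point
  \<open>p\<close> is visited first.\<close>

lemma tour_le:
  assumes "p \<in> unit_circle" "q \<in> unit_circle" "\<bar>Arg p\<bar> \<le> \<bar>Arg q\<bar>"
  shows "dist 1 p + dist p q \<le> 3.52035"
proof -
  define a b where "a = \<bar>Arg p\<bar> / 2" and "b = \<bar>Arg q\<bar> / 2"
  have ab: "0 \<le> a" "a \<le> b" "b \<le> pi / 2"
    using assms Arg_bounded[of q] by (auto simp: a_def b_def)
  have pq: "p = cis (Arg p)" "q = cis (Arg q)" using assms by (simp_all add: unit_circle_cis_Arg)
  have half: "\<bar>sin (x / 2)\<bar> = sin (\<bar>x\<bar> / 2)" "\<bar>cos (x / 2)\<bar> = cos (\<bar>x\<bar> / 2)" if "\<bar>x\<bar> \<le> pi" for x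
  proof -
    have "0 \<le> sin (\<bar>x\<bar> / 2)" "0 \<le> cos (\<bar>x\<bar> / 2)" using that by (auto intro!: sin_ge_zero cos_ge_zero)
    moreover have "cos (\<bar>x\<bar> / 2) = cos (x / 2)" "\<bar>sin (\<bar>x\<bar> / 2)\<bar> = \<bar>sin (x / 2)\<bar>" by (cases "0 \<le> x"; simp)+
    ultimately show "\<bar>sin (x / 2)\<bar> = sin (\<bar>x\<bar> / 2)" "\<bar>cos (x / 2)\<bar> = cos (\<bar>x\<bar> / 2)" by simp_all
  qed
  have Ap: "\<bar>Arg p\<bar> \<le> pi" and Aq: "\<bar>Arg q\<bar> \<le> pi" using Arg_bounded[of p] Arg_bounded[of q] by auto
  have "dist 1 p = 2 * sin a"
    using dist_cis[of 0 "Arg p"] half(1)[OF Ap] pq(1) by (simp add: a_def)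
  moreover have "dist p q \<le> 2 * sin (a + b)"
  proof -
    have "dist p q = 2 * \<bar>sin (Arg p / 2 - Arg q / 2)\<bar>"
      using dist_cis[of "Arg p" "Arg q"] pq by (simp add: diff_divide_distrib)
    also have "\<dots> \<le> 2 * (\<bar>sin (Arg p / 2)\<bar> * \<bar>cos (Arg q / 2)\<bar> + \<bar>cos (Arg p / 2)\<bar> * \<bar>sin (Arg q / 2)\<bar>)"
      unfolding sin_diff abs_mult[symmetric] by (intro mult_left_mono abs_triangle_ineq4) auto
    also have "\<dots> = 2 * sin (a + b)" unfolding half(1)[OF Ap] half(2)[OF Ap] half(1)[OF Aq] half(2)[OF Aq]
      by (simp add: a_def b_def sin_add)
    finally show ?thesis .
  qed
  ultimately show ?thesis using tour_angle_bound[OF ab] by simp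
qed

lemma path_const_bounds: "3.52033 \<le> path_const 2" "path_const 2 \<le> 3.52035"
proof -
  have pc: "path_const 2 = (SUP T\<in>placements 2. tour T)" unfolding path_const_def tour_def ..
  have up: "tour T \<le> 3.52035" if T: "T \<in> placements 2" for T
  proof -
    have u: "T 1 \<in> unit_circle" "T 2 \<in> unit_circle" using T by (auto simp: placements_def)
    show ?thesis
    proof (cases "\<bar>Arg (T 1)\<bar> \<le> \<bar>Arg (T 2)\<bar>")
      case True
      then show ?thesis using tour_le[OF u] unfolding tour_eq by linarith
    next
      case False
      then have "dist 1 (T 2) + dist (T 2) (T 1) \<le> 3.52035" using tour_le[OF u(2,1)] by simp
      then show ?thesis unfolding tour_eq dist_commute[of "T 1" "T 2"] by linarith
    qed
  qed
  \<comment> \<open>A mirror pair close to the optimum: \<open>0.593\<close> approximates the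
    optimal cosine of the half angle, and \<open>0.648351\<close> is
    \<open>1 - 0.593\<^sup>2\<close>.\<close>
  define \<phi> where "\<phi> = 2 * arccos 0.593"
  have half: "cos (\<phi> / 2) = 0.593" "sin (\<phi> / 2) = sqrt 0.648351"
    by (auto simp: \<phi>_def sin_arccos power2_eq_square)
  have root: "0.8052 \<le> sqrt 0.648351" by (rule real_le_rsqrt) (simp add: power2_eq_square)
  let ?T = "treasures (cis \<phi>) (cis (- \<phi>))"
  have T: "?T \<in> placements 2" by (intro treasures_placement) (auto simp: unit_circle_def)
  have "dist 1 (cis \<phi>) = 2 * sqrt 0.648351" "dist 1 (cis (- \<phi>)) = 2 * sqrt 0.648351"
    using dist_cis[of 0 \<phi>] dist_cis[of 0 "- \<phi>"] half by simp_all
  moreover have "dist (cis \<phi>) (cis (- \<phi>)) = 4 * (sqrt 0.648351 * 0.593)"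
    using dist_cis[of \<phi> "- \<phi>"] half sin_double[of "\<phi> / 2"] by (simp add: abs_mult)
  ultimately have "3.52033 \<le> tour ?T" using root unfolding tour_eq by simp
  also have "\<dots> \<le> path_const 2" unfolding pc using T up by (intro cSUP_upper bdd_aboveI2[where M = "3.52035"]) auto
  finally show "3.52033 \<le> path_const 2" .
  show "path_const 2 \<le> 3.52035" unfolding pc using T up by (intro cSUP_least) auto
qed

section \<open>The strategy for the upper bound\<close>

lemma lipschitz_one_iff:
  fixes f :: "real \<Rightarrow> 'a::metric_space"
  shows "1-lipschitz_on A f \<longleftrightarrow> (\<forall>x\<in>A. \<forall>y\<in>A. x \<le> y \<longrightarrow> dist (f x) (f y) \<le> y - x)"
proof
  assume "1-lipschitz_on A f"
  then show "\<forall>x\<in>A. \<forall>y\<in>A. x \<le> y \<longrightarrow> dist (f x) (f y) \<le> y - x"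
    by (force dest: lipschitz_onD simp: dist_real_def)
next
  assume *: "\<forall>x\<in>A. \<forall>y\<in>A. x \<le> y \<longrightarrow> dist (f x) (f y) \<le> y - x"
  show "1-lipschitz_on A f"
  proof (rule lipschitz_onI)
    fix x y assume "x \<in> A" "y \<in> A"
    then show "dist (f x) (f y) \<le> 1 * dist x y"
      using * by (cases "x \<le> y") (auto simp: dist_real_def dist_commute[of "f x"])
  qed simp
qed

lemma lipschitz_join:
  fixes f g :: "real \<Rightarrow> 'a::metric_space"
  assumes f: "1-lipschitz_on (A \<inter> {..c}) f" and g: "1-lipschitz_on (A \<inter> {c..}) g"
    and c: "f c = g c" "c \<in> A"
  shows "1-lipschitz_on A (\<lambda>t. if t \<le> c then f t else g t)"
  unfolding lipschitz_one_iff
proof (intro ballI impI)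
  fix x y assume A: "x \<in> A" "y \<in> A" "x \<le> y"
  note F = f[unfolded lipschitz_one_iff, rule_format] and G = g[unfolded lipschitz_one_iff, rule_format]
  consider "y \<le> c" | "c < x" | "x \<le> c" "c < y" by linarith
  then show "dist (if x \<le> c then f x else g x) (if y \<le> c then f y else g y) \<le> y - x"
  proof cases
    case 1
    then show ?thesis using F[of x y] A by auto
  next
    case 2
    then show ?thesis using G[of x y] A by auto
  next
    case 3
    have "dist (f x) (g y) \<le> dist (f x) (f c) + dist (g c) (g y)"
      using dist_triangle[of "f x" "g y" "f c"] c by simp
    also have "\<dots> \<le> (c - x) + (y - c)" using F[of x c] G[of c y] A 3 c by (intro add_mono) auto
    finally show ?thesis using 3 by simp
  qed
qed

lemma dist_cis_le: "dist (cis a) (cis b) \<le> \<bar>a - b\<bar>"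
  using abs_sin_x_le_abs_x[of "(a - b) / 2"] by (simp add: dist_cis)

definition sweep :: "real \<Rightarrow> real \<Rightarrow> complex" where
  "sweep \<sigma> t = (if t \<le> 1 then of_real t else cis (\<sigma> * (t - 1)))"

lemma sweep_lipschitz:
  assumes "\<bar>\<sigma>\<bar> = 1"
  shows "1-lipschitz_on A (sweep \<sigma>)"
proof -
  have "1-lipschitz_on UNIV (\<lambda>t. if t \<le> 1 then of_real t else cis (\<sigma> * (t - 1)))"
  proof (rule lipschitz_join)
    show "1-lipschitz_on (UNIV \<inter> {..1}) (of_real :: real \<Rightarrow> complex)"
      unfolding lipschitz_one_iff by (auto simp: dist_norm simp flip: of_real_diff)
    show "1-lipschitz_on (UNIV \<inter> {1..}) (\<lambda>t. cis (\<sigma> * (t - 1)))"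
      unfolding lipschitz_one_iff
    proof (intro ballI impI)
      fix x y :: real assume "x \<le> y"
      have "dist (cis (\<sigma> * (x - 1))) (cis (\<sigma> * (y - 1))) \<le> \<bar>\<sigma> * (x - 1) - \<sigma> * (y - 1)\<bar>" by (rule dist_cis_le)
      also have "\<dots> = \<bar>\<sigma>\<bar> * \<bar>x - y\<bar>" by (simp flip: right_diff_distrib abs_mult)
      also have "\<dots> = y - x" using assms \<open>x \<le> y\<close> by simp
      finally show "dist (cis (\<sigma> * (x - 1))) (cis (\<sigma> * (y - 1))) \<le> y - x" .
    qed
  qed auto
  then have "1-lipschitz_on UNIV (sweep \<sigma>)" unfolding sweep_def .
  then show ?thesis by (rule lipschitz_on_subset) auto
qed

text \<open>The robot that did not find the treasure at \<open>cis (\<sigma> * a)\<close>: it is at \<open>cis (- \<sigma> * a)\<close> when the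
  treasure is found, walks along the chord to the treasure and back, and resumes its sweep.\<close>

definition fetch :: "real \<Rightarrow> real \<Rightarrow> real \<Rightarrow> complex" where
  "fetch \<sigma> a t = (if t \<le> 1 + a then sweep (- \<sigma>) t
     else if t \<le> 1 + a + 4 * sin a
     then Complex (cos a) (\<sigma> * (sin a - \<bar>t - (1 + a + 2 * sin a)\<bar>))
     else cis (- \<sigma> * (t - 1 - 4 * sin a)))"

lemma sweep_at: "0 \<le> a \<Longrightarrow> sweep \<sigma> (1 + a) = cis (\<sigma> * a)"
  by (cases "a = 0") (auto simp: sweep_def)

lemma sweep_ge_1: "1 \<le> t \<Longrightarrow> sweep \<sigma> t = cis (\<sigma> * (t - 1))"
  using sweep_at[of "t - 1" \<sigma>] by simp

lemma cis_sign: "\<bar>\<sigma>\<bar> = 1 \<Longrightarrow> cis (\<sigma> * a) = Complex (cos a) (\<sigma> * sin a)"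
  by (auto simp: complex_eq_iff abs_if split: if_splits)

lemma fetch_lipschitz:
  assumes \<sigma>: "\<bar>\<sigma>\<bar> = 1" and a: "0 \<le> a" "a \<le> pi"
  shows "1-lipschitz_on {0..} (fetch \<sigma> a)"
proof -
  let ?s = "sin a"
  have s: "0 \<le> ?s" using a by (intro sin_ge_zero) auto
  have m: "\<bar>- \<sigma>\<bar> = 1" using \<sigma> by simp
  let ?g = "\<lambda>t. if t \<le> 1 + a + 4 * ?s then Complex (cos a) (\<sigma> * (?s - \<bar>t - (1 + a + 2 * ?s)\<bar>))
     else cis (- \<sigma> * (t - 1 - 4 * ?s))"
  have "1-lipschitz_on ({0..} \<inter> {1 + a..}) ?g"
  proof (rule lipschitz_join)
    show "1-lipschitz_on ({0..} \<inter> {1 + a..} \<inter> {..1 + a + 4 * ?s}) (\<lambda>t. Complex (cos a) (\<sigma> * (?s - \<bar>t - (1 + a + 2 * ?s)\<bar>)))"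
      unfolding lipschitz_one_iff
    proof (intro ballI impI)
      fix x y :: real assume "x \<le> y"
      have "dist (Complex (cos a) (\<sigma> * (?s - \<bar>x - (1 + a + 2 * ?s)\<bar>))) (Complex (cos a) (\<sigma> * (?s - \<bar>y - (1 + a + 2 * ?s)\<bar>)))
          = \<bar>\<sigma> * (?s - \<bar>x - (1 + a + 2 * ?s)\<bar>) - \<sigma> * (?s - \<bar>y - (1 + a + 2 * ?s)\<bar>)\<bar>"
        by (simp add: dist_norm cmod_def)
      also have "\<dots> = \<bar>\<sigma>\<bar> * \<bar>(?s - \<bar>x - (1 + a + 2 * ?s)\<bar>) - (?s - \<bar>y - (1 + a + 2 * ?s)\<bar>)\<bar>"
        unfolding right_diff_distrib[symmetric] abs_mult ..
      also have "\<dots> \<le> y - x" using \<sigma> \<open>x \<le> y\<close> by simp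
      finally show "dist (Complex (cos a) (\<sigma> * (?s - \<bar>x - (1 + a + 2 * ?s)\<bar>))) (Complex (cos a) (\<sigma> * (?s - \<bar>y - (1 + a + 2 * ?s)\<bar>)))
         \<le> y - x" .
    qed
    show "1-lipschitz_on ({0..} \<inter> {1 + a..} \<inter> {1 + a + 4 * ?s..}) (\<lambda>t. cis (- \<sigma> * (t - 1 - 4 * ?s)))"
      unfolding lipschitz_one_iff
    proof (intro ballI impI)
      fix x y :: real assume "x \<le> y"
      have "dist (cis (- \<sigma> * (x - 1 - 4 * ?s))) (cis (- \<sigma> * (y - 1 - 4 * ?s))) \<le> \<bar>- \<sigma> * (x - 1 - 4 * ?s) - - \<sigma> * (y - 1 - 4 * ?s)\<bar>"
        by (rule dist_cis_le)
      also have "\<dots> = \<bar>- \<sigma>\<bar> * \<bar>x - 1 - 4 * ?s - (y - 1 - 4 * ?s)\<bar>"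
        unfolding right_diff_distrib[symmetric] abs_mult ..
      also have "\<dots> = y - x" using \<sigma> \<open>x \<le> y\<close> by simp
      finally show "dist (cis (- \<sigma> * (x - 1 - 4 * ?s))) (cis (- \<sigma> * (y - 1 - 4 * ?s))) \<le> y - x" .
    qed
    show "Complex (cos a) (\<sigma> * (?s - \<bar>1 + a + 4 * ?s - (1 + a + 2 * ?s)\<bar>)) = cis (- \<sigma> * (1 + a + 4 * ?s - 1 - 4 * ?s))"
      using cis_sign[OF m, of a] s by (simp add: algebra_simps)
    show "1 + a + 4 * ?s \<in> {0..} \<inter> {1 + a..}" using a s by auto
  qed
  then have "1-lipschitz_on {0..} (\<lambda>t. if t \<le> 1 + a then sweep (- \<sigma>) t else ?g t)"
  proof (rule lipschitz_join[OF sweep_lipschitz[OF m]])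
    show "sweep (- \<sigma>) (1 + a) = ?g (1 + a)"
      using s a cis_sign[OF m, of a] by (simp add: sweep_at)
  qed (use a in simp)
  then show ?thesis unfolding fetch_def .
qed

text \<open>For \<open>P = Q\<close> the quotient is 0 by the convention on division by zero, so the
  robot rests; the minimum keeps it at \<open>Q\<close> after its arrival.\<close>

definition walk :: "complex \<Rightarrow> complex \<Rightarrow> real \<Rightarrow> complex" where
  "walk P Q r = P + of_real (min r (dist P Q) / dist P Q) * (Q - P)"

lemma walk_0 [simp]: "walk P Q 0 = P" by (simp add: walk_def min_def)

lemma walk_end [simp]: "walk P Q (dist P Q) = Q" by (simp add: walk_def)

lemma walk_lipschitz: "1-lipschitz_on A (walk P Q)"
  unfolding lipschitz_one_iff
proof (intro ballI impI)
  fix x y :: real assume "x \<le> y"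
  have "dist (walk P Q x) (walk P Q y) = \<bar>min x (dist P Q) / dist P Q - min y (dist P Q) / dist P Q\<bar> * norm (Q - P)"
  proof -
    have "walk P Q x - walk P Q y =
        of_real (min x (dist P Q) / dist P Q - min y (dist P Q) / dist P Q) * (Q - P)"
      unfolding walk_def of_real_diff left_diff_distrib by simp
    then show ?thesis unfolding dist_norm[of "walk P Q x"] by (simp only: norm_mult norm_of_real)
  qed
  also have "\<dots> = \<bar>min x (dist P Q) - min y (dist P Q)\<bar> / dist P Q * dist P Q"
    by (simp add: dist_norm norm_minus_commute abs_divide flip: diff_divide_distrib)
  also have "\<dots> \<le> \<bar>min x (dist P Q) - min y (dist P Q)\<bar>" by (cases "P = Q") auto
  also have "\<dots> \<le> y - x" using \<open>x \<le> y\<close> by auto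
  finally show "dist (walk P Q x) (walk P Q y) \<le> y - x" .
qed

definition walk2 :: "complex \<Rightarrow> complex \<Rightarrow> complex \<Rightarrow> real \<Rightarrow> complex" where
  "walk2 P Q R r = (if r \<le> dist P Q then walk P Q r else walk Q R (r - dist P Q))"

lemma walk2_lipschitz: "1-lipschitz_on {0..} (walk2 P Q R)"
proof -
  have "1-lipschitz_on ({0..} \<inter> {dist P Q..}) (\<lambda>r. walk Q R (r - dist P Q))"
    unfolding lipschitz_one_iff
  proof (intro ballI impI)
    fix x y :: real assume "x \<le> y"
    then show "dist (walk Q R (x - dist P Q)) (walk Q R (y - dist P Q)) \<le> y - x"
      using walk_lipschitz[of UNIV Q R, unfolded lipschitz_one_iff, rule_format, of "x - dist P Q" "y - dist P Q"] by simp
  qed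
  then show ?thesis unfolding walk2_def by (intro lipschitz_join walk_lipschitz) auto
qed

lemma walk2_visits:
  "walk2 P Q R 0 = P" "walk2 P Q R (dist P Q) = Q" "walk2 P Q R (dist P Q + dist Q R) = R"
  by (auto simp: walk2_def not_le)

section \<open>Trigonometric estimates of the costs\<close>

lemma sum_lessThan_10: "(\<Sum>m<(10::nat). f m) = f 0 + f 1 + f 2 + f 3 + f 4 + f 5 + f 6 + f 7 + f 8 + (f 9 :: real)"
  by (simp add: eval_nat_numeral)

lemma sin_taylor:
  fixes x :: real
  shows "\<bar>sin x - (x - x ^ 3 / 6 + x ^ 5 / 120 - x ^ 7 / 5040 + x ^ 9 / 362880)\<bar> \<le> \<bar>x\<bar> ^ 10 / 3628800"
proof -
  have 1: "(\<Sum>m<10. sin_coeff m * x ^ m) = x - x ^ 3 / 6 + x ^ 5 / 120 - x ^ 7 / 5040 + x ^ 9 / 362880"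
    unfolding sum_lessThan_10 by (simp add: sin_coeff_def fact_numeral)
  have 2: "inverse (fact 10) * \<bar>x\<bar> ^ 10 = \<bar>x\<bar> ^ 10 / 3628800"
    by (simp add: fact_numeral)
  show ?thesis using Maclaurin_sin_bound[of x 10] unfolding 1 2 .
qed

lemma cos_taylor:
  fixes x :: real
  shows "\<bar>cos x - (1 - x ^ 2 / 2 + x ^ 4 / 24 - x ^ 6 / 720 + x ^ 8 / 40320)\<bar> \<le> \<bar>x\<bar> ^ 10 / 3628800"
proof -
  obtain t where t: "cos x = (\<Sum>m<10. cos_coeff m * x ^ m) + (cos (t + 1/2 * real 10 * pi) / fact 10) * x ^ 10"
    using Maclaurin_cos_expansion[of x 10] by blast
  have "(\<Sum>m<10. cos_coeff m * x ^ m) = 1 - x ^ 2 / 2 + x ^ 4 / 24 - x ^ 6 / 720 + x ^ 8 / 40320"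
    unfolding sum_lessThan_10 by (simp add: cos_coeff_def fact_numeral)
  then have "\<bar>cos x - (1 - x ^ 2 / 2 + x ^ 4 / 24 - x ^ 6 / 720 + x ^ 8 / 40320)\<bar> =
      \<bar>cos (t + 1/2 * real 10 * pi)\<bar> * (\<bar>x\<bar> ^ 10 / 3628800)"
    using t by (simp add: fact_numeral abs_mult power_abs)
  also have "\<dots> \<le> 1 * (\<bar>x\<bar> ^ 10 / 3628800)" by (intro mult_right_mono) auto
  finally show ?thesis by simp
qed

lemma sin_leI: "x - x ^ 3 / 6 + x ^ 5 / 120 - x ^ 7 / 5040 + x ^ 9 / 362880 + \<bar>x\<bar> ^ 10 / 3628800 \<le> y \<Longrightarrow> sin x \<le> y"
  and sin_geI: "y \<le> x - x ^ 3 / 6 + x ^ 5 / 120 - x ^ 7 / 5040 + x ^ 9 / 362880 - \<bar>x\<bar> ^ 10 / 3628800 \<Longrightarrow> y \<le> sin x"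
  and cos_leI: "1 - x ^ 2 / 2 + x ^ 4 / 24 - x ^ 6 / 720 + x ^ 8 / 40320 + \<bar>x\<bar> ^ 10 / 3628800 \<le> y \<Longrightarrow> cos x \<le> y"
  and cos_geI: "y \<le> 1 - x ^ 2 / 2 + x ^ 4 / 24 - x ^ 6 / 720 + x ^ 8 / 40320 - \<bar>x\<bar> ^ 10 / 3628800 \<Longrightarrow> y \<le> cos x"
  for x y :: real
  using sin_taylor[of x] cos_taylor[of x] by linarith+

text \<open>Concavity of \<open>sin\<close> on \<open>[0, pi]\<close>: the slope of a chord is an
  intermediate value of \<open>cos\<close>, which decreases there.\<close>

lemma sin_le_tangent:
  assumes "0 \<le> x" "x \<le> pi" "0 \<le> y" "y \<le> pi"
  shows "sin y \<le> sin x + cos x * (y - x)"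
proof (cases x y rule: linorder_cases)
  case less
  obtain z where z: "x < z" "z < y" "sin y - sin x = (y - x) * cos z"
    using MVT2[OF less, of sin cos] by (auto intro: DERIV_sin)
  have "cos z \<le> cos x" using z assms by (intro cos_monotone_0_pi_le) auto
  then have "(y - x) * cos z \<le> (y - x) * cos x" using less by (intro mult_left_mono) auto
  then show ?thesis using z by (simp add: algebra_simps)
next
  case greater
  obtain z where z: "y < z" "z < x" "sin x - sin y = (x - y) * cos z"
    using MVT2[OF greater, of sin cos] by (auto intro: DERIV_sin)
  have "cos x \<le> cos z" using z assms by (intro cos_monotone_0_pi_le) auto
  then have "(x - y) * cos x \<le> (x - y) * cos z" using greater by (intro mult_left_mono) auto
  then show ?thesis using z by (simp add: algebra_simps)
qed simp

text \<open>Balances the worst case of fetching the first treasure at once, which grows with \<open>a\<close>, against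
  that of sweeping on, which decreases with \<open>a\<close>.\<close>

definition fetch_limit :: real where "fetch_limit = 77053 / 100000"

lemma fetch_limit_sin: "sin fetch_limit \<le> 69652 / 100000"
  unfolding fetch_limit_def by (rule sin_leI) (simp add: power_divide)

lemma fetch_limit_bounds: "0 < fetch_limit" "fetch_limit < pi / 2"
  using pi_approx by (auto simp: fetch_limit_def)

lemma sin_le_of_less_fetch_limit: "0 \<le> a \<Longrightarrow> a < fetch_limit \<Longrightarrow> sin a \<le> 69652 / 100000"
  using fetch_limit_sin fetch_limit_bounds sin_monotone_2pi_le[of a fetch_limit] by simp

text \<open>The left hand side is concave in \<open>b\<close>; for \<open>a = fetch_limit\<close> its maximum is near \<open>pi - w\<close>.\<close>

lemma sweep_cost:
  assumes "fetch_limit \<le> a" "a \<le> b" "b \<le> pi"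
  shows "1 + b + 2 * sin b + 2 * sin ((b - a) / 2) \<le> 6.2195"
proof -
  \<comment> \<open>\<open>w\<close> solves \<open>2 * cos w = 1 + sin u\<close> up to rounding,
    which says that the derivative in \<open>b\<close> vanishes at \<open>pi - w\<close> for
    \<open>a = fetch_limit\<close>. So the linear terms of \<open>b\<close> and of the two tangents
    cancel up to the tiny coefficient estimated in fact \<open>4\<close>.\<close>
  define w :: real where "w = 611667 / 1000000"
  define u :: real where "u = 6910985 / 10000000"
  have u: "2 * u = w + fetch_limit" by (simp add: u_def w_def fetch_limit_def)
  have sw: "sin w \<le> 5742331 / 10000000" and cw: "8186918 / 10000000 \<le> cos w" "cos w \<le> 8186920 / 10000000"
    unfolding w_def by (rule sin_leI cos_geI cos_leI, simp add: power_divide)+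
  have cu: "cos u \<le> 7705465 / 10000000" and su: "6373839 / 10000000 \<le> sin u" "sin u \<le> 6373842 / 10000000"
    unfolding u_def by (rule cos_leI sin_geI sin_leI, simp add: power_divide)+
  define v where "v = pi - b"
  define d where "d = v - w"
  have pi: "3.14159 \<le> pi" "pi \<le> 3.14159266" using pi_approx by auto
  have v: "0 \<le> v" "v \<le> pi - fetch_limit" using assms by (auto simp: v_def)
  have "- 1.8 \<le> d" "d \<le> 1.8" using v pi by (simp_all add: d_def w_def fetch_limit_def)
  then have d: "\<bar>d\<bar> \<le> 9 / 5" by simp
  have "sin v \<le> sin w + cos w * d"
    unfolding d_def using v fetch_limit_bounds pi by (intro sin_le_tangent) (auto simp: w_def)
  then have 1: "sin b \<le> sin w + cos w * d" by (simp add: v_def)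
  have "sin ((b - fetch_limit) / 2) \<le> sin (pi / 2 - u) + cos (pi / 2 - u) * ((b - fetch_limit) / 2 - (pi / 2 - u))"
    using assms fetch_limit_bounds pi by (intro sin_le_tangent) (auto simp: u_def fetch_limit_def)
  also have "(b - fetch_limit) / 2 - (pi / 2 - u) = - d / 2"
    using u by (simp add: d_def v_def field_simps)
  also have "sin (pi / 2 - u) = cos u" by (simp add: cos_sin_eq)
  also have "cos (pi / 2 - u) = sin u" by (simp add: sin_cos_eq)
  finally have 2: "sin ((b - fetch_limit) / 2) \<le> cos u - sin u * d / 2" by simp
  have 3: "sin ((b - a) / 2) \<le> sin ((b - fetch_limit) / 2)"
    using assms fetch_limit_bounds by (intro sin_monotone_2pi_le) auto
  have "(2 * cos w - 1 - sin u) * d \<le> \<bar>2 * cos w - 1 - sin u\<bar> * \<bar>d\<bar>"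
    unfolding abs_mult[symmetric] by (rule abs_ge_self)
  also have "\<dots> \<le> 1 / 1000000 * (9 / 5)"
  proof (rule mult_mono)
    show "\<bar>2 * cos w - 1 - sin u\<bar> \<le> 1 / 1000000" using cw su by linarith
  qed (use d in auto)
  finally have 4: "2 * (cos w * d) - d - sin u * d \<le> 1 / 1000000 * (9 / 5)" by (simp add: algebra_simps)
  have b: "b = pi - 611667 / 1000000 - d" by (simp add: d_def v_def w_def)
  have "pi \<le> 314159266 / 100000000" using pi by simp
  with 1 2 3 4 sw cu b have "1 + b + 2 * sin b + 2 * sin ((b - a) / 2) \<le> 62195 / 10000" by linarith
  then show ?thesis by simp
qed

text \<open>\<open>q + 2 * sin q\<close> is concave with its maximum at \<open>2 * pi / 3\<close>.
  After a fetch has delayed one robot by \<open>4 * sin a\<close>, \<open>q\<close> is the mean of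
  the arcs swept by the two robots, so \<open>1 + 2 * sin a + q\<close> is the time and
  \<open>2 * sin q\<close> is the chord between them.\<close>

lemma evacuation_cost:
  assumes "0 \<le> a" "a < fetch_limit" "0 \<le> q" "q \<le> pi"
  shows "1 + 2 * sin a + q + 2 * sin q \<le> 6.2195"
proof -
  have "sin q \<le> sin (2 * pi / 3) + cos (2 * pi / 3) * (q - 2 * pi / 3)"
    using assms by (intro sin_le_tangent) auto
  then have "sin q \<le> sqrt 3 / 2 + - (1 / 2) * (q - 2 * pi / 3)"
    unfolding sin_120 cos_120 by simp
  then have "2 * sin q \<le> sqrt 3 - (q - 2 * pi / 3)" by (simp add: field_simps)
  then have "q + 2 * sin q \<le> 2 * pi / 3 + sqrt 3" by linarith
  moreover have "sqrt 3 \<le> 173205081 / 100000000" by (rule real_le_lsqrt) (auto simp: power2_eq_square)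
  moreover have "pi \<le> 3.14159266" using pi_approx by simp
  ultimately show ?thesis using sin_le_of_less_fetch_limit[OF assms(1,2)] by simp
qed

text \<open>\<open>l\<close> is the fraction of the way back covered at the second discovery. For
  \<open>a\<close> up to \<open>0.68\<close> crude bounds suffice. For larger \<open>a\<close> the
  worst case is \<open>l = 1\<close>, which is \<open>evacuation_cost\<close> at
  \<open>q = a + 2 * sin a\<close>; smaller \<open>l\<close> is compared with it by the tangent of
  \<open>sin\<close> at \<open>q\<close>.\<close>

lemma return_cost:
  assumes a: "0 \<le> a" "a < fetch_limit" and l: "0 \<le> l" "l \<le> 1"
  shows "1 + a + 2 * sin a * (1 + l) + 2 * (1 - l) + 2 * l * sin (a + sin a * (1 + l)) \<le> 6.2195"
proof (cases "a \<le> 0.68")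
  case True
  have "sin a \<le> sin 0.68" using True a pi_approx by (intro sin_monotone_2pi_le) auto
  also have "\<dots> \<le> 0.6288" by (rule sin_leI) (simp add: power_divide)
  finally have s: "sin a \<le> 0.6288" .
  have s0: "0 \<le> sin a" using a fetch_limit_bounds by (intro sin_ge_zero) auto
  have "2 * l * sin (a + sin a * (1 + l)) \<le> 2 * l * 1" using l by (intro mult_left_mono) auto
  moreover have "2 * sin a * (1 + l) \<le> 2 * sin a * 2" using l s0 by (intro mult_left_mono) auto
  ultimately show ?thesis using True s by simp
next
  case False
  define s where "s = sin a"
  define q where "q = a + 2 * s"
  define c where "c = - cos q"
  have "0.6 \<le> sin (0.68::real)" by (rule sin_geI) (simp add: power_divide)
  also have "\<dots> \<le> s" unfolding s_def using False a fetch_limit_bounds by (intro sin_monotone_2pi_le) auto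
  finally have s: "0.6 \<le> s" "s \<le> 0.69652" using sin_le_of_less_fetch_limit[OF a] by (auto simp: s_def)
  have q: "pi / 2 \<le> q" "q \<le> pi / 2 + 0.6" "q \<le> pi" using s False a pi_approx by (auto simp: q_def fetch_limit_def)
  have cq: "c = sin (q - pi / 2)" unfolding c_def by (simp add: sin_diff)
  have c: "0 \<le> c" "c \<le> 0.6"
    unfolding cq using q sin_x_le_x[of "q - pi / 2"] by (auto intro!: sin_ge_zero)
  have "0.8\<^sup>2 \<le> (sin q)\<^sup>2"
  proof -
    have "c\<^sup>2 \<le> 0.6\<^sup>2" using c by (intro power_mono) auto
    then show ?thesis unfolding sin_squared_eq c_def by (simp add: power2_eq_square)
  qed
  then have sq: "0.8 \<le> sin q" by (rule power2_le_imp_le) (use q pi_ge_zero in \<open>auto intro!: sin_ge_zero\<close>)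
  define m where "m = 1 - l"
  have m: "0 \<le> m" "m \<le> 1" using l by (auto simp: m_def)
  have "sin (a + s * (1 + l)) \<le> sin q + cos q * (a + s * (1 + l) - q)"
  proof (rule sin_le_tangent)
    show "0 \<le> a + s * (1 + l)" using a s l by (intro add_nonneg_nonneg mult_nonneg_nonneg) auto
    have "s * (1 + l) \<le> s * 2" using s l by (intro mult_left_mono) auto
    then show "a + s * (1 + l) \<le> pi" using q by (simp add: q_def)
  qed (use q pi_ge_zero in auto)
  also have "a + s * (1 + l) - q = - (s * m)" by (simp add: q_def m_def algebra_simps)
  finally have "sin (a + s * (1 + l)) \<le> sin q + c * (s * m)" by (simp add: c_def)
  then have "2 * l * sin (a + s * (1 + l)) \<le> 2 * l * (sin q + c * (s * m))" using l by (intro mult_left_mono) auto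
  moreover have "1 + a + 2 * s * (1 + l) + 2 * (1 - l) + 2 * l * (sin q + c * (s * m)) =
      1 + 2 * s + q + 2 * sin q + 2 * (m * (1 - s - sin q + l * (c * s)))"
    by (simp add: m_def q_def algebra_simps)
  \<comment> \<open>Twice this product bounds the change in cost when \<open>l\<close> is lowered
    from 1 by \<open>m\<close>.\<close>
  moreover have "m * (1 - s - sin q + l * (c * s)) \<le> 0"
  proof (rule mult_nonneg_nonpos[OF m(1)])
    have "l * (c * s) \<le> 1 * (3 / 5 * s)" using l c s by (intro mult_mono) auto
    moreover have "3 / 5 \<le> s" "4 / 5 \<le> sin q" using s sq by simp_all
    ultimately show "1 - s - sin q + l * (c * s) \<le> 0" by linarith
  qed
  moreover have "1 + 2 * s + q + 2 * sin q \<le> 6.2195"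
    unfolding s_def using evacuation_cost[OF a, of q] q pi_ge_zero by auto
  ultimately show ?thesis unfolding s_def by linarith
qed

section \<open>The response to an ordered pair of treasures\<close>

definition side :: "nat \<Rightarrow> real" where "side i = (if i = 1 then 1 else - 1)"

definition finder :: "complex \<Rightarrow> real" where "finder A = (if 0 \<le> Arg A then 1 else - 1)"

text \<open>The motion until \<open>B\<close> is acted upon. It may mention \<open>A\<close> from
  the start, because up to the discovery of \<open>A\<close> it is plain sweeping whatever
  \<open>A\<close> is.\<close>

definition explore :: "complex \<Rightarrow> nat \<Rightarrow> real \<Rightarrow> complex" where
  "explore A i = (if \<bar>Arg A\<bar> < fetch_limit \<and> side i \<noteq> finder A then fetch (finder A) \<bar>Arg A\<bar> else sweep (side i))"

text \<open>The arc from 1 to \<open>B\<close> in the direction in which the finder of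
  \<open>A\<close> sweeps.\<close>

definition ahead :: "complex \<Rightarrow> complex \<Rightarrow> real" where
  "ahead A B = (if 0 \<le> finder A * Arg B then \<bar>Arg B\<bar> else 2 * pi - \<bar>Arg B\<bar>)"

text \<open>In the fetching case the minimum compares the arrival of the finder at \<open>B\<close>
  with that of the other robot, delayed by \<open>4 * sin \<bar>Arg A\<bar>\<close>. If
  \<open>B\<close> differs from \<open>A\<close> but is its mirror image, the fetching robot has
  already passed it at time \<open>1 + \<bar>Arg A\<bar>\<close>; the strategy disregards this until
  the time given here, which non-anticipation permits.\<close>

definition second_time :: "complex \<Rightarrow> complex \<Rightarrow> real" where
  "second_time A B = (if \<bar>Arg A\<bar> < fetch_limit
     then min (1 + ahead A B) (1 + (2 * pi - ahead A B) + 4 * sin \<bar>Arg A\<bar>) else 1 + \<bar>Arg B\<bar>)"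

definition respond :: "complex \<Rightarrow> complex \<Rightarrow> nat \<Rightarrow> real \<Rightarrow> complex" where
  "respond A B i t = (let \<tau> = second_time A B; P = explore A i \<tau> in
     if t \<le> \<tau> then explore A i t
     else if visited_by (explore A i) A \<tau> then walk2 P B B (t - \<tau>)
     else if dist P A \<le> dist P B then walk2 P A B (t - \<tau>) else walk2 P B A (t - \<tau>))"

lemma side_cases: "side i = 1 \<or> side i = - 1" by (simp add: side_def)

lemma side_abs [simp]: "\<bar>side i\<bar> = 1" by (simp add: side_def)

lemma finder_cases: "finder A = 1 \<or> finder A = - 1" by (simp add: finder_def)

lemma finder_abs [simp]: "\<bar>finder A\<bar> = 1" by (simp add: finder_def)

lemma side_other: "side i \<noteq> finder A \<Longrightarrow> side i = - finder A"
  using side_cases[of i] finder_cases[of A] by auto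

lemma finder_side: "\<exists>i\<in>{1..2}. side i = \<sigma>" if "\<sigma> = 1 \<or> \<sigma> = - 1"
  using that by (auto simp: side_def intro: bexI[of _ 1] bexI[of _ 2])

lemma Arg_le_pi: "\<bar>Arg z\<bar> \<le> pi"
  using Arg_bounded[of z] by auto

lemma explore_lipschitz: "1-lipschitz_on {0..} (explore A i)"
  using Arg_le_pi[of A] by (auto simp: explore_def intro!: fetch_lipschitz sweep_lipschitz)

lemma explore_start: "t \<le> 1 + \<bar>Arg A\<bar> \<Longrightarrow> explore A i t = sweep (side i) t"
  using side_other[of i A] by (auto simp: explore_def fetch_def)

lemma walk2_start: "walk2 P Q R 0 = P" by (fact walk2_visits)

text \<open>Lets the Lipschitz proof treat all branches of \<open>respond\<close> at once: a walk to
  a single target is \<open>walk2\<close> with the target repeated.\<close>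

lemma respond_late:
  "\<exists>X Y. \<forall>r\<ge>0. respond A B i (second_time A B + r) = walk2 (explore A i (second_time A B)) X Y r"
proof -
  define \<tau> where "\<tau> = second_time A B"
  define P where "P = explore A i \<tau>"
  define XY where "XY = (if visited_by (explore A i) A \<tau> then (B, B) else if dist P A \<le> dist P B then (A, B) else (B, A))"
  have "respond A B i (\<tau> + r) = walk2 P (fst XY) (snd XY) r" if "0 \<le> r" for r
    using that by (cases "r = 0") (auto simp: respond_def Let_def \<tau>_def[symmetric] P_def[symmetric] XY_def walk2_start)
  then show ?thesis unfolding \<tau>_def P_def by blast
qed

lemma respond_lipschitz:
  assumes "0 \<le> second_time A B"
  shows "1-lipschitz_on {0..} (respond A B i)"
proof -
  let ?\<tau> = "second_time A B"
  obtain X Y where late: "\<And>r. 0 \<le> r \<Longrightarrow> respond A B i (?\<tau> + r) = walk2 (explore A i ?\<tau>) X Y r"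
    using respond_late by blast
  have "1-lipschitz_on {0..} (\<lambda>t. if t \<le> ?\<tau> then explore A i t else walk2 (explore A i ?\<tau>) X Y (t - ?\<tau>))"
  proof (rule lipschitz_join)
    show "1-lipschitz_on ({0..} \<inter> {..?\<tau>}) (explore A i)"
      by (rule lipschitz_on_subset[OF explore_lipschitz]) auto
    show "1-lipschitz_on ({0..} \<inter> {?\<tau>..}) (\<lambda>t. walk2 (explore A i ?\<tau>) X Y (t - ?\<tau>))"
      unfolding lipschitz_one_iff
    proof (intro ballI impI)
      fix x y assume "x \<in> {0..} \<inter> {?\<tau>..}" "y \<in> {0..} \<inter> {?\<tau>..}" "x \<le> y"
      then show "dist (walk2 (explore A i ?\<tau>) X Y (x - ?\<tau>)) (walk2 (explore A i ?\<tau>) X Y (y - ?\<tau>)) \<le> y - x"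
        using walk2_lipschitz[of "explore A i ?\<tau>" X Y, unfolded lipschitz_one_iff, rule_format, of "x - ?\<tau>" "y - ?\<tau>"] by simp
    qed
  qed (use assms in \<open>auto simp: walk2_start\<close>)
  moreover have "(if t \<le> ?\<tau> then explore A i t else walk2 (explore A i ?\<tau>) X Y (t - ?\<tau>)) = respond A B i t" for t
    using late[of "t - ?\<tau>"] by (auto simp: respond_def Let_def)
  ultimately show ?thesis by simp
qed

lemma visited_by_mono: "visited_by x p s \<Longrightarrow> s \<le> t \<Longrightarrow> visited_by x p t"
  by (force simp: visited_by_def)

lemma respond_early: "t \<le> second_time A B \<Longrightarrow> respond A B i t = explore A i t"
  by (simp add: respond_def Let_def)

lemma respond_visited_early:
  "visited_by (explore A i) p s \<Longrightarrow> s \<le> second_time A B \<Longrightarrow> visited_by (respond A B i) p s"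
  by (auto simp: visited_by_def respond_early intro!: bexI)

text \<open>The second alternative of \<open>cost\<close> also serves a robot that has already been
  at \<open>A\<close>: by the triangle inequality its direct walk to \<open>B\<close> is no longer
  than the tour through both.\<close>

lemma respond_visits:
  assumes \<tau>: "0 \<le> second_time A B"
    and cost: "(visited_by (explore A i) A (second_time A B) \<and> second_time A B + dist (explore A i (second_time A B)) B \<le> K) \<or>
      second_time A B + min (dist (explore A i (second_time A B)) A) (dist (explore A i (second_time A B)) B) + dist A B \<le> K"
  shows "visited_by (respond A B i) A K \<and> visited_by (respond A B i) B K"
proof -
  define \<tau> where "\<tau> = second_time A B"
  define P where "P = explore A i \<tau>"
  have \<tau>0: "0 \<le> \<tau>" using \<tau> by (simp add: \<tau>_def)
  have visit: "visited_by (respond A B i) p K" if "respond A B i (\<tau> + r) = p" "0 \<le> r" "\<tau> + r \<le> K" for p r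
    using that \<tau>0 unfolding visited_by_def by (intro bexI[of _ "\<tau> + r"]) auto
  have cost': "(visited_by (explore A i) A \<tau> \<and> \<tau> + dist P B \<le> K) \<or> \<tau> + min (dist P A) (dist P B) + dist A B \<le> K"
    using cost by (simp add: P_def \<tau>_def)
  show ?thesis
  proof (cases "visited_by (explore A i) A \<tau>")
    case True
    have "dist P B \<le> min (dist P A) (dist P B) + dist A B"
      using dist_triangle[of P B A] by (auto simp: min_def)
    then have le: "\<tau> + dist P B \<le> K" using cost' by linarith
    have "respond A B i (\<tau> + r) = walk2 P B B r" if "0 \<le> r" for r
      using that True by (cases "r = 0") (auto simp: respond_def Let_def \<tau>_def[symmetric] P_def[symmetric] walk2_start)
    then have "respond A B i (\<tau> + dist P B) = B" by (simp add: walk2_visits)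
    then have "visited_by (respond A B i) B K" using le by (intro visit) auto
    moreover have "\<tau> \<le> K" using le zero_le_dist[of P B] by linarith
    then have "visited_by (respond A B i) A K"
      using respond_visited_early[OF True, of B] visited_by_mono by (auto simp: \<tau>_def)
    ultimately show ?thesis by simp
  next
    case False
    then have le: "\<tau> + min (dist P A) (dist P B) + dist A B \<le> K" using cost' by simp
    show ?thesis
    proof (cases "dist P A \<le> dist P B")
      case True
      have eq: "respond A B i (\<tau> + r) = walk2 P A B r" if "0 \<le> r" for r
        using that True False by (cases "r = 0") (auto simp: respond_def Let_def \<tau>_def[symmetric] P_def[symmetric] walk2_start)
      have "visited_by (respond A B i) A K" using le True
        by (intro visit[of "dist P A"]) (auto simp: eq walk2_visits intro: order_trans[OF _ le])
      moreover have "visited_by (respond A B i) B K" using le True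
        by (intro visit[of "dist P A + dist A B"]) (auto simp: eq walk2_visits)
      ultimately show ?thesis by simp
    next
      case nle: False
      have eq: "respond A B i (\<tau> + r) = walk2 P B A r" if "0 \<le> r" for r
        using that nle False by (cases "r = 0") (auto simp: respond_def Let_def \<tau>_def[symmetric] P_def[symmetric] walk2_start)
      have "visited_by (respond A B i) B K" using le nle
        by (intro visit[of "dist P B"]) (auto simp: eq walk2_visits min_def intro: order_trans[OF _ le])
      moreover have "visited_by (respond A B i) A K" using le nle
        by (intro visit[of "dist P B + dist B A"]) (auto simp: eq walk2_visits min_def dist_commute[of A B])
      ultimately show ?thesis by simp
    qed
  qed
qed

lemma dist_cis_same: "\<bar>\<sigma>\<bar> = 1 \<Longrightarrow> dist (cis (\<sigma> * x)) (cis (\<sigma> * y)) = 2 * \<bar>sin ((x - y) / 2)\<bar>"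
proof -
  assume "\<bar>\<sigma>\<bar> = 1"
  then have "\<sigma> = 1 \<or> \<sigma> = - 1" by linarith
  moreover have "(- x - - y) / 2 = - ((x - y) / 2)" by (simp add: field_simps)
  ultimately show ?thesis unfolding dist_cis
    by (elim disjE) (simp_all only: mult_1 mult_minus1 sin_minus abs_minus_cancel)
qed

lemma dist_cis_opposite: "\<bar>\<sigma>\<bar> = 1 \<Longrightarrow> dist (cis (- \<sigma> * x)) (cis (\<sigma> * y)) = 2 * \<bar>sin ((x + y) / 2)\<bar>"
proof -
  assume "\<bar>\<sigma>\<bar> = 1"
  then have "dist (cis (\<sigma> * (- x))) (cis (\<sigma> * y)) = 2 * \<bar>sin ((- x - y) / 2)\<bar>" by (rule dist_cis_same)
  also have "(- x - y) / 2 = - ((x + y) / 2)" by (simp add: field_simps)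
  finally show ?thesis by (simp only: sin_minus abs_minus_cancel mult_minus_right mult_minus_left)
qed

lemma dist_unit_circle_le: "p \<in> unit_circle \<Longrightarrow> q \<in> unit_circle \<Longrightarrow> dist p q \<le> 2"
  using dist_triangle2[of p q 0] by (simp add: unit_circle_def dist_commute)

lemma cis_unit_circle [simp]: "cis x \<in> unit_circle"
  by (simp add: unit_circle_def)

section \<open>Discovery times and the cost in each phase\<close>

locale discovery_order =
  fixes A B :: complex
  assumes A: "A \<in> unit_circle" and B: "B \<in> unit_circle" and order: "\<bar>Arg A\<bar> \<le> \<bar>Arg B\<bar>"
begin

abbreviation "a \<equiv> \<bar>Arg A\<bar>"
abbreviation "b \<equiv> \<bar>Arg B\<bar>"
abbreviation "\<sigma> \<equiv> finder A"
abbreviation "\<beta> \<equiv> ahead A B"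
abbreviation "\<tau> \<equiv> second_time A B"

lemma A_eq: "A = cis (\<sigma> * a)"
  using unit_circle_cis_Arg[OF A] by (simp add: finder_def abs_if)

lemma B_eq: "B = cis (\<sigma> * \<beta>)"
proof (cases "0 \<le> \<sigma> * Arg B")
  case True
  then have "\<sigma> * \<bar>Arg B\<bar> = Arg B" using finder_cases[of A] by (auto simp: abs_if)
  then show ?thesis using True unit_circle_cis_Arg[OF B] by (simp add: ahead_def)
next
  case False
  then have "\<sigma> * (2 * pi - \<bar>Arg B\<bar>) = Arg B + 2 * pi * \<sigma>" using finder_cases[of A] by (auto simp: abs_if algebra_simps)
  moreover have "\<sigma> \<in> \<int>" using finder_cases[of A] by auto
  ultimately show ?thesis using False unit_circle_cis_Arg[OF B]
    by (simp add: ahead_def cis_mult[symmetric] cis_multiple_2pi)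
qed

lemma bounds: "0 \<le> a" "a \<le> b" "b \<le> pi" "a \<le> \<beta>" "\<beta> \<le> 2 * pi - a"
  using order Arg_le_pi[of B] Arg_le_pi[of A] by (auto simp: ahead_def)

lemma sin_a: "0 \<le> sin a"
  using bounds by (intro sin_ge_zero) auto

lemma second_time_ge: "1 + a \<le> \<tau>"
  using bounds sin_a by (auto simp: second_time_def)

lemma first_visit: "side i = \<sigma> \<Longrightarrow> explore A i (1 + a) = A"
  using A_eq bounds by (simp add: explore_start sweep_at)

lemma finder_visited: "side i = \<sigma> \<Longrightarrow> visited_by (explore A i) A \<tau>"
  using first_visit second_time_ge bounds unfolding visited_by_def by (intro bexI[of _ "1 + a"]) auto

lemma explore_finder: "side i = \<sigma> \<Longrightarrow> 1 \<le> t \<Longrightarrow> explore A i t = cis (\<sigma> * (t - 1))"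
  by (simp add: explore_def sweep_ge_1)

lemma explore_late: "fetch_limit \<le> a \<Longrightarrow> 1 \<le> t \<Longrightarrow> explore A i t = cis (side i * (t - 1))"
  by (simp add: explore_def sweep_ge_1)

lemma explore_fetch: "a < fetch_limit \<Longrightarrow> side i = - \<sigma> \<Longrightarrow> explore A i = fetch \<sigma> a"
  using finder_cases[of A] by (auto simp: explore_def)

lemma second_visit: "\<exists>i\<in>{1..2}. explore A i \<tau> = B"
proof (cases "a < fetch_limit")
  case False
  then have \<tau>: "\<tau> = 1 + b" by (simp add: second_time_def)
  have "(if 0 \<le> Arg B then 1 else - 1) = (1 :: real) \<or> (if 0 \<le> Arg B then 1 else - 1) = (- 1 :: real)" by simp
  from finder_side[OF this] obtain i where i: "i \<in> {1..2}" "side i = (if 0 \<le> Arg B then 1 else - 1)" by blast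
  have "explore A i \<tau> = cis (side i * b)" using explore_late[of \<tau> i] False \<tau> by simp
  also have "side i * b = Arg B" by (simp add: i)
  finally show ?thesis using i unit_circle_cis_Arg[OF B] by auto
next
  case True
  show ?thesis
  proof (cases "\<tau> = 1 + \<beta>")
    case True
    obtain i where i: "i \<in> {1..2}" "side i = \<sigma>" using finder_side finder_cases by blast
    then show ?thesis using explore_finder[of i \<tau>] True B_eq bounds by (auto simp: True)
  next
    case False
    have \<tau>: "\<tau> = 1 + (2 * pi - \<beta>) + 4 * sin a"
      using True False by (auto simp: second_time_def min_def split: if_splits)
    obtain i where i: "i \<in> {1..2}" "side i = - \<sigma>" using finder_side[of "- \<sigma>"] finder_cases[of A] by auto
    have "fetch \<sigma> a \<tau> = cis (- \<sigma> * (2 * pi - \<beta>))"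
    proof (cases "\<beta> = 2 * pi - a")
      \<comment> \<open>Boundary case: \<open>B\<close> is where the fetching robot resumes its
        sweep, and that instant still belongs to the chord branch of \<open>fetch\<close>.\<close>
      case True
      have "sin a = 0 \<Longrightarrow> a = 0" using sin_gt_zero[of a] bounds fetch_limit_bounds \<open>a < fetch_limit\<close> by force
      then show ?thesis unfolding fetch_def \<tau> True
        using sin_a cis_sign[of "- \<sigma>" a] bounds by (auto simp: sweep_def)
    next
      case False
      then have "a < 2 * pi - \<beta>" using bounds by simp
      then show ?thesis unfolding fetch_def \<tau> using sin_a by auto
    qed
    also have "- \<sigma> * (2 * pi - \<beta>) = \<sigma> * \<beta> + 2 * pi * (- \<sigma>)" by (simp add: algebra_simps)
    also have "cis \<dots> = B"
    proof -
      have "- \<sigma> \<in> \<int>" using finder_cases[of A] by auto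
      then show ?thesis unfolding cis_mult[symmetric] cis_multiple_2pi[OF \<open>- \<sigma> \<in> \<int>\<close>] using B_eq by simp
    qed
    finally show ?thesis using explore_fetch[OF True i(2)] i(1) by (intro bexI[of _ i]) simp_all
  qed
qed

lemma dist_AB:
  assumes "B = cis (\<sigma> * x)" "a \<le> x" "x \<le> pi"
  shows "dist A B = 2 * sin ((x - a) / 2)"
proof -
  have "dist A B = dist (cis (\<sigma> * a)) (cis (\<sigma> * x))"
    by (rule arg_cong2[where f = dist, OF A_eq assms(1)])
  also have "\<dots> = 2 * \<bar>sin ((a - x) / 2)\<bar>" by (rule dist_cis_same) simp
  also have "(a - x) / 2 = - ((x - a) / 2)" by (simp add: field_simps)
  also have "\<bar>sin (- ((x - a) / 2))\<bar> = sin ((x - a) / 2)"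
    using assms bounds sin_ge_zero[of "(x - a) / 2"] unfolding sin_minus abs_minus_cancel by simp
  finally show ?thesis .
qed

text \<open>A robot that has already found one treasure is at most a diameter away from the other
  when the second is found, for a total of at most \<open>3 + pi\<close>. The critical case is
  \<open>B\<close> on the same side as \<open>A\<close>: the robot from the other side needs both,
  and crosses to \<open>B\<close> before going on to \<open>A\<close>.\<close>

lemma cost_sweep:
  assumes "fetch_limit \<le> a"
  shows "(visited_by (explore A i) A \<tau> \<and> \<tau> + dist (explore A i \<tau>) B \<le> 6.2195) \<or>
      \<tau> + min (dist (explore A i \<tau>) A) (dist (explore A i \<tau>) B) + dist A B \<le> 6.2195"
proof -
  have \<tau>: "\<tau> = 1 + b" using assms by (simp add: second_time_def)
  have P: "explore A i \<tau> = cis (side i * b)" using explore_late[OF assms, of \<tau> i] \<tau> by simp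
  have pi: "3 + pi \<le> 6.2195" using pi_approx by simp
  show ?thesis
  proof (cases "side i = \<sigma>")
    case True
    have "dist (explore A i \<tau>) B \<le> 2" unfolding P using B by (intro dist_unit_circle_le) auto
    then show ?thesis using finder_visited[OF True] bounds pi \<tau> by auto
  next
    case False
    then have P': "explore A i \<tau> = cis (- \<sigma> * b)" unfolding P using side_other by metis
    show ?thesis
    proof (cases "0 \<le> \<sigma> * Arg B")
      case True
      then have \<beta>: "\<beta> = b" by (simp add: ahead_def)
      then have B': "B = cis (\<sigma> * b)" using B_eq by (simp only:)
      have "dist (explore A i \<tau>) B = dist (cis (- \<sigma> * b)) (cis (\<sigma> * b))"
        by (rule arg_cong2[where f = dist, OF P' B'])
      also have "\<dots> = 2 * sin b"
        unfolding dist_cis_opposite[OF finder_abs] using bounds by (simp add: sin_ge_zero)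
      finally have "dist (explore A i \<tau>) B = 2 * sin b" .
      moreover have "dist A B = 2 * sin ((b - a) / 2)" by (rule dist_AB[OF B' bounds(2,3)])
      ultimately show ?thesis using sweep_cost[OF assms bounds(2,3)] \<tau> by (auto simp: min_def)
    next
      case False
      then have \<beta>: "\<beta> = 2 * pi - b" by (simp add: ahead_def)
      have "\<sigma> * \<beta> = - \<sigma> * b + 2 * pi * \<sigma>" unfolding \<beta> by (simp add: algebra_simps)
      then have "B = cis (- \<sigma> * b + 2 * pi * \<sigma>)" using B_eq by (simp only:)
      moreover have "\<sigma> \<in> \<int>" using finder_cases[of A] by auto
      ultimately have "B = cis (- \<sigma> * b)" by (metis cis_mult cis_multiple_2pi mult.right_neutral)
      then have "dist (explore A i \<tau>) B = 0" unfolding P' by simp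
      moreover have "dist A B \<le> 2" using A B by (rule dist_unit_circle_le)
      ultimately show ?thesis using bounds pi \<tau> by (auto simp: min_def)
    qed
  qed
qed

text \<open>If the finder meets \<open>B\<close> itself, nothing is added to the time of discovery.
  Otherwise the fetching robot meets \<open>B\<close> after resuming its sweep, and the mean arc
  \<open>q\<close> reduces the cost to \<open>evacuation_cost\<close>.\<close>

lemma cost_finder:
  assumes fetch: "a < fetch_limit" and i: "side i = \<sigma>"
  shows "\<tau> + dist (explore A i \<tau>) B \<le> 6.2195"
proof -
  have \<tau>1: "1 \<le> \<tau>" using second_time_ge bounds by linarith
  have "dist (explore A i \<tau>) B = dist (cis (\<sigma> * (\<tau> - 1))) (cis (\<sigma> * \<beta>))"
    by (rule arg_cong2[where f = dist, OF explore_finder[OF i \<tau>1] B_eq])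
  also have "\<dots> = 2 * \<bar>sin ((\<tau> - 1 - \<beta>) / 2)\<bar>" by (rule dist_cis_same) simp
  finally have d: "dist (explore A i \<tau>) B = 2 * \<bar>sin ((\<tau> - 1 - \<beta>) / 2)\<bar>" .
  have s1: "sin a \<le> 69652 / 100000" using sin_le_of_less_fetch_limit[OF bounds(1) fetch] .
  show ?thesis
  proof (cases "\<tau> = 1 + \<beta>")
    case True
    then have "\<beta> \<le> 2 * pi - \<beta> + 4 * sin a" using fetch by (auto simp: second_time_def min_def split: if_splits)
    then have "\<beta> \<le> pi + 2 * (69652 / 100000)" using s1 by linarith
    moreover have "pi \<le> 32 / 10" using pi_approx by simp
    moreover have "dist (explore A i \<tau>) B = 0" unfolding d by (simp add: True)
    ultimately have "\<tau> + dist (explore A i \<tau>) B \<le> 62195 / 10000" using True by linarith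
    then show ?thesis by simp
  next
    case False
    then have \<tau>: "\<tau> = 1 + (2 * pi - \<beta>) + 4 * sin a" "(2 * pi - \<beta>) + 4 * sin a < \<beta>"
      using fetch by (auto simp: second_time_def min_def split: if_splits)
    define q where "q = 2 * pi - \<beta> + 2 * sin a"
    have q: "0 \<le> q" "q \<le> pi" using \<tau>(2) bounds sin_a by (auto simp: q_def)
    have "(\<tau> - 1 - \<beta>) / 2 = - (pi - q)" unfolding \<tau>(1) q_def by (simp add: field_simps)
    then have "\<bar>sin ((\<tau> - 1 - \<beta>) / 2)\<bar> = \<bar>sin q\<bar>" by (simp only: sin_minus abs_minus_cancel sin_pi_minus)
    also have "\<dots> = sin q" using sin_ge_zero[OF q] by simp
    finally have "dist (explore A i \<tau>) B = 2 * sin q" unfolding d by simp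
    then have "\<tau> + dist (explore A i \<tau>) B = 1 + 2 * sin a + q + 2 * sin q"
      using \<tau>(1) by (simp add: q_def)
    then show ?thesis using evacuation_cost[OF bounds(1) fetch q] by simp
  qed
qed

lemma fetch_chord:
  assumes "1 + a \<le> t" "t \<le> 1 + a + 4 * sin a"
  shows "fetch \<sigma> a t = Complex (cos a) (\<sigma> * (sin a - \<bar>t - (1 + a + 2 * sin a)\<bar>))"
proof (cases "t = 1 + a")
  case True
  have "fetch \<sigma> a t = cis (- \<sigma> * a)" using True bounds by (simp add: fetch_def sweep_at)
  then show ?thesis using cis_sign[of "- \<sigma>" a] sin_a True by simp
qed (use assms in \<open>auto simp: fetch_def\<close>)

lemma fetch_visits:
  assumes fetch: "a < fetch_limit" and i: "side i = - \<sigma>" and t: "1 + a + 2 * sin a \<le> t"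
  shows "visited_by (explore A i) A t"
proof -
  have "explore A i (1 + a + 2 * sin a) = Complex (cos a) (\<sigma> * sin a)"
    unfolding explore_fetch[OF fetch i] using sin_a by (subst fetch_chord) auto
  also have "\<dots> = cis (\<sigma> * a)" by (rule cis_sign[symmetric]) simp
  also have "\<dots> = A" by (rule A_eq[symmetric])
  finally show ?thesis using t bounds sin_a unfolding visited_by_def
    by (intro bexI[of _ "1 + a + 2 * sin a"]) auto
qed

text \<open>Completing the trip to \<open>A\<close>, which ends at \<open>1 + a + 2 * sin a\<close>,
  and then crossing to \<open>B\<close> costs at most one diameter more.\<close>

lemma cost_fetcher_out:
  assumes fetch: "a < fetch_limit" and i: "side i = - \<sigma>" and \<tau>: "\<tau> \<le> 1 + a + 2 * sin a"
  shows "\<tau> + min (dist (explore A i \<tau>) A) (dist (explore A i \<tau>) B) + dist A B \<le> 6.2195"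
proof -
  have "explore A i \<tau> = Complex (cos a) (\<sigma> * (sin a - \<bar>\<tau> - (1 + a + 2 * sin a)\<bar>))"
    unfolding explore_fetch[OF fetch i] using second_time_ge \<tau> sin_a by (intro fetch_chord) auto
  moreover have "A = Complex (cos a) (\<sigma> * sin a)"
    by (rule trans[OF A_eq cis_sign]) simp
  ultimately have "dist (explore A i \<tau>) A = dist (Complex (cos a) (\<sigma> * (sin a - \<bar>\<tau> - (1 + a + 2 * sin a)\<bar>))) (Complex (cos a) (\<sigma> * sin a))"
    by (rule arg_cong2[where f = dist])
  also have "\<dots> = \<bar>\<sigma> * (sin a - \<bar>\<tau> - (1 + a + 2 * sin a)\<bar>) - \<sigma> * sin a\<bar>" by (simp add: dist_norm cmod_def)
  also have "\<dots> = \<bar>\<sigma>\<bar> * \<bar>(sin a - \<bar>\<tau> - (1 + a + 2 * sin a)\<bar>) - sin a\<bar>"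
    unfolding right_diff_distrib[symmetric] abs_mult ..
  also have "\<dots> = 1 + a + 2 * sin a - \<tau>" using \<tau> by simp
  finally have "\<tau> + min (dist (explore A i \<tau>) A) (dist (explore A i \<tau>) B) \<le> 1 + a + 2 * sin a" by linarith
  moreover have "dist A B \<le> 2" using A B by (rule dist_unit_circle_le)
  moreover have "sin a \<le> 69652 / 100000" "a \<le> 77053 / 100000"
    using sin_le_of_less_fetch_limit[OF bounds(1) fetch] fetch by (auto simp: fetch_limit_def)
  ultimately have "\<tau> + min (dist (explore A i \<tau>) A) (dist (explore A i \<tau>) B) + dist A B \<le> 62195 / 10000" by linarith
  then show ?thesis by simp
qed

text \<open>The position is a convex combination of the ends of the chord, so its distance to
  \<open>B\<close> is at most the same combination of theirs. Bounding the distance from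
  \<open>A\<close> by 2 leads to \<open>return_cost\<close>.\<close>

lemma cost_fetcher_back:
  assumes fetch: "a < fetch_limit" and i: "side i = - \<sigma>"
    and \<tau>: "1 + a + 2 * sin a < \<tau>" "\<tau> \<le> 1 + a + 4 * sin a" and \<tau>\<beta>: "\<tau> = 1 + \<beta>"
  shows "\<tau> + dist (explore A i \<tau>) B \<le> 6.2195"
proof -
  define s where "s = sin a"
  have s: "0 < s" using \<tau> unfolding s_def by linarith
  define l where "l = (\<beta> - a - 2 * s) / (2 * s)"
  have \<beta>: "\<beta> = a + 2 * s * (1 + l)" using s by (simp add: l_def field_simps)
  have l: "0 \<le> l" "l \<le> 1" using s \<tau> \<tau>\<beta> by (auto simp: l_def s_def[symmetric] field_simps)
  have A': "A = Complex (cos a) (\<sigma> * s)"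
    unfolding s_def by (rule trans[OF A_eq cis_sign]) simp
  have A'': "cis (- \<sigma> * a) = Complex (cos a) (- (\<sigma> * s))"
    unfolding s_def using cis_sign[of "- \<sigma>" a] by simp
  have "explore A i \<tau> = Complex (cos a) (\<sigma> * (s - \<bar>\<tau> - (1 + a + 2 * s)\<bar>))"
    unfolding explore_fetch[OF fetch i] s_def using second_time_ge \<tau> by (intro fetch_chord) auto
  also have "\<bar>\<tau> - (1 + a + 2 * s)\<bar> = 2 * s * l"
    using \<tau>(1) unfolding s_def[symmetric] \<tau>\<beta> \<beta> by (simp add: algebra_simps)
  also have "Complex (cos a) (\<sigma> * (s - 2 * s * l)) = of_real (1 - l) * Complex (cos a) (\<sigma> * s) + of_real l * Complex (cos a) (- (\<sigma> * s))"
    by (simp add: complex_eq_iff algebra_simps)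
  finally have P: "explore A i \<tau> = of_real (1 - l) * A + of_real l * cis (- \<sigma> * a)"
    unfolding A'[symmetric] A''[symmetric] .
  have "explore A i \<tau> - B = of_real (1 - l) * (A - B) + of_real l * (cis (- \<sigma> * a) - B)"
    unfolding P by (simp add: algebra_simps)
  then have "dist (explore A i \<tau>) B \<le> norm (of_real (1 - l) * (A - B)) + norm (of_real l * (cis (- \<sigma> * a) - B))"
    unfolding dist_norm by (simp only: norm_triangle_ineq)
  also have "\<dots> = (1 - l) * dist A B + l * dist (cis (- \<sigma> * a)) B"
    using l by (simp only: norm_mult norm_of_real dist_norm abs_of_nonneg diff_ge_0_iff_ge)
  also have "dist (cis (- \<sigma> * a)) B = dist (cis (- \<sigma> * a)) (cis (\<sigma> * \<beta>))"
    by (rule arg_cong[where f = "dist (cis (- \<sigma> * a))", OF B_eq])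
  also have "\<dots> = 2 * \<bar>sin ((a + \<beta>) / 2)\<bar>" by (rule dist_cis_opposite) simp
  also have "(a + \<beta>) / 2 = a + s * (1 + l)" unfolding \<beta> by (simp add: field_simps)
  also have "\<bar>sin (a + s * (1 + l))\<bar> = sin (a + s * (1 + l))"
  proof -
    have "0 \<le> s * (1 + l)" "s * (1 + l) \<le> s * 2" using s l by (auto intro: mult_left_mono)
    moreover have "s \<le> 69652 / 100000" "a \<le> 77053 / 100000"
      using sin_le_of_less_fetch_limit[OF bounds(1) fetch] fetch by (auto simp: fetch_limit_def s_def)
    moreover have "3 \<le> pi" using pi_approx by simp
    ultimately have "0 \<le> a + s * (1 + l)" "a + s * (1 + l) \<le> pi" using bounds(1) by linarith+
    then show ?thesis using sin_ge_zero by simp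
  qed
  also have "(1 - l) * dist A B \<le> (1 - l) * 2"
    using l dist_unit_circle_le[OF A B] by (intro mult_left_mono) auto
  finally have "dist (explore A i \<tau>) B \<le> (1 - l) * 2 + l * (2 * sin (a + s * (1 + l)))" by simp
  then show ?thesis using return_cost[OF bounds(1) fetch l] unfolding \<tau>\<beta> \<beta> s_def by (simp add: algebra_simps)
qed

text \<open>If the finder meets \<open>B\<close>, the chord between the robots is that of
  \<open>evacuation_cost\<close>; otherwise this robot is itself at \<open>B\<close>, and only the
  discovery time has to be bounded.\<close>

lemma cost_fetcher_resumed:
  assumes fetch: "a < fetch_limit" and i: "side i = - \<sigma>" and \<tau>: "1 + a + 4 * sin a \<le> \<tau>"
  shows "\<tau> + dist (explore A i \<tau>) B \<le> 6.2195"
proof -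
  have "explore A i \<tau> = cis (- \<sigma> * (\<tau> - 1 - 4 * sin a))"
  proof (cases "\<tau> = 1 + a + 4 * sin a")
    case True
    then show ?thesis unfolding explore_fetch[OF fetch i]
      using sin_a cis_sign[of "- \<sigma>" a] by (subst fetch_chord) auto
  next
    case False
    then show ?thesis unfolding explore_fetch[OF fetch i] fetch_def using \<tau> sin_a by auto
  qed
  from arg_cong2[where f = dist, OF this B_eq]
  have d: "dist (explore A i \<tau>) B = 2 * \<bar>sin ((\<tau> - 1 - 4 * sin a + \<beta>) / 2)\<bar>"
    unfolding dist_cis_opposite[OF finder_abs] .
  have s1: "sin a \<le> 69652 / 100000" using sin_le_of_less_fetch_limit[OF bounds(1) fetch] .
  show ?thesis
  proof (cases "\<tau> = 1 + \<beta>")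
    case True
    then have le: "\<beta> \<le> 2 * pi - \<beta> + 4 * sin a" using fetch by (auto simp: second_time_def min_def split: if_splits)
    define q where "q = \<beta> - 2 * sin a"
    have q: "0 \<le> q" "q \<le> pi" using le \<tau> True sin_a bounds by (auto simp: q_def)
    have "(\<tau> - 1 - 4 * sin a + \<beta>) / 2 = q" unfolding True q_def by (simp add: field_simps)
    then have "dist (explore A i \<tau>) B = 2 * sin q"
      unfolding d using sin_ge_zero[OF q] by simp
    then have "\<tau> + dist (explore A i \<tau>) B = 1 + 2 * sin a + q + 2 * sin q"
      using True by (simp add: q_def)
    then show ?thesis using evacuation_cost[OF bounds(1) fetch q] by simp
  next
    case False
    then have \<tau>': "\<tau> = 1 + (2 * pi - \<beta>) + 4 * sin a" "(2 * pi - \<beta>) + 4 * sin a < \<beta>"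
      using fetch by (auto simp: second_time_def min_def split: if_splits)
    have "(\<tau> - 1 - 4 * sin a + \<beta>) / 2 = pi" unfolding \<tau>'(1) by simp
    then have "dist (explore A i \<tau>) B = 0" unfolding d by simp
    moreover have "\<tau> \<le> 1 + pi + 2 * (69652 / 100000)" using \<tau>' s1 by linarith
    moreover have "pi \<le> 32 / 10" using pi_approx by simp
    ultimately have "\<tau> + dist (explore A i \<tau>) B \<le> 62195 / 10000" by linarith
    then show ?thesis by simp
  qed
qed

lemma cost:
  "(visited_by (explore A i) A \<tau> \<and> \<tau> + dist (explore A i \<tau>) B \<le> 6.2195) \<or>
    \<tau> + min (dist (explore A i \<tau>) A) (dist (explore A i \<tau>) B) + dist A B \<le> 6.2195"
proof (cases "a < fetch_limit")
  case False
  then show ?thesis by (intro cost_sweep) simp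
next
  case fetch: True
  show ?thesis
  proof (cases "side i = \<sigma>")
    case True
    show ?thesis using cost_finder[OF fetch True] finder_visited[OF True] by blast
  next
    case False
    then have i: "side i = - \<sigma>" by (rule side_other)
    consider "\<tau> \<le> 1 + a + 2 * sin a" | "1 + a + 4 * sin a \<le> \<tau>"
      | "1 + a + 2 * sin a < \<tau>" "\<tau> < 1 + a + 4 * sin a" by linarith
    then show ?thesis
    proof cases
      case 1
      then show ?thesis using cost_fetcher_out[OF fetch i] by blast
    next
      case 2
      moreover have "1 + a + 2 * sin a \<le> \<tau>" using 2 sin_a by linarith
      ultimately show ?thesis using cost_fetcher_resumed[OF fetch i] fetch_visits[OF fetch i] by blast
    next
      case 3
      \<comment> \<open>By \<open>\<beta> \<le> 2 * pi - a\<close> the delayed robot's arrival time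
        at \<open>B\<close> cannot be before its return to the circle at
        \<open>1 + a + 4 * sin a\<close>, so the minimum is the finder's arrival.\<close>
      have "\<tau> = 1 + \<beta>"
        using fetch 3(2) bounds by (auto simp: second_time_def min_def split: if_splits)
      then show ?thesis using cost_fetcher_back[OF fetch i 3(1)] 3 fetch_visits[OF fetch i] by simp
    qed
  qed
qed

end

section \<open>Validity of the strategy\<close>

definition found_before :: "complex \<Rightarrow> complex \<Rightarrow> bool" where
  "found_before p q \<longleftrightarrow> \<bar>Arg p\<bar> < \<bar>Arg q\<bar> \<or> (\<bar>Arg p\<bar> = \<bar>Arg q\<bar> \<and> Arg q \<le> Arg p)"

definition first_found :: "(nat \<Rightarrow> complex) \<Rightarrow> complex" where
  "first_found T = (if found_before (T 1) (T 2) then T 1 else T 2)"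

definition second_found :: "(nat \<Rightarrow> complex) \<Rightarrow> complex" where
  "second_found T = (if found_before (T 1) (T 2) then T 2 else T 1)"

definition sweep_strategy :: "(nat \<Rightarrow> complex) \<Rightarrow> nat \<Rightarrow> real \<Rightarrow> complex" where
  "sweep_strategy T = respond (first_found T) (second_found T)"

lemma found_treasures:
  "{#first_found T, second_found T#} = {#T 1, T 2#}"
  by (auto simp: first_found_def second_found_def add_mset_commute)

lemma found_before_found: "found_before (first_found T) (second_found T)"
  by (auto simp: first_found_def second_found_def found_before_def)

lemma treasures_on_circle: "T \<in> placements 2 \<Longrightarrow> j \<in> {1..2} \<Longrightarrow> T j \<in> unit_circle"
  by (auto simp: placements_def)

lemma found_on_circle:
  assumes "T \<in> placements 2"
  shows "first_found T \<in> unit_circle" "second_found T \<in> unit_circle"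
  using treasures_on_circle[OF assms, of 1] treasures_on_circle[OF assms, of 2]
  by (auto simp: first_found_def second_found_def)

lemma discovery_order_found:
  assumes "T \<in> placements 2"
  shows "discovery_order (first_found T) (second_found T)"
  using found_on_circle[OF assms] found_before_found[of T]
  by unfold_locales (auto simp: found_before_def)

text \<open>The robots learn locations but no indices, so the order must be recoverable from the
  multiset. If the pair were swapped, each point would be found before the other; as ties are broken
  by \<open>Arg\<close>, this forces equal arguments and hence equal points.\<close>

lemma found_unique:
  assumes "T \<in> placements 2" "T' \<in> placements 2"
    and eq: "{#first_found T, second_found T#} = {#first_found T', second_found T'#}"
  shows "first_found T = first_found T' \<and> second_found T = second_found T'"
proof -
  have "first_found T = first_found T' \<and> second_found T = second_found T' \<or>
      first_found T = second_found T' \<and> second_found T = first_found T'"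
    using eq by (auto simp: add_eq_conv_ex add_mset_eq_singleton_iff)
  then show ?thesis
  proof
    assume swap: "first_found T = second_found T' \<and> second_found T = first_found T'"
    then have "found_before (second_found T') (first_found T')" using found_before_found[of T] by simp
    then have "Arg (first_found T') = Arg (second_found T')"
      using found_before_found[of T'] by (auto simp: found_before_def)
    then have "first_found T' = second_found T'"
      using unit_circle_cis_Arg found_on_circle[OF assms(2)] by metis
    then show ?thesis using swap by simp
  qed
qed

lemma index_found:
  assumes "j \<in> {1..2}"
  shows "T j = first_found T \<or> T j = second_found T"
proof -
  have "j = 1 \<or> j = 2" using assms by auto
  then show ?thesis by (auto simp: first_found_def second_found_def)
qed

lemma found_index: "\<exists>j\<in>{1..2}. T j = first_found T"
  by (auto simp: first_found_def intro: bexI[of _ 1] bexI[of _ 2])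

lemma image_two: "image_mset T (mset_set {1..2 :: nat}) = {#first_found T, second_found T#}"
proof -
  have "{1..2 :: nat} = {1, 2}" by auto
  then show ?thesis unfolding found_treasures by simp
qed

lemma discovered_subset: "discovered 2 2 X T t \<subseteq># {#first_found T, second_found T#}"
  unfolding discovered_def image_two[symmetric]
  by (intro image_mset_subseteq_mono subset_imp_msubset_mset_set) auto

lemma first_visited:
  assumes T: "T \<in> placements 2" and t: "1 + \<bar>Arg (first_found T)\<bar> \<le> t"
  shows "\<exists>i\<in>{1..2}. visited_by (sweep_strategy T i) (first_found T) t"
proof -
  interpret discovery_order "first_found T" "second_found T" using T by (rule discovery_order_found)
  obtain i where i: "i \<in> {1..2}" "side i = finder (first_found T)" using finder_side finder_cases by blast
  have "visited_by (explore (first_found T) i) (first_found T) (1 + a)"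
    using first_visit[OF i(2)] bounds(1) unfolding visited_by_def by (intro bexI[of _ "1 + a"]) auto
  then have "visited_by (sweep_strategy T i) (first_found T) (1 + a)"
    unfolding sweep_strategy_def using second_time_ge by (rule respond_visited_early)
  then show ?thesis using i(1) t visited_by_mono by blast
qed

lemma second_visited:
  assumes T: "T \<in> placements 2" and t: "second_time (first_found T) (second_found T) \<le> t"
  shows "\<exists>i\<in>{1..2}. visited_by (sweep_strategy T i) (second_found T) t"
proof -
  interpret discovery_order "first_found T" "second_found T" using T by (rule discovery_order_found)
  obtain i where i: "i \<in> {1..2}" "explore (first_found T) i \<tau> = second_found T" using second_visit by blast
  have "visited_by (explore (first_found T) i) (second_found T) \<tau>"
    using i(2) second_time_ge bounds(1) unfolding visited_by_def by (intro bexI[of _ \<tau>]) auto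
  then have "visited_by (sweep_strategy T i) (second_found T) \<tau>"
    unfolding sweep_strategy_def by (rule respond_visited_early) simp
  then show ?thesis using i(1) t visited_by_mono by blast
qed

lemma discovered_first:
  assumes T: "T \<in> placements 2" and t: "1 + \<bar>Arg (first_found T)\<bar> \<le> t"
  shows "first_found T \<in># discovered 2 2 (sweep_strategy T) T t"
proof -
  obtain j where j: "j \<in> {1..2}" "T j = first_found T" using found_index by blast
  then have "j \<in> {j \<in> {1..2}. \<exists>i\<in>{1..2}. visited_by (sweep_strategy T i) (T j) t}"
    using first_visited[OF T t] by simp
  then show ?thesis unfolding discovered_def using j(2) by (auto intro!: image_eqI[of _ _ j])
qed

lemma discovered_both:
  assumes T: "T \<in> placements 2" and t: "second_time (first_found T) (second_found T) \<le> t"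
  shows "discovered 2 2 (sweep_strategy T) T t = {#first_found T, second_found T#}"
proof -
  interpret discovery_order "first_found T" "second_found T" using T by (rule discovery_order_found)
  have "1 + a \<le> t" using t second_time_ge by linarith
  have "\<exists>i\<in>{1..2}. visited_by (sweep_strategy T i) (T j) t" if "j \<in> {1..2}" for j
    using index_found[OF that, of T] first_visited[OF T \<open>1 + a \<le> t\<close>] second_visited[OF T t] by metis
  then have "{j \<in> {1..2}. \<exists>i\<in>{1..2}. visited_by (sweep_strategy T i) (T j) t} = {1..2}" by blast
  then show ?thesis unfolding discovered_def by (simp only: image_two)
qed

lemma sweep_strategy_early:
  assumes "T \<in> placements 2" "t \<le> 1 + \<bar>Arg (first_found T)\<bar>"
  shows "sweep_strategy T i t = sweep (side i) t"
proof -
  interpret discovery_order "first_found T" "second_found T" using assms(1) by (rule discovery_order_found)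
  have "t \<le> \<tau>" using assms(2) second_time_ge by linarith
  then show ?thesis unfolding sweep_strategy_def using assms(2) by (simp add: respond_early explore_start)
qed

text \<open>The record at time \<open>t\<close> alone already determines the positions. Once one run
  has made its first discovery, that location is in the record of the other, so the other has made
  its first discovery too. If the first locations differ, the record contains both treasures of
  either run; if one run has reached its second time, the record is complete. In these two cases the
  pairs agree by \<open>found_unique\<close>, and otherwise both runs follow the same
  \<open>explore\<close>.\<close>

lemma nonanticipation:
  assumes T: "T \<in> placements 2" "T' \<in> placements 2"
    and rec: "discovered 2 2 (sweep_strategy T) T t = discovered 2 2 (sweep_strategy T') T' t"
  shows "sweep_strategy T i t = sweep_strategy T' i t"
proof -
  let ?D = "discovered 2 2 (sweep_strategy T) T t"
  have sub: "?D \<subseteq># {#first_found T, second_found T#}" "?D \<subseteq># {#first_found T', second_found T'#}"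
    using discovered_subset[of "sweep_strategy T" T t] discovered_subset[of "sweep_strategy T'" T' t] rec by auto
  have same: "sweep_strategy T i t = sweep_strategy T' i t"
    if "{#first_found T, second_found T#} = {#first_found T', second_found T'#}"
    using found_unique[OF T that] by (simp add: sweep_strategy_def)
  have le: "\<bar>Arg (first_found T)\<bar> \<le> \<bar>Arg (second_found T)\<bar>" "\<bar>Arg (first_found T')\<bar> \<le> \<bar>Arg (second_found T')\<bar>"
    using discovery_order_found[OF T(1)] discovery_order_found[OF T(2)] by (auto simp: discovery_order_def)
  show ?thesis
  proof (cases "t \<le> 1 + \<bar>Arg (first_found T)\<bar> \<and> t \<le> 1 + \<bar>Arg (first_found T')\<bar>")
    case True
    then show ?thesis using sweep_strategy_early T by simp
  next
    case False
    have 1: "\<bar>Arg (first_found T')\<bar> \<le> \<bar>Arg (first_found T)\<bar>" if "1 + \<bar>Arg (first_found T)\<bar> \<le> t"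
    proof -
      have "first_found T \<in># {#first_found T', second_found T'#}"
        using discovered_first[OF T(1) that] sub(2) by (rule mset_subset_eqD[rotated])
      then show ?thesis using le by auto
    qed
    have 2: "\<bar>Arg (first_found T)\<bar> \<le> \<bar>Arg (first_found T')\<bar>" if "1 + \<bar>Arg (first_found T')\<bar> \<le> t"
    proof -
      have "first_found T' \<in># ?D" using discovered_first[OF T(2) that] rec by simp
      then have "first_found T' \<in># {#first_found T, second_found T#}"
        using sub(1) by (rule mset_subset_eqD[rotated])
      then show ?thesis using le by auto
    qed
    have late: "1 + \<bar>Arg (first_found T)\<bar> \<le> t" "1 + \<bar>Arg (first_found T')\<bar> \<le> t" using False 1 2 by linarith+
    have in1: "first_found T \<in># ?D" using discovered_first[OF T(1) late(1)] .
    have in2: "first_found T' \<in># ?D" using discovered_first[OF T(2) late(2)] rec by simp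
    show ?thesis
    proof (cases "t < second_time (first_found T) (second_found T) \<and> t < second_time (first_found T') (second_found T')")
      case True
      show ?thesis
      proof (cases "first_found T = first_found T'")
        case True
        then show ?thesis
          using \<open>t < second_time (first_found T) (second_found T) \<and> _\<close> by (simp add: sweep_strategy_def respond_early)
      next
        case False
        have "first_found T = second_found T'" "first_found T' = second_found T"
          using mset_subset_eqD[OF sub(2) in1] mset_subset_eqD[OF sub(1) in2] False by auto
        then have "{#first_found T, second_found T#} = {#first_found T', second_found T'#}"
          by (simp add: add_mset_commute)
        then show ?thesis by (rule same)
      qed
    next
      case False
      have full: "M = N" if "M \<subseteq># N" "size M = size N" for M N :: "complex multiset"
        using that by (metis mset_subset_size nat_neq_iff subset_mset.le_less)
      have "?D = {#first_found T, second_found T#} \<or> ?D = {#first_found T', second_found T'#}"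
        using False discovered_both[OF T(1), of t] discovered_both[OF T(2), of t] rec by auto
      then have "{#first_found T, second_found T#} = {#first_found T', second_found T'#}"
        using sub full[of "{#first_found T, second_found T#}" "{#first_found T', second_found T'#}"]
          full[of "{#first_found T', second_found T'#}" "{#first_found T, second_found T#}"] by auto
      then show ?thesis by (rule same)
    qed
  qed
qed

lemma sweep_strategy_valid: "sweep_strategy \<in> strategies 2 2"
  unfolding strategies_def
proof (intro CollectI conjI ballI allI impI)
  fix T assume T: "T \<in> placements 2"
  interpret discovery_order "first_found T" "second_found T" using T by (rule discovery_order_found)
  show "admissible_motion 2 (sweep_strategy T)"
    unfolding admissible_motion_def
  proof (intro ballI conjI)
    fix i :: nat
    have "sweep_strategy T i 0 = sweep (side i) 0" using bounds by (intro sweep_strategy_early T) auto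
    then show "sweep_strategy T i 0 = 0" by (simp add: sweep_def)
    show "1-lipschitz_on {0..} (sweep_strategy T i)"
      unfolding sweep_strategy_def using second_time_ge bounds(1) by (intro respond_lipschitz) linarith
  qed
next
  fix T T' t i assume "T \<in> placements 2" "T' \<in> placements 2" "(0::real) \<le> t"
    and "\<forall>s\<in>{0..t}. discovered 2 2 (sweep_strategy T) T s = discovered 2 2 (sweep_strategy T') T' s"
  then show "sweep_strategy T i t = sweep_strategy T' i t" by (intro nonanticipation) auto
qed

lemma rho_upper: "rho 2 2 \<le> ereal 6.2195"
proof -
  have "completion_time 2 2 (sweep_strategy T) T \<le> ereal 6.2195" if T: "T \<in> placements 2" for T
  proof -
    interpret discovery_order "first_found T" "second_found T" using T by (rule discovery_order_found)
    have "0 \<le> \<tau>" using second_time_ge bounds(1) by linarith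
    then have "visited_by (sweep_strategy T i) (first_found T) 6.2195 \<and> visited_by (sweep_strategy T i) (second_found T) 6.2195" for i
      unfolding sweep_strategy_def by (rule respond_visits[OF _ cost])
    then have "visited_by (sweep_strategy T i) (T j) 6.2195" if "j \<in> {1..2}" for i j
      using index_found[OF that, of T] by auto
    then show ?thesis unfolding completion_time_def by (intro INF_lower) auto
  qed
  then have "(SUP T\<in>placements 2. completion_time 2 2 (sweep_strategy T) T) \<le> ereal 6.2195"
    by (rule SUP_least)
  moreover have "rho 2 2 \<le> (SUP T\<in>placements 2. completion_time 2 2 (sweep_strategy T) T)"
    unfolding rho_def using sweep_strategy_valid by (rule INF_lower)
  ultimately show ?thesis by (rule order_trans[rotated])
qed

theorem theorem19:
  "ereal (1 + pi / 3 + path_const 2) \<le> rho 2 2 \<and> rho 2 2 \<le> ereal 6.2195 \<and>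
   \<bar>(1 + pi / 3 + path_const 2) - 5.5675\<bar> < 0.00005"
proof (intro conjI)
  have pi: "3.1415926 \<le> pi" "pi \<le> 3.1415927" using pi_approx by auto
  have "1 + pi / 3 + path_const 2 \<le> 5.568" using pi path_const_bounds by simp
  then show "ereal (1 + pi / 3 + path_const 2) \<le> rho 2 2"
    using rho_lower by (meson ereal_less_eq(3) order_trans)
  show "rho 2 2 \<le> ereal 6.2195" by (rule rho_upper)
  show "\<bar>(1 + pi / 3 + path_const 2) - 5.5675\<bar> < 0.00005"
    using pi path_const_bounds by (simp add: abs_less_iff)
qed

end
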